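(* Let $p_0=p_{f_0}\in\mathcal{P}$ with $f_0\in\mathcal{F}$, and suppose assumptions (A)–(E) (listed in the context) hold with $\varepsilon=2$. Let $f_{g,\lambda,n}=-g_\lambda(\hat C)\hat\xi$ be constructed from i.i.d. samples $X_1,\dots,X_n$ from $p_0$, with $\lambda=\lambda_n$ required to satisfy $\lambda\ge n^{-1/2}$. Then, as $n\to\infty$: (i) If $f_0\in\mathcal{R}(C^\beta)$ for some $\beta>0$, then $$\|f_{g,\lambda,n}-f_0\|_{\mathcal{H}}=O_{p_0}(\theta_n),\qquad \theta_n:=n^{-\min\left\{\frac{\beta}{2(\beta+1)},\frac{\eta_0}{2(\eta_0+1)}\right\}},$$ with $\lambda=n^{-\max\left\{\frac1{2(\beta+1)},\frac1{2(\eta_0+1)}\right\}}$. In addition, if $\|k\|_\infty:=\sup_{x\in\Omega}k(x,x)<\infty$, then for any $1<r\le\infty$ with $q_0\in L^1(\Omega)\cap L^r(\Omega)$, $\|p_{f_{g,\lambda,n}}-p_0\|_{L^r(\Omega)}=O_{p_0}(\theta_n)$, $h(p_0,p_{f_{g,\lambda,n}})=O_{p_0}(\theta_n)$ and $KL(p_0\|p_{f_{g,\lambda,n}})=O_{p_0}(\theta_n^2)$. (ii) If $f_0\in\mathcal{R}(C^\beta)$ for some $\beta\ge0$, then $$J(p_0\|p_{f_{g,\lambda,n}})=O_{p_0}\left(n^{-\frac{\min\{2\beta+1,\,2\eta_0\}}{\min\{2\beta+2,\,2\eta_0+1\}}}\right)$$ with $\lambda=n^{-\frac1{\min\{2\beta+2,\,2\eta_0+1\}}}$.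 (iii) If $\|C^{-1}\|<\infty$, then $\|f_{g,\lambda,n}-f_0\|_{\mathcal{H}}=O_{p_0}(\theta_n)$ and $J(p_0\|p_{f_{g,\lambda,n}})=O_{p_0}(\theta_n^2)$ with $\theta_n=n^{-1/2}$ and $\lambda=n^{-\frac1{\min\{2,\,2\eta_0\}}}$.
   Context: Family: $q_0$ is a probability density on $\Omega\subseteq\mathbb{R}^d$; $\mathcal{H}$ is the RKHS on $\Omega$ with reproducing kernel $k$; $A(f):=\log\int_\Omega e^{f}q_0\,dx$; $\mathcal{F}:=\{f\in\mathcal{H}:e^{A(f)}<\infty\}$; $p_f:=e^{f-A(f)}q_0$; $\mathcal{P}:=\{p_f:f\in\mathcal{F}\}$. Distances: $J(p\|q)=\frac12\int_\Omega p\,\|\nabla\log p-\nabla\log q\|_2^2\,dx$ (since $\nabla\log p_f=\nabla f+\nabla\log q_0$ does not involve the normalizing constant, $J(p_0\|p_f)=\frac12\int_\Omega p_0\|\nabla f_0-\nabla f\|_2^2\,dx$, which is meaningful for every $f\in\mathcal{H}$); $KL(p\|q)=\int p\log\frac pq\,dx$; $h(p,q)=\|\sqrt p-\sqrt q\|_{L^2(\Omega)}$. Derivatives: $[d]=\{1,\dots,d\}$; for $k$ on $\Omega\times\Omega$, $\partial_i$ and $\partial_{i+d}$ denote partial derivatives in the $i$-th coordinate of the first and second argument, respectively; $\partial_ik(x,\cdot)$ and $\partial_i^2k(x,\cdot)$ (derivatives in the first argument) are elements of $\mathcal{H}$; $\partial^{\alpha,\alpha}k:=\partial_1^{\alpha_1}\cdots\partial_d^{\alpha_d}\partial_{1+d}^{\alpha_1}\cdots\partial_{2d}^{\alpha_d}k$.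 For $u,v\in\mathcal{H}$, $(u\otimes v)w=u\langle v,w\rangle_{\mathcal{H}}$. Operators: $C:=\int_\Omega p_0(x)\sum_{i=1}^d\partial_ik(x,\cdot)\otimes\partial_ik(x,\cdot)\,dx$ (positive self-adjoint trace-class on $\mathcal{H}$); $\hat C:=\frac1n\sum_{a=1}^n\sum_{i=1}^d\partial_ik(X_a,\cdot)\otimes\partial_ik(X_a,\cdot)$; $\hat\xi:=\frac1n\sum_{a=1}^n\sum_{i=1}^d\left(\partial_ik(X_a,\cdot)\,\partial_i\log q_0(X_a)+\partial_i^2k(X_a,\cdot)\right)$. $g_\lambda(\hat C)$ is defined by functional calculus: $g_\lambda(\hat C)=\sum_ig_\lambda(\hat\alpha_i)\langle\cdot,\hat\phi_i\rangle_{\mathcal{H}}\hat\phi_i$ with $(\hat\alpha_i)$, $(\hat\phi_i)$ the eigenvalues and orthonormal eigenvectors of $\hat C$ (including eigenvalue $0$). $\mathcal{R}(\cdot)$ denotes range, $C^\beta$ the fractional power, $\mathcal{R}(C^0):=\mathcal{H}$; $\|C^{-1}\|<\infty$ means $C$ is invertible with bounded inverse. $O_{p_0}$ is stochastic boundedness under $p_0$. Assumptions: (A) $\Omega$ is a non-empty open subset of $\mathbb{R}^d$ with a piecewise smooth boundary $\partial\Omega:=\overline\Omega\setminus\Omega$. (B) $p_0$ is continuously extendible to $\overline\Omega$; $k$ is twice continuously differentiable on $\Omega\times\Omega$ (i.e. $\partial^{\alpha,\alpha}k$ exists and is continuous for $|\alpha|\le2$) with continuous extension of $\partial^{\alpha,\alpha}k$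 to $\overline\Omega\times\overline\Omega$ for $|\alpha|\le2$. (C) For all $i\in[d]$: $\partial_i\partial_{i+d}k(x,x)p_0(x)=0$ for $x\in\partial\Omega$, and $\sqrt{\partial_i\partial_{i+d}k(x,x)}\,p_0(x)=o(\|x\|_2^{1-d})$ as $x\in\Omega$, $\|x\|_2\to\infty$. (D) ($\varepsilon$-integrability) $q_0\in C^1(\Omega)$, and for some $\varepsilon\ge1$ and all $i\in[d]$, the functions $x\mapsto\partial_i\partial_{i+d}k(x,x)$, $\sqrt{\partial_i^2\partial_{i+d}^2k(x,x)}$ and $\sqrt{\partial_i\partial_{i+d}k(x,x)}\,\partial_i\log q_0(x)$ belong to $L^\varepsilon(\Omega,p_0)$. (E) $\chi:=d\sup_{x\in\Omega,i\in[d]}\partial_i\partial_{i+d}k(x,x)<\infty$, and there exist finite positive constants $A_g,B_g,C_g,\eta_0$ and $(\gamma_\eta)_{\eta\in(0,\eta_0]}$, all independent of $\lambda>0$, such that $g_\lambda:[0,\chi]\to\mathbb{R}$ satisfies, with $\mathcal{D}:=[0,\chi]$: (a) $\sup_{\alpha\in\mathcal{D}}|\alpha g_\lambda(\alpha)|\le A_g$; (b) $\sup_{\alpha\in\mathcal{D}}|g_\lambda(\alpha)|\le B_g/\lambda$; (c) $\sup_{\alpha\in\mathcal{D}}|1-\alpha g_\lambda(\alpha)|\le C_g$; (d) $\sup_{\alpha\in\mathcal{D}}|1-\alpha g_\lambda(\alpha)|\alpha^\eta\le\gamma_\eta\lambda^\eta$ for all $\eta\in(0,\eta_0]$. *)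

theory Defs
  imports "HOL-Probability.Probability" "HOL-Library.Landau_Symbols"
begin

section \<open>Partial derivatives\<close>

text \<open>
  Derivative of \<open>f\<close> at \<open>x\<close> in the direction \<open>j\<close>; for \<open>j\<close> a basis vector this is a partial
  derivative. A kernel is a function \<open>k\<close> on the product space, so that the derivative in the
  \<open>i\<close>-th coordinate of the first (second) argument is \<open>pd (i, 0) k\<close> (\<open>pd (0, i) k\<close>).
\<close>

definition pd :: "'a::real_normed_vector \<Rightarrow> ('a \<Rightarrow> real) \<Rightarrow> 'a \<Rightarrow> real" where
  "pd j f x = deriv (\<lambda>t. f (x + t *\<^sub>R j)) 0"

definition grad :: "('a::euclidean_space \<Rightarrow> real) \<Rightarrow> 'a \<Rightarrow> 'a" where
  "grad f x = (\<Sum>i\<in>Basis. pd i f x *\<^sub>R i)"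

text \<open>The directions are applied from the right: \<open>iter_pd [i, j] f = pd i (pd j f)\<close>.\<close>

definition iter_pd :: "'a::real_normed_vector list \<Rightarrow> ('a \<Rightarrow> real) \<Rightarrow> 'a \<Rightarrow> real" where
  "iter_pd js f = foldr pd js f"

fun iter_pd_exists :: "'a::real_normed_vector set \<Rightarrow> 'a list \<Rightarrow> ('a \<Rightarrow> real) \<Rightarrow> bool" where
  "iter_pd_exists S [] f = True"
| "iter_pd_exists S (j # js) f \<longleftrightarrow>
     iter_pd_exists S js f \<and> (\<forall>x\<in>S. (\<lambda>t. iter_pd js f (x + t *\<^sub>R j)) differentiable (at 0))"

text \<open>
  The multi-index \<open>\<alpha>\<close> is given as the list of its unit summands, so \<open>length bs = \<bar>\<alpha>\<bar>\<close>, and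
  \<open>iter_pd (diag_dirs bs) k\<close> is the mixed derivative of \<open>k\<close> of order \<open>\<alpha>\<close> in each argument.
\<close>

definition diag_dirs :: "'a::real_vector list \<Rightarrow> ('a \<times> 'a) list" where
  "diag_dirs bs = map (\<lambda>i. (i, 0)) bs @ map (\<lambda>i. (0, i)) bs"

definition C1_on :: "'a::real_normed_vector set \<Rightarrow> ('a \<Rightarrow> 'b::real_normed_vector) \<Rightarrow> bool" where
  "C1_on U f \<longleftrightarrow>
     (\<exists>f'. (\<forall>x\<in>U. (f has_derivative blinfun_apply (f' x)) (at x)) \<and> continuous_on U f')"

text \<open>
  The only candidate for a continuous extension of \<open>f\<close> from \<open>S\<close> to \<open>closure S\<close>; such an
  extension exists iff this function is continuous on \<open>closure S\<close>.
\<close>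

definition cont_ext :: "'a::topological_space set \<Rightarrow> ('a \<Rightarrow> real) \<Rightarrow> 'a \<Rightarrow> real" where
  "cont_ext S f x = (if x \<in> S then f x else Lim (at x within S) f)"


section \<open>Domains with piecewise smooth boundary\<close>

text \<open>
  A patch is the image of a closed unit cube of codimension one, embedded in the coordinate
  hyperplane orthogonal to \<open>b\<close>, under a \<open>C\<^sup>1\<close> map that is injective and immersive on the
  relative interior of the cube. Degeneration is allowed on the faces of the cube, so that
  for instance the tip of a cone is covered.
\<close>

definition smooth_patch :: "'a::euclidean_space set \<Rightarrow> bool" where
  "smooth_patch S \<longleftrightarrow>
     (\<exists>b\<in>Basis. \<exists>U \<phi> \<phi>'.
        let Q = {y. y \<bullet> b = 0 \<and> (\<forall>i\<in>Basis - {b}. 0 \<le> y \<bullet> i \<and> y \<bullet> i \<le> 1)};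
            Q0 = {y. y \<bullet> b = 0 \<and> (\<forall>i\<in>Basis - {b}. 0 < y \<bullet> i \<and> y \<bullet> i < 1)}
        in open U \<and> Q \<subseteq> U \<and>
           (\<forall>y\<in>U. (\<phi> has_derivative blinfun_apply (\<phi>' y)) (at y)) \<and> continuous_on U \<phi>' \<and>
           inj_on \<phi> Q0 \<and>
           (\<forall>y\<in>Q0. inj_on (blinfun_apply (\<phi>' y :: 'a \<Rightarrow>\<^sub>L 'a)) {v. v \<bullet> b = 0}) \<and>
           S = \<phi> ` Q)"

definition piecewise_smooth_boundary :: "'a::euclidean_space set \<Rightarrow> bool" where
  "piecewise_smooth_boundary \<Omega> \<longleftrightarrow>
     (\<exists>P. (\<forall>S\<in>P. smooth_patch S) \<and>
          (\<forall>K. bounded K \<longrightarrow> finite {S \<in> P. S \<inter> K \<noteq> {}}) \<and>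
          closure \<Omega> - \<Omega> = \<Union>P)"


section \<open>Lebesgue spaces and distances between densities\<close>

definition Lp_norm :: "'a measure \<Rightarrow> ennreal \<Rightarrow> ('a \<Rightarrow> real) \<Rightarrow> ennreal" where
  "Lp_norm M r f =
     (if r = \<infinity> then esssup M (\<lambda>x. ennreal \<bar>f x\<bar>)
      else let I = (\<integral>\<^sup>+x. ennreal (\<bar>f x\<bar> powr enn2real r) \<partial>M)
           in if I = \<infinity> then \<infinity> else ennreal (enn2real I powr (1 / enn2real r)))"

definition in_Lp :: "'a measure \<Rightarrow> ennreal \<Rightarrow> ('a \<Rightarrow> real) \<Rightarrow> bool" where
  "in_Lp M r f \<longleftrightarrow> f \<in> borel_measurable M \<and> Lp_norm M r f < \<infinity>"

definition prob_density_on :: "'a::euclidean_space set \<Rightarrow> ('a \<Rightarrow> real) \<Rightarrow> bool" where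
  "prob_density_on \<Omega> q \<longleftrightarrow>
     q \<in> borel_measurable (restrict_space lborel \<Omega>) \<and> (\<forall>x\<in>\<Omega>. 0 \<le> q x) \<and>
     (\<integral>\<^sup>+x. ennreal (q x) \<partial>restrict_space lborel \<Omega>) = 1"

definition fisher_divergence ::
    "'a::euclidean_space set \<Rightarrow> ('a \<Rightarrow> real) \<Rightarrow> ('a \<Rightarrow> real) \<Rightarrow> ennreal" where
  "fisher_divergence \<Omega> p q =
     (\<integral>\<^sup>+x. ennreal (p x * (norm (grad (\<lambda>y. ln (p y)) x - grad (\<lambda>y. ln (q y)) x))\<^sup>2)
        \<partial>restrict_space lborel \<Omega>) / 2"

text \<open>
  For probability densities the negative part of \<open>p * ln (p / q)\<close> is always integrable, so
  a failure of integrability means that the divergence is infinite.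
\<close>

definition KL_div :: "'a::euclidean_space set \<Rightarrow> ('a \<Rightarrow> real) \<Rightarrow> ('a \<Rightarrow> real) \<Rightarrow> ereal" where
  "KL_div \<Omega> p q =
     (if (AE x in restrict_space lborel \<Omega>. q x = 0 \<longrightarrow> p x = 0) \<and>
         set_integrable lborel \<Omega> (\<lambda>x. p x * ln (p x / q x))
      then ereal (LINT x:\<Omega>|lborel. p x * ln (p x / q x)) else \<infinity>)"

definition hellinger ::
    "'a::euclidean_space set \<Rightarrow> ('a \<Rightarrow> real) \<Rightarrow> ('a \<Rightarrow> real) \<Rightarrow> ennreal" where
  "hellinger \<Omega> p q = Lp_norm (restrict_space lborel \<Omega>) 2 (\<lambda>x. sqrt (p x) - sqrt (q x))"


section \<open>Reproducing kernel Hilbert spaces\<close>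

text \<open>
  The Hilbert space is a type \<open>'h\<close>; \<open>evf f\<close> is the function on \<open>\<Omega>\<close> that the element \<open>f\<close>
  stands for. Values of \<open>evf f\<close> outside \<open>\<Omega>\<close> are irrelevant.
\<close>

definition rkhs ::
    "'a set \<Rightarrow> ('a \<times> 'a \<Rightarrow> real) \<Rightarrow> ('h::{real_inner,banach} \<Rightarrow> 'a \<Rightarrow> real) \<Rightarrow> bool" where
  "rkhs \<Omega> k evf \<longleftrightarrow>
     (\<forall>x\<in>\<Omega>. linear (\<lambda>f. evf f x)) \<and>
     (\<forall>f g. (\<forall>x\<in>\<Omega>. evf f x = evf g x) \<longrightarrow> f = g) \<and>
     (\<forall>x\<in>\<Omega>. \<exists>kx. (\<forall>y\<in>\<Omega>. evf kx y = k (x, y)) \<and> (\<forall>f. evf f x = f \<bullet> kx))"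

definition elem_of :: "'a set \<Rightarrow> ('h \<Rightarrow> 'a \<Rightarrow> real) \<Rightarrow> ('a \<Rightarrow> real) \<Rightarrow> 'h" where
  "elem_of \<Omega> evf \<phi> = (THE h. \<forall>y\<in>\<Omega>. evf h y = \<phi> y)"

definition dk :: "'a::real_normed_vector set \<Rightarrow> ('a \<times> 'a \<Rightarrow> real) \<Rightarrow> ('h \<Rightarrow> 'a \<Rightarrow> real) \<Rightarrow>
    'a \<Rightarrow> 'a \<Rightarrow> 'h" where
  "dk \<Omega> k evf i x = elem_of \<Omega> evf (\<lambda>y. pd (i, 0) k (x, y))"

definition ddk :: "'a::real_normed_vector set \<Rightarrow> ('a \<times> 'a \<Rightarrow> real) \<Rightarrow> ('h \<Rightarrow> 'a \<Rightarrow> real) \<Rightarrow>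
    'a \<Rightarrow> 'a \<Rightarrow> 'h" where
  "ddk \<Omega> k evf i x = elem_of \<Omega> evf (\<lambda>y. pd (i, 0) (pd (i, 0) k) (x, y))"


section \<open>Operators and functional calculus\<close>

definition rank_one :: "'h::real_inner \<Rightarrow> 'h \<Rightarrow> 'h \<Rightarrow> 'h" where
  "rank_one u v w = (v \<bullet> w) *\<^sub>R u"

definition eigenbasis :: "('h::real_inner \<Rightarrow> 'h) \<Rightarrow> 'h set \<Rightarrow> bool" where
  "eigenbasis T \<Phi> \<longleftrightarrow>
     (\<forall>\<phi>\<in>\<Phi>. norm \<phi> = 1) \<and> (\<forall>\<phi>\<in>\<Phi>. \<forall>\<psi>\<in>\<Phi>. \<phi> \<noteq> \<psi> \<longrightarrow> \<phi> \<bullet> \<psi> = 0) \<and>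
     (\<forall>\<phi>\<in>\<Phi>. \<exists>\<alpha>. T \<phi> = \<alpha> *\<^sub>R \<phi>) \<and> closure (span \<Phi>) = UNIV"

text \<open>
  The eigenvalue of a unit eigenvector \<open>\<phi>\<close> is \<open>\<phi> \<bullet> T \<phi>\<close>. The basis contains eigenvectors for
  the eigenvalue \<open>0\<close>. For compact self-adjoint \<open>T\<close> an eigenbasis exists, and the resulting
  operator does not depend on which one is chosen.
\<close>

definition op_fun :: "(real \<Rightarrow> real) \<Rightarrow> ('h::{real_inner,banach} \<Rightarrow> 'h) \<Rightarrow> 'h \<Rightarrow> 'h" where
  "op_fun g T f =
     (let \<Phi> = (SOME \<Phi>. eigenbasis T \<Phi>)
      in infsum (\<lambda>\<phi>. (g (\<phi> \<bullet> T \<phi>) * (\<phi> \<bullet> f)) *\<^sub>R \<phi>) \<Phi>)"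

text \<open>The zeroth power is the identity by convention (note that \<open>0 powr 0 = 0\<close>).\<close>

definition op_powr :: "('h::{real_inner,banach} \<Rightarrow> 'h) \<Rightarrow> real \<Rightarrow> 'h \<Rightarrow> 'h" where
  "op_powr T \<beta> = (if \<beta> = 0 then id else op_fun (\<lambda>\<alpha>. \<alpha> powr \<beta>) T)"

definition boundedly_invertible :: "('h::real_normed_vector \<Rightarrow> 'h) \<Rightarrow> bool" where
  "boundedly_invertible T \<longleftrightarrow> (\<exists>B. bounded_linear B \<and> (\<forall>f. B (T f) = f) \<and> (\<forall>f. T (B f) = f))"

text \<open>
  A Bochner integral in \<open>'h\<close>, which the library provides for second countable spaces only.
  This is no restriction: an RKHS with a continuous kernel on a subset of a Euclidean space
  is separable.
\<close>

definition pop_op :: "'a::euclidean_space set \<Rightarrow> ('a \<times> 'a \<Rightarrow> real) \<Rightarrow>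
    ('h::{real_inner,banach,second_countable_topology} \<Rightarrow> 'a \<Rightarrow> real) \<Rightarrow> ('a \<Rightarrow> real) \<Rightarrow>
    'h \<Rightarrow> 'h" where
  "pop_op \<Omega> k evf p0 f =
     (LINT x:\<Omega>|lborel. p0 x *\<^sub>R (\<Sum>i\<in>Basis. rank_one (dk \<Omega> k evf i x) (dk \<Omega> k evf i x) f))"

text \<open>The sample of size \<open>n\<close> is \<open>xs 0, \<dots>, xs (n - 1)\<close>.\<close>

definition emp_op :: "'a::euclidean_space set \<Rightarrow> ('a \<times> 'a \<Rightarrow> real) \<Rightarrow>
    ('h::real_inner \<Rightarrow> 'a \<Rightarrow> real) \<Rightarrow> nat \<Rightarrow> (nat \<Rightarrow> 'a) \<Rightarrow> 'h \<Rightarrow> 'h" where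
  "emp_op \<Omega> k evf n xs f =
     (1 / real n) *\<^sub>R
       (\<Sum>a<n. \<Sum>i\<in>Basis. rank_one (dk \<Omega> k evf i (xs a)) (dk \<Omega> k evf i (xs a)) f)"

definition emp_xi :: "'a::euclidean_space set \<Rightarrow> ('a \<times> 'a \<Rightarrow> real) \<Rightarrow>
    ('h::real_inner \<Rightarrow> 'a \<Rightarrow> real) \<Rightarrow> ('a \<Rightarrow> real) \<Rightarrow> nat \<Rightarrow> (nat \<Rightarrow> 'a) \<Rightarrow> 'h" where
  "emp_xi \<Omega> k evf q0 n xs =
     (1 / real n) *\<^sub>R
       (\<Sum>a<n. \<Sum>i\<in>Basis.
          pd i (\<lambda>y. ln (q0 y)) (xs a) *\<^sub>R dk \<Omega> k evf i (xs a) + ddk \<Omega> k evf i (xs a))"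

definition estimator :: "'a::euclidean_space set \<Rightarrow> ('a \<times> 'a \<Rightarrow> real) \<Rightarrow>
    ('h::{real_inner,banach} \<Rightarrow> 'a \<Rightarrow> real) \<Rightarrow> ('a \<Rightarrow> real) \<Rightarrow> (real \<Rightarrow> real) \<Rightarrow>
    nat \<Rightarrow> (nat \<Rightarrow> 'a) \<Rightarrow> 'h" where
  "estimator \<Omega> k evf q0 gl n xs = - op_fun gl (emp_op \<Omega> k evf n xs) (emp_xi \<Omega> k evf q0 n xs)"


section \<open>The exponential family\<close>

definition exp_family_domain ::
    "'a::euclidean_space set \<Rightarrow> ('a \<Rightarrow> real) \<Rightarrow> ('h \<Rightarrow> 'a \<Rightarrow> real) \<Rightarrow> 'h set" where
  "exp_family_domain \<Omega> q0 evf = {f. set_integrable lborel \<Omega> (\<lambda>x. exp (evf f x) * q0 x)}"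

definition log_partition ::
    "'a::euclidean_space set \<Rightarrow> ('a \<Rightarrow> real) \<Rightarrow> ('h \<Rightarrow> 'a \<Rightarrow> real) \<Rightarrow> 'h \<Rightarrow> real" where
  "log_partition \<Omega> q0 evf f = ln (LINT x:\<Omega>|lborel. exp (evf f x) * q0 x)"

text \<open>
  For \<open>f\<close> outside \<open>exp_family_domain\<close> the integral, and hence \<open>log_partition\<close>, is \<open>0\<close> and
  this is the unnormalised function \<open>exp f * q0\<close>. The normalising constant does not enter
  the gradient of the logarithm, so \<open>fisher_divergence\<close> is meaningful for these \<open>f\<close> as well.
\<close>

definition exp_family_density ::
    "'a::euclidean_space set \<Rightarrow> ('a \<Rightarrow> real) \<Rightarrow> ('h \<Rightarrow> 'a \<Rightarrow> real) \<Rightarrow> 'h \<Rightarrow> 'a \<Rightarrow> real" where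
  "exp_family_density \<Omega> q0 evf f x = exp (evf f x - log_partition \<Omega> q0 evf f) * q0 x"


section \<open>Standing assumptions\<close>

definition domain_assm :: "'a::euclidean_space set \<Rightarrow> bool" where
  "domain_assm \<Omega> \<longleftrightarrow> \<Omega> \<noteq> {} \<and> open \<Omega> \<and> piecewise_smooth_boundary \<Omega>"

definition smoothness_assm ::
    "'a::euclidean_space set \<Rightarrow> ('a \<times> 'a \<Rightarrow> real) \<Rightarrow> ('a \<Rightarrow> real) \<Rightarrow> bool" where
  "smoothness_assm \<Omega> k p0 \<longleftrightarrow>
     continuous_on (closure \<Omega>) (cont_ext \<Omega> p0) \<and>
     (\<forall>bs. set bs \<subseteq> Basis \<and> length bs \<le> 2 \<longrightarrow>
        iter_pd_exists (\<Omega> \<times> \<Omega>) (diag_dirs bs) k \<and>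
        continuous_on (\<Omega> \<times> \<Omega>) (iter_pd (diag_dirs bs) k) \<and>
        continuous_on (closure \<Omega> \<times> closure \<Omega>) (cont_ext (\<Omega> \<times> \<Omega>) (iter_pd (diag_dirs bs) k)))"

definition boundary_assm ::
    "'a::euclidean_space set \<Rightarrow> ('a \<times> 'a \<Rightarrow> real) \<Rightarrow> ('a \<Rightarrow> real) \<Rightarrow> bool" where
  "boundary_assm \<Omega> k p0 \<longleftrightarrow>
     (\<forall>i\<in>Basis.
        (\<forall>x\<in>closure \<Omega> - \<Omega>.
           cont_ext (\<Omega> \<times> \<Omega>) (iter_pd (diag_dirs [i]) k) (x, x) * cont_ext \<Omega> p0 x = 0) \<and>
        (\<lambda>x. sqrt (iter_pd (diag_dirs [i]) k (x, x)) * p0 x)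
          \<in> o[inf at_infinity (principal \<Omega>)](\<lambda>x. norm x powr (1 - real DIM('a))))"

definition integrability_assm :: "real \<Rightarrow>
    'a::euclidean_space set \<Rightarrow> ('a \<times> 'a \<Rightarrow> real) \<Rightarrow> ('a \<Rightarrow> real) \<Rightarrow> ('a \<Rightarrow> real) \<Rightarrow> bool" where
  "integrability_assm eps \<Omega> k q0 p0 \<longleftrightarrow>
     1 \<le> eps \<and> C1_on \<Omega> q0 \<and>
     (let \<mu> = density (restrict_space lborel \<Omega>) (\<lambda>x. ennreal (p0 x)) in
      \<forall>i\<in>Basis.
        in_Lp \<mu> (ennreal eps) (\<lambda>x. iter_pd (diag_dirs [i]) k (x, x)) \<and>
        in_Lp \<mu> (ennreal eps) (\<lambda>x. sqrt (iter_pd (diag_dirs [i, i]) k (x, x))) \<and>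
        in_Lp \<mu> (ennreal eps)
          (\<lambda>x. sqrt (iter_pd (diag_dirs [i]) k (x, x)) * pd i (\<lambda>y. ln (q0 y)) x))"

definition diag_values :: "'a::euclidean_space set \<Rightarrow> ('a \<times> 'a \<Rightarrow> real) \<Rightarrow> real set" where
  "diag_values \<Omega> k = {iter_pd (diag_dirs [i]) k (x, x) | x i. x \<in> \<Omega> \<and> i \<in> Basis}"

definition chi :: "'a::euclidean_space set \<Rightarrow> ('a \<times> 'a \<Rightarrow> real) \<Rightarrow> real" where
  "chi \<Omega> k = real DIM('a) * Sup (diag_values \<Omega> k)"

definition regularizer_assm :: "'a::euclidean_space set \<Rightarrow> ('a \<times> 'a \<Rightarrow> real) \<Rightarrow>
    (real \<Rightarrow> real \<Rightarrow> real) \<Rightarrow> real \<Rightarrow> real \<Rightarrow> real \<Rightarrow> real \<Rightarrow> (real \<Rightarrow> real) \<Rightarrow> bool" where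
  "regularizer_assm \<Omega> k g Ag Bg Cg \<eta>0 \<gamma> \<longleftrightarrow>
     bdd_above (diag_values \<Omega> k) \<and>
     0 < Ag \<and> 0 < Bg \<and> 0 < Cg \<and> 0 < \<eta>0 \<and> (\<forall>\<eta>\<in>{0<..\<eta>0}. 0 < \<gamma> \<eta>) \<and>
     (\<forall>lam>0. \<forall>\<alpha>\<in>{0..chi \<Omega> k}.
        \<bar>\<alpha> * g lam \<alpha>\<bar> \<le> Ag \<and>
        \<bar>g lam \<alpha>\<bar> \<le> Bg / lam \<and>
        \<bar>1 - \<alpha> * g lam \<alpha>\<bar> \<le> Cg \<and>
        (\<forall>\<eta>\<in>{0<..\<eta>0}. \<bar>1 - \<alpha> * g lam \<alpha>\<bar> * \<alpha> powr \<eta> \<le> \<gamma> \<eta> * lam powr \<eta>))"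


section \<open>Stochastic boundedness\<close>

text \<open>
  The functions \<open>g lam\<close> are not assumed to be measurable, so the exceptional events need not
  be measurable either. They are therefore required to be covered by measurable events of
  small probability. For measurable \<open>Z n\<close> this is the usual notion.
\<close>

definition stoch_O :: "'w measure \<Rightarrow> (nat \<Rightarrow> 'w \<Rightarrow> ereal) \<Rightarrow> (nat \<Rightarrow> real) \<Rightarrow> bool" where
  "stoch_O M Z \<theta> \<longleftrightarrow>
     (\<forall>\<delta>>0. \<exists>c::real. \<forall>\<^sub>F n in sequentially.
        \<exists>E\<in>sets M. measure M E < \<delta> \<and> {\<omega>\<in>space M. ereal (c * \<theta> n) < \<bar>Z n \<omega>\<bar>} \<subseteq> E)"

end

theory Submission
  imports Defs
begin

text \<open>Let \<open>r\<^sub>\<lambda> \<alpha> = 1 - \<alpha> * g\<^sub>\<lambda> \<alpha>\<close>. Writing \<open>D\<close> for the empirical operator and \<open>z\<close> for the empirical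
  vector, the error is \<open>f - f0 = - g\<^sub>\<lambda>(D) (z + D f0) - r\<^sub>\<lambda>(D) f0\<close>.

  Variance: the summands of \<open>z + D f0\<close> are centred by integration by parts, and the entries of
  \<open>D - C\<close> along an eigenbasis of \<open>C\<close> are centred by definition. Hence both the norm of \<open>z + D f0\<close> and
  the Hilbert--Schmidt norm of \<open>D - C\<close> are \<open>O(n\<^bsup>-1/2\<^esup>)\<close> in mean square.

  Bias: the source condition is rewritten as \<open>f0 = (C + \<lambda>)\<^sup>b h\<close> with \<open>h\<close> bounded, and \<open>C\<close> has to be
  replaced by \<open>D\<close> in \<open>(C + \<lambda>)\<^sup>b\<close>. The function \<open>(\<alpha> + \<lambda>)\<^sup>b\<close> has Lipschitz constant
  \<open>O(1/\<lambda>)\<close> for \<open>\<lambda> \<le> 1\<close>, a Lipschitz function of a scalar is Lipschitz in the Hilbert--Schmidt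
  norm as a function of the operator, and the resulting error \<open>n\<^bsup>-1/2\<^esup> / \<lambda>\<close> equals \<open>\<lambda>\<^sup>b\<close>, since
  \<open>n\<^bsup>-1/2\<^esup> = \<lambda>\<^bsup>b+1\<^esup>\<close> for the prescribed \<open>\<lambda>\<close>. If \<open>C\<close> is boundedly invertible, the spectrum of \<open>D\<close> is
  bounded away from \<open>0\<close> and the case \<open>\<eta> = 1\<close> of the qualification condition gives a bias \<open>O(\<lambda>)\<close>.

  The constraint \<open>\<lambda> \<ge> n\<^bsup>-1/2\<^esup>\<close> at \<open>n = 2\<close> forces \<open>\<eta>0 \<ge> 1/2\<close> in (ii) and \<open>\<eta>0 \<ge> 1\<close> in (iii).

  The Fisher distance is \<open>J = (w \<bullet> C w) / 2\<close> with \<open>w = f - f0\<close>. The remaining distances are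
  controlled by the sup norm of \<open>w\<close>, which for a bounded kernel is at most a multiple of \<open>norm w\<close>.\<close>

section \<open>Orthonormal expansions and functional calculus\<close>

text \<open>\<open>op_fun\<close> works with a chosen eigenbasis, so nothing can be computed before
  one is known to exist. Existence is proved for positive Hilbert--Schmidt operators, which covers
  both \<open>C\<close> and \<open>D\<close>: they are averages of the same one-point operators. The
  power \<alpha>^b with 0 < b < 1 is not Lipschitz at 0; the shift by \<lambda> repairs this at the
  price 1/\<lambda>, affordable because n^(-1/2)/\<lambda> is also the size of the noise term. The
  exponent b is the smoothness \<beta> cut off at the qualification: min \<beta> \<eta>0 for the
  norm, min \<beta> (\<eta>0 - 1/2) for the Fisher distance, where a factor sqrt \<alpha> consumes
  half a power. The distance of \<open>D\<close> to \<open>C\<close> is measured along the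
  eigenbasis of \<open>C\<close>, which does not depend on the sample; one Markov inequality then
  gives a single exceptional event for each n, and off that event the argument is deterministic.
  Finally, \<open>q0\<close> may vanish inside \<Omega>, so all terms with log q0 are restricted to
  the set where it is positive; at an interior zero, a minimum, the gradient of \<open>q0\<close>
  vanishes too.\<close>

definition orthonormal :: "'h::real_inner set \<Rightarrow> bool" where
  "orthonormal \<Phi> \<longleftrightarrow> (\<forall>\<phi>\<in>\<Phi>. norm \<phi> = 1) \<and> (\<forall>\<phi>\<in>\<Phi>. \<forall>\<psi>\<in>\<Phi>. \<phi> \<noteq> \<psi> \<longrightarrow> \<phi> \<bullet> \<psi> = 0)"

lemma orthonormal_subset: "orthonormal \<Phi> \<Longrightarrow> F \<subseteq> \<Phi> \<Longrightarrow> orthonormal F"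
  by (auto simp: orthonormal_def)

lemma orthonormal_inner:
  "orthonormal \<Phi> \<Longrightarrow> \<phi> \<in> \<Phi> \<Longrightarrow> \<psi> \<in> \<Phi> \<Longrightarrow> \<phi> \<bullet> \<psi> = (if \<phi> = \<psi> then 1 else 0)"
  by (auto simp: orthonormal_def norm_eq_1)

lemma inner_orthonormal_sum:
  assumes "orthonormal F" "finite F" "\<psi> \<in> F"
  shows "\<psi> \<bullet> (\<Sum>\<phi>\<in>F. c \<phi> *\<^sub>R \<phi>) = c \<psi>"
proof -
  have "\<psi> \<bullet> (\<Sum>\<phi>\<in>F. c \<phi> *\<^sub>R \<phi>) = (\<Sum>\<phi>\<in>F. if \<psi> = \<phi> then c \<phi> else 0)"
    unfolding inner_sum_right
    by (rule sum.cong[OF refl]) (use assms in \<open>simp add: orthonormal_inner\<close>)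
  also have "\<dots> = c \<psi>" using assms by simp
  finally show ?thesis .
qed

lemma norm_orthonormal_sum:
  assumes "orthonormal F" "finite F"
  shows "(norm (\<Sum>\<phi>\<in>F. c \<phi> *\<^sub>R \<phi>))\<^sup>2 = (\<Sum>\<phi>\<in>F. (c \<phi>)\<^sup>2)"
proof -
  have "(norm (\<Sum>\<phi>\<in>F. c \<phi> *\<^sub>R \<phi>))\<^sup>2 = (\<Sum>\<psi>\<in>F. c \<psi> * (\<psi> \<bullet> (\<Sum>\<phi>\<in>F. c \<phi> *\<^sub>R \<phi>)))"
    unfolding power2_norm_eq_inner by (subst inner_sum_left) simp
  also have "\<dots> = (\<Sum>\<phi>\<in>F. (c \<phi>)\<^sup>2)"
    by (rule sum.cong[OF refl]) (use assms in \<open>simp add: inner_orthonormal_sum power2_eq_square\<close>)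
  finally show ?thesis .
qed

lemma projection_residual:
  assumes "orthonormal F" "finite F" "y \<in> span F"
  shows "(x - (\<Sum>\<phi>\<in>F. (\<phi> \<bullet> x) *\<^sub>R \<phi>)) \<bullet> y = 0"
  using assms(3)
proof (induction rule: span_induct_alt)
  case base
  then show ?case by simp
next
  case (step c a y)
  have "a \<bullet> (x - (\<Sum>\<phi>\<in>F. (\<phi> \<bullet> x) *\<^sub>R \<phi>)) = 0"
    using assms step by (simp add: inner_diff_right inner_orthonormal_sum)
  with step show ?case by (simp add: inner_add_right inner_commute[of _ a])
qed

lemma projection_in_span: "(\<Sum>\<phi>\<in>F. c \<phi> *\<^sub>R \<phi>) \<in> span F"
  by (intro span_sum span_scale span_base)

text \<open>Pythagoras: the residual of the projection is orthogonal to the difference of the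
  projection and any other point of the span.\<close>

lemma projection_best:
  assumes "orthonormal F" "finite F" "y \<in> span F"
  shows "norm (x - (\<Sum>\<phi>\<in>F. (\<phi> \<bullet> x) *\<^sub>R \<phi>)) \<le> norm (x - y)"
proof -
  define P where "P = (\<Sum>\<phi>\<in>F. (\<phi> \<bullet> x) *\<^sub>R \<phi>)"
  have "P - y \<in> span F"
    unfolding P_def by (intro span_diff projection_in_span assms)
  then have "(x - P) \<bullet> (P - y) = 0"
    unfolding P_def by (rule projection_residual[OF assms(1,2)])
  then have "(norm ((x - P) + (P - y)))\<^sup>2 = (norm (x - P))\<^sup>2 + (norm (P - y))\<^sup>2"
    unfolding power2_norm_eq_inner by (simp add: algebra_simps inner_commute)
  then have "(norm (x - P))\<^sup>2 \<le> (norm (x - y))\<^sup>2" by simp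
  then show ?thesis unfolding P_def by (simp add: power_mono_iff)
qed

lemma bessel_finite:
  assumes "orthonormal F" "finite F"
  shows "(\<Sum>\<phi>\<in>F. (\<phi> \<bullet> x)\<^sup>2) \<le> (norm x)\<^sup>2"
proof -
  define P where "P = (\<Sum>\<phi>\<in>F. (\<phi> \<bullet> x) *\<^sub>R \<phi>)"
  have "(x - P) \<bullet> P = 0"
    unfolding P_def by (rule projection_residual[OF assms projection_in_span])
  then have "(norm ((x - P) + P))\<^sup>2 = (norm (x - P))\<^sup>2 + (norm P)\<^sup>2"
    unfolding power2_norm_eq_inner by (simp add: algebra_simps inner_commute)
  moreover have "(norm P)\<^sup>2 = (\<Sum>\<phi>\<in>F. (\<phi> \<bullet> x)\<^sup>2)"
    unfolding P_def by (rule norm_orthonormal_sum[OF assms])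
  ultimately show ?thesis by simp
qed

lemma bessel_summable:
  assumes "orthonormal \<Phi>"
  shows "(\<lambda>\<phi>. (\<phi> \<bullet> x)\<^sup>2) summable_on \<Phi>"
proof (rule nonneg_bdd_above_summable_on)
  show "bdd_above (sum (\<lambda>\<phi>. (\<phi> \<bullet> x)\<^sup>2) ` {F. F \<subseteq> \<Phi> \<and> finite F})"
    by (rule bdd_aboveI[of _ "(norm x)\<^sup>2"]) (use assms bessel_finite orthonormal_subset in blast)
qed auto

text \<open>A close point of the span involves finitely many basis vectors only, and the projection
  onto any larger finite subset is at least as close. This is convergence along the net of finite
  subsets.\<close>

lemma orthonormal_expansion:
  assumes on: "orthonormal \<Phi>" and x: "x \<in> closure (span \<Phi>)"
  shows "((\<lambda>\<phi>. (\<phi> \<bullet> x) *\<^sub>R \<phi>) has_sum x) \<Phi>"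
  unfolding has_sum_def
proof (rule tendstoI)
  fix e :: real assume "0 < e"
  then obtain y where y: "y \<in> span \<Phi>" "dist y x < e"
    using x closure_approachable by blast
  obtain F0 r where F0: "finite F0" "F0 \<subseteq> \<Phi>" and r: "y = (\<Sum>\<phi>\<in>F0. r \<phi> *\<^sub>R \<phi>)"
    using y(1) unfolding span_explicit by blast
  have "dist (\<Sum>\<phi>\<in>F. (\<phi> \<bullet> x) *\<^sub>R \<phi>) x < e" if F: "finite F" "F0 \<subseteq> F" "F \<subseteq> \<Phi>" for F
  proof -
    have "y \<in> span F" unfolding r using projection_in_span F(2) span_mono by blast
    then have "norm (x - (\<Sum>\<phi>\<in>F. (\<phi> \<bullet> x) *\<^sub>R \<phi>)) \<le> norm (x - y)"
      using projection_best orthonormal_subset[OF on F(3)] F(1) by blast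
    then show ?thesis using y(2) by (simp add: dist_norm norm_minus_commute)
  qed
  then show "\<forall>\<^sub>F F in finite_subsets_at_top \<Phi>. dist (\<Sum>\<phi>\<in>F. (\<phi> \<bullet> x) *\<^sub>R \<phi>) x < e"
    unfolding eventually_finite_subsets_at_top using F0 by blast
qed

text \<open>The squared distance of two partial sums is a partial sum of the squared coefficients,
  so the Cauchy property carries over and completeness gives the limit.\<close>

lemma orthonormal_series_summable:
  fixes \<Phi> :: "'h::{real_inner,banach} set"
  assumes on: "orthonormal \<Phi>" and c: "(\<lambda>\<phi>. (c \<phi>)\<^sup>2) summable_on \<Phi>"
  shows "(\<lambda>\<phi>. c \<phi> *\<^sub>R \<phi>) summable_on \<Phi>"
proof -
  let ?f = "\<lambda>\<phi>. c \<phi> *\<^sub>R \<phi>"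
  obtain L where L: "((\<lambda>\<phi>. (c \<phi>)\<^sup>2) has_sum L) \<Phi>" using c summable_on_def by blast
  have "\<exists>P. eventually P (finite_subsets_at_top \<Phi>) \<and>
              (\<forall>F F'. P F \<and> P F' \<longrightarrow> dist (sum ?f F) (sum ?f F') < e)" if "e > 0" for e
  proof -
    have "\<forall>\<^sub>F F in finite_subsets_at_top \<Phi>. dist (\<Sum>\<phi>\<in>F. (c \<phi>)\<^sup>2) L < (e/2)\<^sup>2"
      using L that unfolding has_sum_def tendsto_iff by simp
    then obtain F0 where F0: "finite F0" "F0 \<subseteq> \<Phi>"
      and small: "\<And>F. finite F \<Longrightarrow> F0 \<subseteq> F \<Longrightarrow> F \<subseteq> \<Phi> \<Longrightarrow> dist (\<Sum>\<phi>\<in>F. (c \<phi>)\<^sup>2) L < (e/2)\<^sup>2"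
      unfolding eventually_finite_subsets_at_top by metis
    define P where "P F \<longleftrightarrow> finite F \<and> F0 \<subseteq> F \<and> F \<subseteq> \<Phi>" for F
    have near: "dist (sum ?f F) (sum ?f F0) < e/2" if "P F" for F
    proof -
      have F: "finite F" "F0 \<subseteq> F" "F \<subseteq> \<Phi>" using that by (auto simp: P_def)
      have "sum ?f F - sum ?f F0 = sum ?f (F - F0)" using F by (simp add: sum_diff)
      then have "(dist (sum ?f F) (sum ?f F0))\<^sup>2 = (\<Sum>\<phi>\<in>F - F0. (c \<phi>)\<^sup>2)"
        using norm_orthonormal_sum[OF orthonormal_subset[OF on], of "F - F0" c] F by (auto simp: dist_norm)
      also have "\<dots> = (\<Sum>\<phi>\<in>F. (c \<phi>)\<^sup>2) - (\<Sum>\<phi>\<in>F0. (c \<phi>)\<^sup>2)" using F by (simp add: sum_diff)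
      also have "\<dots> \<le> L - (\<Sum>\<phi>\<in>F0. (c \<phi>)\<^sup>2)"
        using finite_sum_le_has_sum[OF L F(1,3)] by simp
      also have "\<dots> < (e/2)\<^sup>2"
        using small[OF F0(1) order_refl F0(2)] by (simp add: dist_real_def)
      finally show ?thesis using \<open>e > 0\<close> by (metis less_eq_real_def half_gt_zero power2_less_imp_less)
    qed
    have "dist (sum ?f F) (sum ?f F') < e" if "P F" "P F'" for F F'
      using near[OF that(1)] near[OF that(2)] dist_triangle2[of "sum ?f F" "sum ?f F'" "sum ?f F0"] by linarith
    moreover have "eventually P (finite_subsets_at_top \<Phi>)"
      unfolding eventually_finite_subsets_at_top P_def using F0 by blast
    ultimately show ?thesis by blast
  qed
  then have "cauchy_filter (filtermap (sum ?f) (finite_subsets_at_top \<Phi>))"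
    by (simp add: cauchy_filter_metric_filtermap)
  moreover have "uniform_space_class.complete (UNIV::'h set)"
    by (meson Cauchy_convergent UNIV_I complete_def convergent_def)
  ultimately obtain L' where "(sum ?f \<longlongrightarrow> L') (finite_subsets_at_top \<Phi>)"
    using complete_uniform[where S=UNIV] by (force simp add: filterlim_def)
  then show ?thesis using summable_on_def has_sum_def by blast
qed

lemma orthonormal_series_coeff:
  assumes on: "orthonormal \<Phi>" and s: "((\<lambda>\<phi>. c \<phi> *\<^sub>R \<phi>) has_sum z) \<Phi>" and \<psi>: "\<psi> \<in> \<Phi>"
  shows "\<psi> \<bullet> z = c \<psi>"
proof -
  have "((\<lambda>\<phi>. \<psi> \<bullet> (c \<phi> *\<^sub>R \<phi>)) has_sum \<psi> \<bullet> z) \<Phi>"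
    using has_sum_bounded_linear[OF bounded_linear_inner_right s] by (simp add: o_def)
  moreover have "((\<lambda>\<phi>. \<psi> \<bullet> (c \<phi> *\<^sub>R \<phi>)) has_sum c \<psi>) \<Phi> \<longleftrightarrow> ((\<lambda>\<phi>. c \<phi>) has_sum c \<psi>) {\<psi>}"
    by (rule has_sum_cong_neutral) (use on \<psi> in \<open>auto simp: orthonormal_inner\<close>)
  ultimately show ?thesis by (simp add: has_sum_unique has_sum_finiteI)
qed

lemma parseval:
  assumes on: "orthonormal \<Phi>" and x: "x \<in> closure (span \<Phi>)"
  shows "((\<lambda>\<phi>. (\<phi> \<bullet> x) * (\<phi> \<bullet> y)) has_sum x \<bullet> y) \<Phi>"
  using has_sum_bounded_linear[OF bounded_linear_inner_left orthonormal_expansion[OF on x], of y]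
  by (simp add: o_def)

text \<open>Parseval turns a coefficientwise bound into a norm bound. All operator norm estimates of
  the functional calculus below are instances.\<close>

lemma norm_le_coeffs:
  assumes on: "orthonormal \<Phi>" and dense: "closure (span \<Phi>) = UNIV" and B: "0 \<le> B"
    and le: "\<And>\<phi>. \<phi> \<in> \<Phi> \<Longrightarrow> \<bar>\<phi> \<bullet> x\<bar> \<le> B * \<bar>\<phi> \<bullet> y\<bar>"
  shows "norm x \<le> B * norm y"
proof -
  have x: "((\<lambda>\<phi>. (\<phi> \<bullet> x) * (\<phi> \<bullet> x)) has_sum x \<bullet> x) \<Phi>"
    and y: "((\<lambda>\<phi>. (\<phi> \<bullet> y) * (\<phi> \<bullet> y)) has_sum y \<bullet> y) \<Phi>"
    using parseval[OF on] dense by auto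
  have "(\<phi> \<bullet> x) * (\<phi> \<bullet> x) \<le> B\<^sup>2 * ((\<phi> \<bullet> y) * (\<phi> \<bullet> y))" if "\<phi> \<in> \<Phi>" for \<phi>
    using power_mono[OF le[OF that], of 2] by (simp add: power2_eq_square power_mult_distrib algebra_simps)
  then have "x \<bullet> x \<le> B\<^sup>2 * (y \<bullet> y)"
    by (rule has_sum_mono[OF x has_sum_cmult_right[OF y]])
  then have "(norm x)\<^sup>2 \<le> (B * norm y)\<^sup>2" by (simp add: power2_norm_eq_inner power_mult_distrib)
  then show ?thesis by (rule power2_le_imp_le) (use B in simp)
qed

lemma eq_by_coeffs:
  assumes on: "orthonormal \<Phi>" and dense: "closure (span \<Phi>) = UNIV"
    and eq: "\<And>\<phi>. \<phi> \<in> \<Phi> \<Longrightarrow> \<phi> \<bullet> x = \<phi> \<bullet> y"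
  shows "x = y"
proof -
  have "norm (x - y) \<le> 0 * norm (x - y)"
    by (rule norm_le_coeffs[OF on dense]) (use eq in \<open>auto simp: inner_diff_right\<close>)
  then show ?thesis by simp
qed

lemma eigenbasis_orthonormal: "eigenbasis T \<Phi> \<Longrightarrow> orthonormal \<Phi>"
  by (simp add: eigenbasis_def orthonormal_def)

lemma eigenbasis_dense: "eigenbasis T \<Phi> \<Longrightarrow> closure (span \<Phi>) = UNIV"
  by (simp add: eigenbasis_def)

lemma eigenbasis_eigenvector:
  assumes "eigenbasis T \<Phi>" "\<phi> \<in> \<Phi>"
  shows "T \<phi> = (\<phi> \<bullet> T \<phi>) *\<^sub>R \<phi>"
proof -
  obtain \<alpha> where \<alpha>: "T \<phi> = \<alpha> *\<^sub>R \<phi>" using assms unfolding eigenbasis_def by blast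
  have "\<phi> \<bullet> \<phi> = 1" using assms by (auto simp: eigenbasis_def norm_eq_1)
  then show ?thesis by (simp add: \<alpha>)
qed

text \<open>The \<open>infsum\<close> in \<open>op_fun\<close> is 0 by default when the family is
  not summable. Boundedness of \<open>g\<close> on the eigenvalues makes the coefficients square
  summable, which rules the default out.\<close>

lemma op_fun_coeff:
  fixes T :: "'h::{real_inner,banach} \<Rightarrow> 'h"
  assumes ex: "\<exists>\<Phi>. eigenbasis T \<Phi>" and \<Phi>: "\<Phi> = (SOME \<Phi>. eigenbasis T \<Phi>)"
    and bdd: "\<And>\<phi>. \<phi> \<in> \<Phi> \<Longrightarrow> \<bar>g (\<phi> \<bullet> T \<phi>)\<bar> \<le> B" and \<psi>: "\<psi> \<in> \<Phi>"
  shows "\<psi> \<bullet> op_fun g T f = g (\<psi> \<bullet> T \<psi>) * (\<psi> \<bullet> f)"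
proof -
  have "eigenbasis T \<Phi>" unfolding \<Phi> by (rule someI_ex[OF ex])
  then have on: "orthonormal \<Phi>" by (rule eigenbasis_orthonormal)
  have "(\<lambda>\<phi>. (g (\<phi> \<bullet> T \<phi>) * (\<phi> \<bullet> f))\<^sup>2) summable_on \<Phi>"
  proof (rule summable_on_comparison_test)
    show "(\<lambda>\<phi>. B\<^sup>2 * (\<phi> \<bullet> f)\<^sup>2) summable_on \<Phi>"
      by (intro summable_on_cmult_right bessel_summable on)
    show "(g (\<phi> \<bullet> T \<phi>) * (\<phi> \<bullet> f))\<^sup>2 \<le> B\<^sup>2 * (\<phi> \<bullet> f)\<^sup>2" if "\<phi> \<in> \<Phi>" for \<phi>
      using power_mono[OF bdd[OF that], of 2] by (simp add: power_mult_distrib mult_right_mono)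
  qed auto
  then have "(\<lambda>\<phi>. (g (\<phi> \<bullet> T \<phi>) * (\<phi> \<bullet> f)) *\<^sub>R \<phi>) summable_on \<Phi>"
    by (rule orthonormal_series_summable[OF on])
  then have "((\<lambda>\<phi>. (g (\<phi> \<bullet> T \<phi>) * (\<phi> \<bullet> f)) *\<^sub>R \<phi>) has_sum op_fun g T f) \<Phi>"
    unfolding op_fun_def Let_def \<Phi>[symmetric] by (rule has_sum_infsum)
  then show ?thesis by (rule orthonormal_series_coeff[OF on _ \<psi>])
qed

section \<open>Diagonalisation of positive Hilbert--Schmidt operators\<close>

text \<open>Zorn gives a maximal orthonormal set of eigenvectors. Its orthogonal complement is
  closed and, by symmetry, invariant; a nonzero vector there would yield a further eigenvector. The
  hypothesis on subspaces replaces the restriction of \<open>T\<close> to the complement.\<close>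

lemma eigenbasis_exists:
  fixes T :: "'h::{real_inner,banach} \<Rightarrow> 'h"
  assumes lin: "linear T" and sym: "\<And>x y. x \<bullet> T y = T x \<bullet> y"
    and ev: "\<And>W. subspace W \<Longrightarrow> closed W \<Longrightarrow> (\<And>x. x \<in> W \<Longrightarrow> T x \<in> W) \<Longrightarrow> \<exists>x\<in>W. x \<noteq> 0 \<Longrightarrow>
      \<exists>x\<in>W. norm x = 1 \<and> (\<exists>\<alpha>. T x = \<alpha> *\<^sub>R x)"
  shows "\<exists>\<Phi>. eigenbasis T \<Phi>"
proof -
  define A where "A = {\<Phi>. orthonormal \<Phi> \<and> (\<forall>\<phi>\<in>\<Phi>. \<exists>\<alpha>. T \<phi> = \<alpha> *\<^sub>R \<phi>)}"
  have "\<exists>M\<in>A. \<forall>X\<in>A. M \<subseteq> X \<longrightarrow> X = M"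
  proof (rule subset_Zorn')
    fix \<C> assume ch: "subset.chain A \<C>"
    then have sub: "\<C> \<subseteq> A" and tot: "\<And>X Y. X \<in> \<C> \<Longrightarrow> Y \<in> \<C> \<Longrightarrow> X \<subseteq> Y \<or> Y \<subseteq> X"
      by (auto simp: subset_chain_def)
    have "\<phi> \<bullet> \<psi> = 0" if "\<phi> \<in> \<Union>\<C>" "\<psi> \<in> \<Union>\<C>" "\<phi> \<noteq> \<psi>" for \<phi> \<psi>
    proof -
      obtain X Y where XY: "X \<in> \<C>" "Y \<in> \<C>" "\<phi> \<in> X" "\<psi> \<in> Y"
        using \<open>\<phi> \<in> \<Union>\<C>\<close> \<open>\<psi> \<in> \<Union>\<C>\<close> by blast
      then obtain Z where "Z \<in> \<C>" "\<phi> \<in> Z" "\<psi> \<in> Z" using tot[OF XY(1,2)] by blast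
      moreover have "orthonormal Z" using calculation(1) sub by (auto simp: A_def)
      ultimately show ?thesis using \<open>\<phi> \<noteq> \<psi>\<close> by (auto simp: orthonormal_def)
    qed
    moreover have "norm \<phi> = 1" "\<exists>\<alpha>. T \<phi> = \<alpha> *\<^sub>R \<phi>" if "\<phi> \<in> \<Union>\<C>" for \<phi>
      using that sub by (auto simp: A_def orthonormal_def)
    ultimately show "\<Union>\<C> \<in> A" unfolding A_def orthonormal_def by blast
  qed
  then obtain \<Phi> where \<Phi>: "\<Phi> \<in> A" and max: "\<And>X. X \<in> A \<Longrightarrow> \<Phi> \<subseteq> X \<Longrightarrow> X = \<Phi>" by blast
  then have on: "orthonormal \<Phi>" and eig: "\<And>\<phi>. \<phi> \<in> \<Phi> \<Longrightarrow> \<exists>\<alpha>. T \<phi> = \<alpha> *\<^sub>R \<phi>"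
    by (auto simp: A_def)
  have "closure (span \<Phi>) = UNIV"
  proof (rule ccontr)
    assume "closure (span \<Phi>) \<noteq> UNIV"
    then obtain x where x: "x \<notin> closure (span \<Phi>)" by blast
    define W where "W = {y. \<forall>\<phi>\<in>\<Phi>. \<phi> \<bullet> y = 0}"
    \<comment> \<open>\<open>z\<close> is the projection of \<open>x\<close> onto the closed span,
      so \<open>x - z\<close> is a nonzero vector of the complement.\<close>
    obtain z where z: "((\<lambda>\<phi>. (\<phi> \<bullet> x) *\<^sub>R \<phi>) has_sum z) \<Phi>"
      using orthonormal_series_summable[OF on bessel_summable[OF on]] summable_on_def by blast
    have "z \<in> closure (span \<Phi>)"
    proof (rule Lim_in_closed_set[OF closed_closure _ _ z[unfolded has_sum_def]])
      show "\<forall>\<^sub>F F in finite_subsets_at_top \<Phi>. (\<Sum>\<phi>\<in>F. (\<phi> \<bullet> x) *\<^sub>R \<phi>) \<in> closure (span \<Phi>)"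
        by (intro eventually_finite_subsets_at_top_weakI subsetD[OF closure_subset] span_sum span_scale)
          (auto intro: span_base)
    qed simp
    then have "x - z \<noteq> 0" using x by auto
    moreover have "x - z \<in> W"
      using orthonormal_series_coeff[OF on z] by (simp add: W_def inner_diff_right)
    moreover have "subspace W" by (auto simp: W_def subspace_def inner_add_right)
    moreover have "closed W"
    proof -
      have "W = (\<Inter>\<phi>\<in>\<Phi>. {y. \<phi> \<bullet> y = 0})" by (auto simp: W_def)
      then show ?thesis by (simp add: closed_hyperplane closed_INT)
    qed
    moreover have "T y \<in> W" if "y \<in> W" for y
      unfolding W_def
    proof (intro CollectI ballI)
      fix \<phi> assume \<phi>: "\<phi> \<in> \<Phi>"
      obtain \<alpha> where "T \<phi> = \<alpha> *\<^sub>R \<phi>" using eig[OF \<phi>] by blast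
      then show "\<phi> \<bullet> T y = 0" using \<phi> that by (simp add: sym W_def)
    qed
    ultimately obtain w where w: "w \<in> W" "norm w = 1" "\<exists>\<alpha>. T w = \<alpha> *\<^sub>R w"
      using ev[of W] by blast
    have "insert w \<Phi> \<in> A"
      using w on eig unfolding A_def orthonormal_def W_def by (auto simp: inner_commute)
    then have "w \<in> \<Phi>" using max[of "insert w \<Phi>"] by blast
    then show False using w by (auto simp: W_def norm_eq_1)
  qed
  then have "eigenbasis T \<Phi>" using on eig unfolding eigenbasis_def orthonormal_def by simp
  then show ?thesis by (rule exI)
qed

text \<open>For the zero operator every unit vector is an eigenvector.\<close>

lemma orthonormal_basis_exists:
  "\<exists>E::'h::{real_inner,banach} set. orthonormal E \<and> closure (span E) = UNIV"
proof -
  have "\<exists>E. eigenbasis (\<lambda>_::'h. 0) E"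
  proof (rule eigenbasis_exists)
    fix W :: "'h set" assume "subspace W" "\<exists>x\<in>W. x \<noteq> 0"
    then obtain x where "x \<in> W" "x \<noteq> 0" by blast
    then have "(1 / norm x) *\<^sub>R x \<in> W" "norm ((1 / norm x) *\<^sub>R x) = 1"
      using \<open>subspace W\<close> by (auto simp: subspace_def)
    then show "\<exists>x\<in>W. norm x = 1 \<and> (\<exists>\<alpha>. 0 = \<alpha> *\<^sub>R x)" by (metis scaleR_zero_left)
  qed (auto simp: linear_zero)
  then show ?thesis using eigenbasis_orthonormal eigenbasis_dense by blast
qed

text \<open>Cauchy--Schwarz for the coefficients together with Bessel. The set \<Phi> need not be
  complete: \<open>x'\<close> is the part of \<open>x\<close> along \<Phi>, which allows the use on
  tails of a basis.\<close>

lemma norm_le_HS: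
  fixes A :: "'h::{real_inner,banach} \<Rightarrow> 'k::real_normed_vector"
  assumes A: "bounded_linear A" and s: "((\<lambda>\<phi>. (\<phi> \<bullet> x) *\<^sub>R \<phi>) has_sum x') \<Phi>" and on: "orthonormal \<Phi>"
    and S: "0 \<le> S" "\<And>F. finite F \<Longrightarrow> F \<subseteq> \<Phi> \<Longrightarrow> (\<Sum>\<phi>\<in>F. (norm (A \<phi>))\<^sup>2) \<le> S\<^sup>2"
  shows "norm (A x') \<le> S * norm x"
proof -
  have "((\<lambda>\<phi>. (\<phi> \<bullet> x) *\<^sub>R A \<phi>) has_sum A x') \<Phi>"
    using has_sum_bounded_linear[OF A s] linear_scale[OF bounded_linear.linear[OF A]] by (simp add: o_def)
  then have "((\<lambda>F. norm (\<Sum>\<phi>\<in>F. (\<phi> \<bullet> x) *\<^sub>R A \<phi>)) \<longlongrightarrow> norm (A x')) (finite_subsets_at_top \<Phi>)"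
    unfolding has_sum_def by (rule tendsto_norm)
  moreover have "norm (\<Sum>\<phi>\<in>F. (\<phi> \<bullet> x) *\<^sub>R A \<phi>) \<le> S * norm x" if F: "finite F" "F \<subseteq> \<Phi>" for F
  proof -
    have "norm (\<Sum>\<phi>\<in>F. (\<phi> \<bullet> x) *\<^sub>R A \<phi>) \<le> (\<Sum>\<phi>\<in>F. \<bar>\<phi> \<bullet> x\<bar> * \<bar>norm (A \<phi>)\<bar>)"
      by (rule order_trans[OF norm_sum]) simp
    also have "\<dots> \<le> L2_set (\<lambda>\<phi>. \<phi> \<bullet> x) F * L2_set (\<lambda>\<phi>. norm (A \<phi>)) F"
      by (rule L2_set_mult_ineq)
    also have "\<dots> \<le> norm x * S"
    proof (rule mult_mono)
      show "L2_set (\<lambda>\<phi>. \<phi> \<bullet> x) F \<le> norm x"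
        unfolding L2_set_def using bessel_finite[OF orthonormal_subset[OF on F(2)] F(1), of x]
        by (intro real_le_lsqrt) (auto intro: sum_nonneg)
      show "L2_set (\<lambda>\<phi>. norm (A \<phi>)) F \<le> S"
        unfolding L2_set_def using S F by (intro real_le_lsqrt) (auto intro: sum_nonneg)
    qed (auto simp: L2_set_nonneg)
    finally show ?thesis by (simp add: mult.commute)
  qed
  ultimately show ?thesis
    using tendsto_upperbound eventually_finite_subsets_at_top_weakI finite_subsets_at_top_neq_bot
    by (metis (mono_tags, lifting))
qed

text \<open>Minkowski sum of finitely many segments; the vectors may be linearly dependent.\<close>

lemma compact_finite_box: "finite F \<Longrightarrow> compact {\<Sum>e\<in>F. c e *\<^sub>R (v e::'k::real_normed_vector) | c. \<forall>e\<in>F. \<bar>c e\<bar> \<le> 1}"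
proof (induction F rule: finite_induct)
  case empty
  then show ?case by simp
next
  case (insert a F)
  have seg: "compact ((\<lambda>t. t *\<^sub>R v a) ` {-1..1::real})"
    by (intro compact_continuous_image continuous_intros) auto
  have "{\<Sum>e\<in>insert a F. c e *\<^sub>R v e | c. \<forall>e\<in>insert a F. \<bar>c e\<bar> \<le> 1}
      = {x + y | x y. x \<in> (\<lambda>t. t *\<^sub>R v a) ` {-1..1::real} \<and> y \<in> {\<Sum>e\<in>F. c e *\<^sub>R v e | c. \<forall>e\<in>F. \<bar>c e\<bar> \<le> 1}}"
    (is "?L = ?R")
  proof (intro equalityI subsetI)
    fix x assume "x \<in> ?L"
    then show "x \<in> ?R" using insert by (fastforce simp: abs_le_iff)
  next
    fix x assume "x \<in> ?R"
    then obtain t c where t: "-1 \<le> t" "t \<le> 1" and c: "\<forall>e\<in>F. \<bar>c e\<bar> \<le> 1"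
      and x: "x = t *\<^sub>R v a + (\<Sum>e\<in>F. c e *\<^sub>R v e)" by auto
    have "(\<Sum>e\<in>F. (c(a := t)) e *\<^sub>R v e) = (\<Sum>e\<in>F. c e *\<^sub>R v e)"
      by (rule sum.cong) (use insert in auto)
    then have "x = (\<Sum>e\<in>insert a F. (c(a := t)) e *\<^sub>R v e)" using insert x by simp
    moreover have "\<forall>e\<in>insert a F. \<bar>(c(a := t)) e\<bar> \<le> 1" using t c by (auto simp: abs_le_iff)
    ultimately show "x \<in> ?L" by blast
  qed
  then show ?case using compact_sums[OF seg insert.IH] by simp
qed

text \<open>Outside finitely many basis vectors the Hilbert--Schmidt norm of \<open>T\<close> is
  small, so the image of the unit ball is uniformly close to a compact box spanned by finitely many
  images.\<close>

lemma HS_image_compact: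
  fixes T :: "'h::{real_inner,banach} \<Rightarrow> 'h"
  assumes T: "bounded_linear T"
    and HS: "\<And>F. finite F \<Longrightarrow> orthonormal F \<Longrightarrow> (\<Sum>e\<in>F. (norm (T e))\<^sup>2) \<le> K"
  shows "compact (closure (T ` {x. norm x \<le> 1}))"
  unfolding compact_eq_totally_bounded
proof (intro conjI allI impI)
  show "uniform_space_class.complete (closure (T ` {x. norm x \<le> 1}))" by (simp add: complete_eq_closed)
next
  fix \<epsilon> :: real assume "0 < \<epsilon>"
  \<comment> \<open>Three errors of size at most \<open>d\<close> occur: passing from the closure to
    the image, from the image to the box, and from the box to its finite net.\<close>
  define d where "d = \<epsilon> / 4"
  have d: "0 < d" using \<open>0 < \<epsilon>\<close> by (simp add: d_def)
  obtain E :: "'h set" where E: "orthonormal E" "closure (span E) = UNIV"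
    using orthonormal_basis_exists by blast
  have "(\<lambda>e. (norm (T e))\<^sup>2) summable_on E"
  proof (rule nonneg_bdd_above_summable_on)
    show "bdd_above (sum (\<lambda>e. (norm (T e))\<^sup>2) ` {F. F \<subseteq> E \<and> finite F})"
      by (rule bdd_aboveI[of _ K]) (use HS orthonormal_subset[OF E(1)] in blast)
  qed auto
  then obtain L where L: "((\<lambda>e. (norm (T e))\<^sup>2) has_sum L) E" using summable_on_def by blast
  then have "\<forall>\<^sub>F F in finite_subsets_at_top E. dist (\<Sum>e\<in>F. (norm (T e))\<^sup>2) L < d\<^sup>2"
    using d unfolding has_sum_def tendsto_iff by simp
  then obtain E0 where E0: "finite E0" "E0 \<subseteq> E" and small: "dist (\<Sum>e\<in>E0. (norm (T e))\<^sup>2) L < d\<^sup>2"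
    unfolding eventually_finite_subsets_at_top by blast
  define Q where "Q = {\<Sum>e\<in>E0. c e *\<^sub>R T e | c. \<forall>e\<in>E0. \<bar>c e\<bar> \<le> 1}"
  have "compact Q" unfolding Q_def by (rule compact_finite_box[OF E0(1)])
  then obtain k where k: "finite k" "Q \<subseteq> (\<Union>x\<in>k. ball x d)"
    using d unfolding compact_eq_totally_bounded by blast
  have approx: "\<exists>q\<in>Q. dist (T x) q \<le> d" if x: "norm x \<le> 1" for x
  proof -
    define P where "P = (\<Sum>e\<in>E0. (e \<bullet> x) *\<^sub>R e)"
    have s: "((\<lambda>e. (e \<bullet> x) *\<^sub>R e) has_sum (x - P)) (E - E0)"
      unfolding P_def
      by (rule has_sum_Diff[OF orthonormal_expansion has_sum_finite]) (use E E0 in auto)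
    have "norm (T (x - P)) \<le> d * norm x"
    proof (rule norm_le_HS[OF T s orthonormal_subset[OF E(1)]])
      fix F assume F: "finite F" "F \<subseteq> E - E0"
      have "(\<Sum>e\<in>E0. (norm (T e))\<^sup>2) + (\<Sum>e\<in>F. (norm (T e))\<^sup>2) = (\<Sum>e\<in>E0 \<union> F. (norm (T e))\<^sup>2)"
        using E0 F by (intro sum.union_disjoint[symmetric]) auto
      also have "\<dots> \<le> L" by (rule finite_sum_le_has_sum[OF L]) (use E0 F in auto)
      finally show "(\<Sum>e\<in>F. (norm (T e))\<^sup>2) \<le> d\<^sup>2" using small by (simp add: dist_real_def)
    qed (use d in auto)
    also have "\<dots> \<le> d" using x d by (simp add: mult_left_le)
    finally have "dist (T x) (T P) \<le> d"
      by (simp add: dist_norm linear_diff[OF bounded_linear.linear[OF T]])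
    moreover have "T P \<in> Q"
    proof -
      have "\<bar>e \<bullet> x\<bar> \<le> 1" if "e \<in> E0" for e
        using Cauchy_Schwarz_ineq2[of e x] E(1) E0 x that by (auto simp: orthonormal_def)
      moreover have "T P = (\<Sum>e\<in>E0. (e \<bullet> x) *\<^sub>R T e)"
        unfolding P_def using bounded_linear.linear[OF T] by (simp add: linear_sum linear_scale)
      ultimately show ?thesis unfolding Q_def by (intro CollectI exI[of _ "\<lambda>e. e \<bullet> x"]) auto
    qed
    ultimately show ?thesis by blast
  qed
  have "closure (T ` {x. norm x \<le> 1}) \<subseteq> (\<Union>x\<in>k. ball x \<epsilon>)"
  proof
    fix y assume "y \<in> closure (T ` {x. norm x \<le> 1})"
    then obtain x where x: "norm x \<le> 1" "dist (T x) y < d"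
      using d unfolding closure_approachable by blast
    obtain q where q: "q \<in> Q" "dist (T x) q \<le> d" using approx[OF x(1)] by blast
    obtain z where z: "z \<in> k" "dist z q < d" using k(2) q(1) by auto
    have "dist z y \<le> dist z q + dist (T x) q + dist (T x) y"
      by (metis add.commute add_left_mono dist_commute dist_triangle dist_triangle_le group_cancel.add2)
    then have "dist z y < \<epsilon>" using x q z d unfolding d_def by linarith
    then show "y \<in> (\<Union>x\<in>k. ball x \<epsilon>)" using z(1) by auto
  qed
  then show "\<exists>k. finite k \<and> closure (T ` {x. norm x \<le> 1}) \<subseteq> (\<Union>x\<in>k. ball x \<epsilon>)" using k(1) by blast
qed

text \<open>The quadratic polynomial in t given by the form at x + t y is nonnegative; evaluate it
  at its minimiser.\<close>

lemma positive_form_Cauchy_Schwarz: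
  assumes lin: "linear T" and sym: "\<And>x y. x \<bullet> T y = T x \<bullet> y" and pos: "\<And>x. 0 \<le> x \<bullet> T x"
  shows "(x \<bullet> T y)\<^sup>2 \<le> (x \<bullet> T x) * (y \<bullet> T y)"
proof -
  have q: "0 \<le> x \<bullet> T x + 2 * t * (x \<bullet> T y) + t\<^sup>2 * (y \<bullet> T y)" for t
  proof -
    have "(x + t *\<^sub>R y) \<bullet> T (x + t *\<^sub>R y) = x \<bullet> T x + 2 * t * (x \<bullet> T y) + t\<^sup>2 * (y \<bullet> T y)"
    proof -
      have "y \<bullet> T x = x \<bullet> T y" using sym[of y x] by (simp add: inner_commute)
      then show ?thesis
        by (simp add: linear_add[OF lin] linear_scale[OF lin] inner_add_left inner_add_right
            power2_eq_square distrib_left)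
    qed
    then show ?thesis using pos[of "x + t *\<^sub>R y"] by simp
  qed
  show ?thesis
  proof (cases "y \<bullet> T y = 0")
    case True
    have "x \<bullet> T y = 0"
    proof (rule ccontr)
      assume ne: "x \<bullet> T y \<noteq> 0"
      \<comment> \<open>Without quadratic term the polynomial is affine in t, and this t would give
        it the value -1.\<close>
      have "0 \<le> x \<bullet> T x + 2 * (- (x \<bullet> T x + 1) / (2 * (x \<bullet> T y))) * (x \<bullet> T y)"
        using q[of "- (x \<bullet> T x + 1) / (2 * (x \<bullet> T y))"] True by simp
      also have "\<dots> = - 1" using ne by (simp add: field_simps)
      finally show False by simp
    qed
    with True show ?thesis by simp
  next
    case False
    then have p: "0 < y \<bullet> T y" using pos[of y] by simp
    have "0 \<le> x \<bullet> T x - (x \<bullet> T y)\<^sup>2 / (y \<bullet> T y)"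
      using q[of "- (x \<bullet> T y) / (y \<bullet> T y)"] p by (simp add: field_simps power2_eq_square)
    then show ?thesis using p by (simp add: field_simps)
  qed
qed

text \<open>On an invariant closed subspace the supremum \<open>m\<close> of the Rayleigh quotient
  is an eigenvalue: compactness of the image extracts an eigenvector from a maximising sequence. If
  \<open>m = 0\<close>, the operator vanishes on the subspace.\<close>

theorem eigenbasis_exists_HS:
  fixes T :: "'h::{real_inner,banach} \<Rightarrow> 'h"
  assumes T: "bounded_linear T" and sym: "\<And>x y. x \<bullet> T y = T x \<bullet> y" and pos: "\<And>x. 0 \<le> x \<bullet> T x"
    and HS: "\<And>F. finite F \<Longrightarrow> orthonormal F \<Longrightarrow> (\<Sum>e\<in>F. (norm (T e))\<^sup>2) \<le> K"
  shows "\<exists>\<Phi>. eigenbasis T \<Phi>"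
proof (rule eigenbasis_exists[OF bounded_linear.linear[OF T] sym])
  note lin = bounded_linear.linear[OF T]
  fix W assume W: "subspace W" "closed W" and inv: "\<And>x. x \<in> W \<Longrightarrow> T x \<in> W" and ne: "\<exists>x\<in>W. x \<noteq> 0"
  define U where "U = {x\<in>W. norm x = 1}"
  define m where "m = (SUP x\<in>U. x \<bullet> T x)"
  have scaled: "(1 / norm x) *\<^sub>R x \<in> U" if "x \<in> W" "x \<noteq> 0" for x
    using that W(1) by (simp add: U_def subspace_scale)
  then have Une: "U \<noteq> {}" using ne by blast
  obtain B where B: "\<And>x. norm (T x) \<le> norm x * B" using bounded_linear.bounded[OF T] by blast
  have bdd: "bdd_above ((\<lambda>x. x \<bullet> T x) ` U)"
  proof (rule bdd_aboveI2)
    fix x assume "x \<in> U"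
    then show "x \<bullet> T x \<le> B" using norm_cauchy_schwarz[of x "T x"] B[of x] by (simp add: U_def)
  qed
  have le_m: "x \<bullet> T x \<le> m * (norm x)\<^sup>2" if "x \<in> W" for x
  proof (cases "x = 0")
    case False
    then have "((1 / norm x) *\<^sub>R x) \<bullet> T ((1 / norm x) *\<^sub>R x) \<le> m"
      unfolding m_def using scaled[OF that] bdd by (intro cSUP_upper) auto
    with False show ?thesis by (simp add: linear_scale[OF lin] field_simps power2_eq_square)
  qed simp
  have m0: "0 \<le> m"
  proof -
    obtain x where "x \<in> U" using Une by blast
    then show ?thesis using le_m[of x] pos[of x] by (simp add: U_def)
  qed
  \<comment> \<open>Cauchy--Schwarz for the form of \<open>T\<close>, applied to the pair
    \<open>T x\<close>, \<open>x\<close>.\<close>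
  have norm_T: "(norm (T x))\<^sup>2 \<le> m * (x \<bullet> T x)" if "x \<in> W" for x
  proof (cases "T x = 0")
    case False
    have "((norm (T x))\<^sup>2)\<^sup>2 = (T x \<bullet> T x)\<^sup>2" by (simp add: power2_norm_eq_inner)
    also have "\<dots> \<le> (T x \<bullet> T (T x)) * (x \<bullet> T x)"
      by (rule positive_form_Cauchy_Schwarz[OF lin sym pos])
    also have "\<dots> \<le> (m * (norm (T x))\<^sup>2) * (x \<bullet> T x)"
      by (intro mult_right_mono le_m inv that pos)
    finally have "(norm (T x))\<^sup>2 * (norm (T x))\<^sup>2 \<le> (norm (T x))\<^sup>2 * (m * (x \<bullet> T x))"
      by (simp add: power2_eq_square algebra_simps)
    then show ?thesis by (rule mult_left_le_imp_le) (use False in simp)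
  qed (use m0 pos in simp)
  show "\<exists>x\<in>W. norm x = 1 \<and> (\<exists>\<alpha>. T x = \<alpha> *\<^sub>R x)"
  proof (cases "m = 0")
    case True
    obtain x where x: "x \<in> U" using Une by blast
    then have "T x = 0 *\<^sub>R x" using norm_T[of x] True by (simp add: U_def)
    then show ?thesis using x unfolding U_def by blast
  next
    case False
    then have m: "0 < m" using m0 by simp
    have "\<exists>x\<in>U. m - inverse (real (Suc n)) < x \<bullet> T x" for n
      using less_cSUP_iff[OF Une bdd, of "m - inverse (real (Suc n))"] unfolding m_def by simp
    then obtain x where xU: "\<And>n. x n \<in> U" and x: "\<And>n. m - inverse (real (Suc n)) < x n \<bullet> T (x n)"
      by metis
    \<comment> \<open>The squared defect is at most \<open>m\<close> times the gap of the Rayleigh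
      quotient to \<open>m\<close>, by \<open>norm_T\<close>.\<close>
    have lim0: "(\<lambda>n. T (x n) - m *\<^sub>R x n) \<longlonglongrightarrow> 0"
    proof (rule tendsto_norm_zero_cancel, rule tendsto_0_le)
      have "(\<lambda>n. sqrt (m * inverse (real (Suc n)))) \<longlonglongrightarrow> sqrt (m * 0)"
        by (intro tendsto_intros LIMSEQ_inverse_real_of_nat)
      then show "(\<lambda>n. sqrt (m * inverse (real (Suc n)))) \<longlonglongrightarrow> 0" by simp
      have "norm (T (x n) - m *\<^sub>R x n) \<le> sqrt (m * inverse (real (Suc n)))" for n
      proof (rule real_le_rsqrt)
        have n1: "x n \<bullet> x n = 1" "x n \<in> W" using xU[of n] by (auto simp: U_def norm_eq_1)
        have "(norm (T (x n) - m *\<^sub>R x n))\<^sup>2 = (norm (T (x n)))\<^sup>2 - 2 * m * (x n \<bullet> T (x n)) + m * m"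
          unfolding power2_norm_eq_inner using n1
          by (simp add: algebra_simps inner_commute)
        also have "\<dots> \<le> m * (m - x n \<bullet> T (x n))" using norm_T[OF n1(2)] by (simp add: algebra_simps)
        also have "\<dots> \<le> m * inverse (real (Suc n))" using x[of n] m by (intro mult_left_mono) auto
        finally show "(norm (T (x n) - m *\<^sub>R x n))\<^sup>2 \<le> m * inverse (real (Suc n))" .
      qed
      moreover have "0 \<le> sqrt (m * inverse (real (Suc n)))" for n
        using m by simp
      ultimately show "\<forall>\<^sub>F n in sequentially. norm (norm (T (x n) - m *\<^sub>R x n))
          \<le> norm (sqrt (m * inverse (real (Suc n)))) * 1"
        by (intro always_eventually allI) (simp only: real_norm_def abs_norm_cancel abs_of_nonneg mult_1_right)
    qed
    have "\<forall>n. T (x n) \<in> closure (T ` {x. norm x \<le> 1})"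
      using xU by (auto simp: U_def intro!: subsetD[OF closure_subset])
    then obtain y r where r: "strict_mono (r::nat\<Rightarrow>nat)" and y: "((\<lambda>n. T (x n)) \<circ> r) \<longlonglongrightarrow> y"
      using HS_image_compact[OF T HS] unfolding compact_def by metis
    \<comment> \<open>Compactness controls only the images; as \<open>m\<close> is nonzero and the
      defect tends to 0, the vectors themselves converge along the subsequence.\<close>
    have "(\<lambda>n. (1 / m) *\<^sub>R (T (x (r n)) - (T (x (r n)) - m *\<^sub>R x (r n)))) \<longlonglongrightarrow> (1 / m) *\<^sub>R (y - 0)"
      using y LIMSEQ_subseq_LIMSEQ[OF lim0 r] by (intro tendsto_intros) (auto simp: o_def)
    then have xr: "(\<lambda>n. x (r n)) \<longlonglongrightarrow> (1 / m) *\<^sub>R y" using m by simp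
    define w where "w = (1 / m) *\<^sub>R y"
    have "w \<in> W" unfolding w_def
      by (rule closed_sequentially[OF W(2) _ xr]) (use xU in \<open>auto simp: U_def\<close>)
    moreover have "norm w = 1"
      using LIMSEQ_unique[OF tendsto_norm[OF xr], of 1] xU m unfolding w_def U_def by auto
    moreover have "T w = m *\<^sub>R w"
    proof -
      have "(\<lambda>n. T (x (r n))) \<longlonglongrightarrow> T w" unfolding w_def by (rule bounded_linear.tendsto[OF T xr])
      moreover have "(\<lambda>n. T (x (r n))) \<longlonglongrightarrow> y" using y by (simp add: o_def)
      ultimately have "T w = y" by (rule LIMSEQ_unique)
      then show ?thesis using m by (simp add: w_def)
    qed
    ultimately show ?thesis by blast
  qed
qed

section \<open>Derivatives of the kernel in the reproducing kernel Hilbert space\<close>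

lemma mvt_symmetric:
  fixes F F' :: "real \<Rightarrow> real"
  assumes F: "\<And>u. \<bar>u\<bar> \<le> \<bar>s\<bar> \<Longrightarrow> (F has_real_derivative F' u) (at u)"
  shows "\<exists>\<xi>. \<bar>\<xi>\<bar> \<le> \<bar>s\<bar> \<and> F s - F 0 = s * F' \<xi>"
proof (cases s "0::real" rule: linorder_cases)
  case less
  then obtain z where "s < z" "z < 0" "F 0 - F s = (0 - s) * F' z"
    using MVT2[of s 0 F F'] F by auto
  then show ?thesis using less by (intro exI[of _ z]) (auto simp: algebra_simps)
next
  case greater
  then obtain z where "0 < z" "z < s" "F s - F 0 = (s - 0) * F' z"
    using MVT2[of 0 s F F'] F by auto
  then show ?thesis using greater by (intro exI[of _ z]) auto
qed auto

text \<open>The second difference is the increment of F t - F (t - s) over [0, s]. One mean value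
  theorem applies to this function, a second one to \<open>F1\<close> between t - s and t.\<close>

lemma second_difference_mvt:
  fixes F F1 F2 :: "real \<Rightarrow> real"
  assumes s: "0 < s" and F: "\<And>u. \<bar>u\<bar> \<le> s \<Longrightarrow> (F has_real_derivative F1 u) (at u)"
    and F1: "\<And>u. \<bar>u\<bar> \<le> s \<Longrightarrow> (F1 has_real_derivative F2 u) (at u)"
  shows "\<exists>\<xi>. \<bar>\<xi>\<bar> \<le> s \<and> F s - 2 * F 0 + F (- s) = s\<^sup>2 * F2 \<xi>"
proof -
  have shift: "((\<lambda>t. F (t - s)) has_real_derivative F1 (t - s)) (at t)" if "0 \<le> t" "t \<le> s" for t
  proof -
    have "(F has_real_derivative F1 (t - s)) (at (t + - s))" using F[of "t - s"] that by simp
    then show ?thesis using DERIV_shift[of F _ t "- s"] by simp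
  qed
  obtain t where t: "0 < t" "t < s"
    and eq1: "(F s - F (s - s)) - (F 0 - F (0 - s)) = (s - 0) * (F1 t - F1 (t - s))"
    using MVT2[OF s DERIV_diff[OF F shift]] by auto
  obtain \<xi> where \<xi>: "t - s < \<xi>" "\<xi> < t" and eq2: "F1 t - F1 (t - s) = (t - (t - s)) * F2 \<xi>"
    using MVT2[of "t - s" t F1 F2] s t F1 by (auto simp: abs_le_iff)
  have "F s - 2 * F 0 + F (- s) = s\<^sup>2 * F2 \<xi>"
    using eq1 eq2 by (simp add: power2_eq_square)
  moreover have "\<bar>\<xi>\<bar> \<le> s" using \<xi> t by auto
  ultimately show ?thesis by blast
qed

text \<open>\<open>F1\<close> is differentiable at 0 only, so L'Hopital can be applied once; what
  remains is the symmetric difference quotient of \<open>F1\<close>.\<close>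

lemma second_difference_limit:
  fixes F F1 :: "real \<Rightarrow> real"
  assumes r: "0 < r" and F: "\<And>u. \<bar>u\<bar> < r \<Longrightarrow> (F has_real_derivative F1 u) (at u)"
    and F1: "(F1 has_real_derivative c) (at 0)"
  shows "((\<lambda>s. (F s - 2 * F 0 + F (- s)) / s\<^sup>2) \<longlongrightarrow> c) (at_right 0)"
proof (rule lhopital_right[where f' = "\<lambda>s. F1 s - F1 (- s)" and g' = "\<lambda>s. 2 * s"])
  have ev: "\<forall>\<^sub>F s in at_right 0. 0 < s \<and> s < r"
    by (rule eventually_at_rightI[OF _ r]) auto
  have "isCont F 0" using F[of 0] r DERIV_isCont by auto
  then have F0: "(F \<longlongrightarrow> F 0) (at 0)" by (simp add: isCont_def)
  then have F0r: "(F \<longlongrightarrow> F 0) (at_right 0)" by (rule filterlim_at_split[THEN iffD1, THEN conjunct2])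
  have "((\<lambda>s. F (- s)) \<longlongrightarrow> F 0) (at_right 0)"
    using F0 by (simp add: filterlim_at_split filterlim_at_left_to_right)
  with F0r have "((\<lambda>s. F s - 2 * F 0 + F (- s)) \<longlongrightarrow> F 0 - 2 * F 0 + F 0) (at_right 0)"
    by (intro tendsto_intros)
  then show "((\<lambda>s. F s - 2 * F 0 + F (- s)) \<longlongrightarrow> 0) (at_right 0)" by simp
  show "((\<lambda>s::real. s\<^sup>2) \<longlongrightarrow> 0) (at_right 0)" by (auto intro!: tendsto_eq_intros)
  show "\<forall>\<^sub>F s in at_right 0. s\<^sup>2 \<noteq> (0::real)" "\<forall>\<^sub>F s in at_right 0. 2 * s \<noteq> (0::real)"
    using ev by (auto elim: eventually_mono)
  show "\<forall>\<^sub>F s in at_right 0. ((\<lambda>s. s\<^sup>2) has_real_derivative 2 * s) (at s)"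
    by (intro always_eventually allI) (auto intro!: derivative_eq_intros)
  show "\<forall>\<^sub>F s in at_right 0. ((\<lambda>s. F s - 2 * F 0 + F (- s)) has_real_derivative F1 s - F1 (- s)) (at s)"
    using ev
  proof (rule eventually_mono)
    fix s assume s: "0 < s \<and> s < r"
    have "((\<lambda>s. F (- s)) has_real_derivative F1 (- s) * (- 1)) (at s)"
      by (rule DERIV_chain2[where g = uminus]) (use s in \<open>auto intro!: F derivative_eq_intros\<close>)
    then show "((\<lambda>s. F s - 2 * F 0 + F (- s)) has_real_derivative F1 s - F1 (- s)) (at s)"
      using s F[of s] by (auto intro!: derivative_eq_intros)
  qed
  have lim: "((\<lambda>s. (F1 s - F1 0) / s) \<longlongrightarrow> c) (at 0)" using F1 by (simp add: has_field_derivative_iff)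
  then have l1: "((\<lambda>s. (F1 s - F1 0) / s) \<longlongrightarrow> c) (at_right 0)"
    and l2: "((\<lambda>s. (F1 (- s) - F1 0) / (- s)) \<longlongrightarrow> c) (at_right 0)"
    by (simp_all add: filterlim_at_split filterlim_at_left_to_right)
  have "((\<lambda>s. ((F1 s - F1 0) / s + (F1 (- s) - F1 0) / (- s)) / 2) \<longlongrightarrow> (c + c) / 2) (at_right 0)"
    by (intro tendsto_intros l1 l2) auto
  moreover have "\<forall>\<^sub>F s in at_right 0. ((F1 s - F1 0) / s + (F1 (- s) - F1 0) / (- s)) / 2
      = (F1 s - F1 (- s)) / (2 * s)"
    using ev by (rule eventually_mono) (auto simp: field_simps)
  ultimately show "((\<lambda>s. (F1 s - F1 (- s)) / (2 * s)) \<longlongrightarrow> c) (at_right 0)"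
    using Lim_transform_eventually by fastforce
qed

text \<open>Expanding the squared distance of Q s and Q t into inner products, all of them near c,
  leaves c - 2 c + c = 0. Convergence in the Hilbert space thus follows from that of scalar kernel
  values.\<close>

lemma hilbert_convergent:
  fixes Q :: "'b \<Rightarrow> 'h::{real_inner,banach}"
  assumes ne: "F \<noteq> bot"
    and c: "\<And>e. 0 < e \<Longrightarrow> \<exists>P. eventually P F \<and> (\<forall>s t. P s \<longrightarrow> P t \<longrightarrow> \<bar>Q s \<bullet> Q t - c\<bar> < e)"
  shows "\<exists>L. (Q \<longlongrightarrow> L) F"
proof -
  have "\<exists>P. eventually P F \<and> (\<forall>s t. P s \<and> P t \<longrightarrow> dist (Q s) (Q t) < e)" if e: "0 < e" for e :: real
  proof -
    obtain P where P: "eventually P F" and cl: "\<And>s t. P s \<Longrightarrow> P t \<Longrightarrow> \<bar>Q s \<bullet> Q t - c\<bar> < e\<^sup>2 / 4"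
      using c[of "e\<^sup>2 / 4"] e by auto
    have "dist (Q s) (Q t) < e" if "P s" "P t" for s t
    proof -
      have "(dist (Q s) (Q t))\<^sup>2 = (Q s \<bullet> Q s - c) - 2 * (Q s \<bullet> Q t - c) + (Q t \<bullet> Q t - c)"
        unfolding dist_norm power2_norm_eq_inner by (simp add: algebra_simps inner_commute)
      also have "\<dots> < e\<^sup>2"
      proof -
        have "Q s \<bullet> Q s - c < e\<^sup>2 / 4" "Q t \<bullet> Q t - c < e\<^sup>2 / 4" "- (Q s \<bullet> Q t - c) < e\<^sup>2 / 4"
          using cl[OF that] cl[OF that(1,1)] cl[OF that(2,2)] unfolding abs_less_iff by blast+
        moreover have "a - 2 * b + d < q" if "a < q / 4" "d < q / 4" "- b < q / 4" for a b d q :: real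
          using that by linarith
        ultimately show ?thesis by blast
      qed
      finally show ?thesis using e by (simp add: power2_less_imp_less)
    qed
    then show ?thesis using P by blast
  qed
  then have "cauchy_filter (filtermap Q F)"
    by (simp add: cauchy_filter_metric_filtermap)
  moreover have "uniform_space_class.complete (UNIV::'h set)"
    by (meson Cauchy_convergent UNIV_I complete_def convergent_def)
  moreover have "filtermap Q F \<noteq> bot" using ne by (simp add: filtermap_bot_iff)
  ultimately obtain L' where "filtermap Q F \<le> nhds L'"
    using complete_uniform[where S=UNIV] by force
  then show ?thesis unfolding filterlim_def by blast
qed

lemma pd_DERIV:
  assumes "(\<lambda>t. f (z + t *\<^sub>R j)) differentiable (at 0)"
  shows "((\<lambda>t. f (z + t *\<^sub>R j)) has_real_derivative pd j f z) (at 0)"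
  using assms unfolding pd_def DERIV_deriv_iff_real_differentiable .

lemma DERIV_line_shift:
  fixes f :: "'a::real_vector \<Rightarrow> real"
  assumes "((\<lambda>t. f ((z + u *\<^sub>R j) + t *\<^sub>R j)) has_real_derivative D) (at 0)"
  shows "((\<lambda>t. f (z + t *\<^sub>R j)) has_real_derivative D) (at u)"
proof -
  have "((\<lambda>t. f (z + (t + u) *\<^sub>R j)) has_real_derivative D) (at 0)"
    using assms by (simp add: scaleR_add_left add.assoc add.commute[of "u *\<^sub>R j"])
  then show ?thesis using DERIV_shift[of "\<lambda>t. f (z + t *\<^sub>R j)" D 0 u] by simp
qed

text \<open>The squared distance of two feature vectors is a combination of three kernel values that
  vanishes on the diagonal.\<close>

lemma continuous_on_hilbert_kernel:
  fixes \<Psi> :: "'a::topological_space \<Rightarrow> 'h::real_inner"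
  assumes K: "\<And>x y. x \<in> S \<Longrightarrow> y \<in> S \<Longrightarrow> \<Psi> x \<bullet> \<Psi> y = K (x, y)"
    and cont: "continuous_on (S \<times> S) K"
  shows "continuous_on S \<Psi>"
  unfolding continuous_on_def
proof
  fix x assume x: "x \<in> S"
  have c1: "continuous_on S (\<lambda>y. K (y, y))" "continuous_on S (\<lambda>y. K (y, x))"
    using x by (auto intro!: continuous_on_compose2[OF cont] continuous_intros)
  have "((\<lambda>y. sqrt (K (y, y) - 2 * K (y, x) + K (x, x))) \<longlongrightarrow> sqrt (K (x, x) - 2 * K (x, x) + K (x, x)))
      (at x within S)"
    using c1 x unfolding continuous_on_def by (intro tendsto_intros) auto
  then have "((\<lambda>y. sqrt (K (y, y) - 2 * K (y, x) + K (x, x))) \<longlongrightarrow> 0) (at x within S)" by simp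
  moreover have "\<forall>\<^sub>F y in at x within S. sqrt (K (y, y) - 2 * K (y, x) + K (x, x)) = dist (\<Psi> y) (\<Psi> x)"
    unfolding eventually_at_filter
  proof (intro always_eventually allI impI)
    fix y assume "y \<in> S"
    then have "K (y, y) - 2 * K (y, x) + K (x, x) = (dist (\<Psi> y) (\<Psi> x))\<^sup>2"
      unfolding dist_norm power2_norm_eq_inner using x
      by (simp add: K[symmetric] inner_diff_left inner_diff_right inner_commute)
    then show "sqrt (K (y, y) - 2 * K (y, x) + K (x, x)) = dist (\<Psi> y) (\<Psi> x)" by simp
  qed
  ultimately have "((\<lambda>y. dist (\<Psi> y) (\<Psi> x)) \<longlongrightarrow> 0) (at x within S)"
    by (rule Lim_transform_eventually)
  then show "(\<Psi> \<longlongrightarrow> \<Psi> x) (at x within S)" by (rule tendsto_dist_iff[THEN iffD2])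
qed

lemma continuous_at_product_box:
  fixes K :: "'a::real_normed_vector \<times> 'a \<Rightarrow> real"
  assumes S: "open S" and cont: "continuous_on (S \<times> S) K" and xy: "x \<in> S" "y \<in> S"
    and i: "norm i = 1" and e: "0 < e"
  shows "\<exists>d>0. \<forall>s t. \<bar>s\<bar> < d \<longrightarrow> \<bar>t\<bar> < d \<longrightarrow> x + s *\<^sub>R i \<in> S \<and> y + t *\<^sub>R i \<in> S \<and>
    \<bar>K (x + s *\<^sub>R i, y + t *\<^sub>R i) - K (x, y)\<bar> < e"
proof -
  obtain r where r: "0 < r" "ball x r \<subseteq> S" using S xy(1) open_contains_ball by blast
  obtain r' where r': "0 < r'" "ball y r' \<subseteq> S" using S xy(2) open_contains_ball by blast
  obtain q where q: "0 < q"
    and close: "\<And>z. z \<in> S \<times> S \<Longrightarrow> dist z (x, y) < q \<Longrightarrow> dist (K z) (K (x, y)) < e"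
    using cont xy e unfolding continuous_on_iff by (metis SigmaI)
  define d where "d = min (min r r') (q / 2)"
  have d: "0 < d" using r r' q by (simp add: d_def)
  have "x + s *\<^sub>R i \<in> S \<and> y + t *\<^sub>R i \<in> S \<and> \<bar>K (x + s *\<^sub>R i, y + t *\<^sub>R i) - K (x, y)\<bar> < e"
    if st: "\<bar>s\<bar> < d" "\<bar>t\<bar> < d" for s t
  proof -
    have mem: "x + s *\<^sub>R i \<in> S" "y + t *\<^sub>R i \<in> S"
      using st r r' i by (auto simp: d_def dist_norm subset_iff)
    have "dist (x + s *\<^sub>R i, y + t *\<^sub>R i) (x, y) \<le> \<bar>s\<bar> + \<bar>t\<bar>"
      unfolding dist_Pair_Pair using i sqrt_sum_squares_le_sum_abs[of s t] by (simp add: dist_norm)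
    also have "\<dots> < q" using st by (auto simp: d_def)
    finally show ?thesis using mem close[of "(x + s *\<^sub>R i, y + t *\<^sub>R i)"] by (simp add: dist_real_def)
  qed
  then show ?thesis using d by blast
qed

section \<open>The feature map and its first two derivatives\<close>

locale smooth_rkhs =
  fixes \<Omega> :: "'a::euclidean_space set" and k :: "'a \<times> 'a \<Rightarrow> real"
    and evf :: "'h::{real_inner,banach} \<Rightarrow> 'a \<Rightarrow> real"
  assumes open_\<Omega>: "open \<Omega>" and rkhs: "rkhs \<Omega> k evf"
    and k_exists: "\<And>bs. set bs \<subseteq> Basis \<Longrightarrow> length bs \<le> 2 \<Longrightarrow> iter_pd_exists (\<Omega> \<times> \<Omega>) (diag_dirs bs) k"
    and k_continuous: "\<And>bs. set bs \<subseteq> Basis \<Longrightarrow> length bs \<le> 2 \<Longrightarrow> continuous_on (\<Omega> \<times> \<Omega>) (iter_pd (diag_dirs bs) k)"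
begin

definition kf :: "'a \<Rightarrow> 'h" where
  "kf x = (SOME kx. (\<forall>y\<in>\<Omega>. evf kx y = k (x, y)) \<and> (\<forall>f. evf f x = f \<bullet> kx))"

lemma kf: assumes "x \<in> \<Omega>" shows evf_kf: "y \<in> \<Omega> \<Longrightarrow> evf (kf x) y = k (x, y)" and evf_inner: "evf f x = f \<bullet> kf x"
proof -
  have "\<exists>kx. (\<forall>y\<in>\<Omega>. evf kx y = k (x, y)) \<and> (\<forall>f. evf f x = f \<bullet> kx)"
    using rkhs assms by (auto simp: rkhs_def)
  from someI_ex[OF this] have "(\<forall>y\<in>\<Omega>. evf (kf x) y = k (x, y)) \<and> (\<forall>f. evf f x = f \<bullet> kf x)"
    unfolding kf_def .
  then show "y \<in> \<Omega> \<Longrightarrow> evf (kf x) y = k (x, y)" "evf f x = f \<bullet> kf x" by blast+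
qed

lemma k_inner: "x \<in> \<Omega> \<Longrightarrow> y \<in> \<Omega> \<Longrightarrow> k (x, y) = kf x \<bullet> kf y"
  using evf_kf[of x y] evf_inner[of y "kf x"] by simp

lemma k_sym: "x \<in> \<Omega> \<Longrightarrow> y \<in> \<Omega> \<Longrightarrow> k (x, y) = k (y, x)"
  by (simp add: k_inner inner_commute)

lemma eq_by_kf: assumes "\<And>y. y \<in> \<Omega> \<Longrightarrow> h \<bullet> kf y = h' \<bullet> kf y" shows "h = h'"
proof -
  have "\<forall>x\<in>\<Omega>. evf h x = evf h' x" using assms by (simp add: evf_inner)
  then show ?thesis using rkhs unfolding rkhs_def by blast
qed

lemma elem_of_eq: "(\<And>y. y \<in> \<Omega> \<Longrightarrow> h \<bullet> kf y = \<phi> y) \<Longrightarrow> elem_of \<Omega> evf \<phi> = h"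
  unfolding elem_of_def
proof (rule the_equality)
  show "h' = h" if "\<forall>y\<in>\<Omega>. evf h' y = \<phi> y" "\<And>y. y \<in> \<Omega> \<Longrightarrow> h \<bullet> kf y = \<phi> y" for h'
    using that by (intro eq_by_kf) (simp add: evf_inner)
qed (simp add: evf_inner)

lemma kf_continuous: "continuous_on \<Omega> kf"
proof (rule continuous_on_hilbert_kernel[where K = k])
  show "continuous_on (\<Omega> \<times> \<Omega>) k"
    using k_continuous[of "[]"] by (simp add: diag_dirs_def iter_pd_def)
qed (simp add: k_inner)

abbreviation K1 :: "'a \<Rightarrow> 'a \<times> 'a \<Rightarrow> real" where "K1 i \<equiv> iter_pd (diag_dirs [i]) k"
abbreviation K2 :: "'a \<Rightarrow> 'a \<times> 'a \<Rightarrow> real" where "K2 i \<equiv> iter_pd (diag_dirs [i, i]) k"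

lemma K1_eq: "K1 i = pd (i, 0) (pd (0, i) k)"
  by (simp add: diag_dirs_def iter_pd_def)

lemma K2_eq: "K2 i = pd (i, 0) (pd (i, 0) (pd (0, i) (pd (0, i) k)))"
  by (simp add: diag_dirs_def iter_pd_def)

lemma line_nhds:
  assumes "x + u *\<^sub>R i \<in> \<Omega>"
  shows "\<forall>\<^sub>F s in nhds (u::real). x + s *\<^sub>R i \<in> \<Omega>"
proof -
  have "open ((\<lambda>s::real. x + s *\<^sub>R i) -` \<Omega>)"
    by (intro open_vimage open_\<Omega> continuous_intros)
  then show ?thesis unfolding eventually_nhds using assms by (metis vimageI vimageE)
qed

lemma line_at: "x + u *\<^sub>R i \<in> \<Omega> \<Longrightarrow> \<forall>\<^sub>F s in at (u::real). x + s *\<^sub>R i \<in> \<Omega>"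
  unfolding eventually_at_filter by (drule line_nhds) (auto elim: eventually_mono)

lemma DERIV_second:
  fixes f :: "'a \<times> 'a \<Rightarrow> real"
  assumes "(\<lambda>t. f ((x, y + u *\<^sub>R i) + t *\<^sub>R (0, i))) differentiable (at 0)"
  shows "((\<lambda>t. f (x, y + t *\<^sub>R i)) has_real_derivative pd (0, i) f (x, y + u *\<^sub>R i)) (at u)"
  using DERIV_line_shift[of f "(x, y)" u "(0, i)"] pd_DERIV[OF assms] by simp

lemma DERIV_first:
  fixes f :: "'a \<times> 'a \<Rightarrow> real"
  assumes "(\<lambda>t. f ((x + u *\<^sub>R i, y) + t *\<^sub>R (i, 0))) differentiable (at 0)"
  shows "((\<lambda>t. f (x + t *\<^sub>R i, y)) has_real_derivative pd (i, 0) f (x + u *\<^sub>R i, y)) (at u)"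
  using DERIV_line_shift[of f "(x, y)" u "(i, 0)"] pd_DERIV[OF assms] by simp

text \<open>\<open>diag_dirs\<close> differentiates in the second argument first, and existence is
  guaranteed in this order. The offsets u and v make the derivatives available at every point of a
  line, as the mean value theorem demands.\<close>

lemma mixed_diffs:
  assumes i: "i \<in> Basis" and x: "x + u *\<^sub>R i \<in> \<Omega>" and y: "y + v *\<^sub>R i \<in> \<Omega>"
  defines "X \<equiv> x + u *\<^sub>R i" and "Y \<equiv> y + v *\<^sub>R i"
  shows "((\<lambda>t. k (X, y + t *\<^sub>R i)) has_real_derivative pd (0, i) k (X, Y)) (at v)"
    and "((\<lambda>t. pd (0, i) k (X, y + t *\<^sub>R i)) has_real_derivative pd (0, i) (pd (0, i) k) (X, Y)) (at v)"
    and "((\<lambda>s. pd (0, i) k (x + s *\<^sub>R i, Y)) has_real_derivative K1 i (X, Y)) (at u)"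
    and "((\<lambda>s. pd (0, i) (pd (0, i) k) (x + s *\<^sub>R i, Y)) has_real_derivative
      pd (i, 0) (pd (0, i) (pd (0, i) k)) (X, Y)) (at u)"
    and "((\<lambda>s. pd (i, 0) (pd (0, i) (pd (0, i) k)) (x + s *\<^sub>R i, Y)) has_real_derivative K2 i (X, Y)) (at u)"
proof -
  have XY: "(X, Y) \<in> \<Omega> \<times> \<Omega>" using x y by (simp add: X_def Y_def)
  note e1 = k_exists[of "[i]"] and e2 = k_exists[of "[i, i]"]
  show "((\<lambda>t. k (X, y + t *\<^sub>R i)) has_real_derivative pd (0, i) k (X, Y)) (at v)"
    unfolding Y_def by (rule DERIV_second)
      (use e1 i XY in \<open>simp add: diag_dirs_def iter_pd_def Y_def\<close>)
  show "((\<lambda>t. pd (0, i) k (X, y + t *\<^sub>R i)) has_real_derivative pd (0, i) (pd (0, i) k) (X, Y)) (at v)"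
    unfolding Y_def by (rule DERIV_second)
      (use e2 i XY in \<open>simp add: diag_dirs_def iter_pd_def Y_def\<close>)
  show "((\<lambda>s. pd (0, i) k (x + s *\<^sub>R i, Y)) has_real_derivative K1 i (X, Y)) (at u)"
    unfolding X_def K1_eq by (rule DERIV_first)
      (use e1 i XY in \<open>simp add: diag_dirs_def iter_pd_def X_def\<close>)
  show "((\<lambda>s. pd (0, i) (pd (0, i) k) (x + s *\<^sub>R i, Y)) has_real_derivative
      pd (i, 0) (pd (0, i) (pd (0, i) k)) (X, Y)) (at u)"
    unfolding X_def by (rule DERIV_first)
      (use e2 i XY in \<open>simp add: diag_dirs_def iter_pd_def X_def\<close>)
  show "((\<lambda>s. pd (i, 0) (pd (0, i) (pd (0, i) k)) (x + s *\<^sub>R i, Y)) has_real_derivative K2 i (X, Y)) (at u)"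
    unfolding X_def K2_eq by (rule DERIV_first)
      (use e2 i XY in \<open>simp add: diag_dirs_def iter_pd_def X_def\<close>)
qed

definition diff1 :: "'a \<Rightarrow> 'a \<Rightarrow> real \<Rightarrow> 'h" where
  "diff1 i x s = (1 / s) *\<^sub>R (kf (x + s *\<^sub>R i) - kf x)"

text \<open>A symmetric second difference involves values of \<open>kf\<close> only, so its limit
  can be found before anything is known about the derivative of \<open>dk\<close>.\<close>

definition diff2 :: "'a \<Rightarrow> 'a \<Rightarrow> real \<Rightarrow> 'h" where
  "diff2 i x s = (1 / s\<^sup>2) *\<^sub>R (kf (x + s *\<^sub>R i) - 2 *\<^sub>R kf x + kf (x + (- s) *\<^sub>R i))"

text \<open>The inner product is a mixed second difference of \<open>k\<close>; mean values are
  taken first in the second argument, then in the first.\<close>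

lemma diff1_inner:
  assumes i: "i \<in> Basis" and st: "s \<noteq> 0" "t \<noteq> 0"
    and in\<Omega>: "\<And>u. \<bar>u\<bar> \<le> \<bar>s\<bar> \<Longrightarrow> x + u *\<^sub>R i \<in> \<Omega>" "\<And>u. \<bar>u\<bar> \<le> \<bar>t\<bar> \<Longrightarrow> y + u *\<^sub>R i \<in> \<Omega>"
  shows "\<exists>\<sigma> \<tau>. \<bar>\<sigma>\<bar> \<le> \<bar>s\<bar> \<and> \<bar>\<tau>\<bar> \<le> \<bar>t\<bar> \<and> diff1 i x s \<bullet> diff1 i y t = K1 i (x + \<sigma> *\<^sub>R i, y + \<tau> *\<^sub>R i)"
proof -
  have xy: "x \<in> \<Omega>" "y \<in> \<Omega>" "x + s *\<^sub>R i \<in> \<Omega>" "y + t *\<^sub>R i \<in> \<Omega>"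
    using in\<Omega>(1)[of 0] in\<Omega>(2)[of 0] in\<Omega>(1)[of s] in\<Omega>(2)[of t] by auto
  have "\<exists>\<tau>. \<bar>\<tau>\<bar> \<le> \<bar>t\<bar> \<and> (k (x + s *\<^sub>R i, y + t *\<^sub>R i) - k (x, y + t *\<^sub>R i))
      - (k (x + s *\<^sub>R i, y + 0 *\<^sub>R i) - k (x, y + 0 *\<^sub>R i))
    = t * (pd (0, i) k (x + s *\<^sub>R i, y + \<tau> *\<^sub>R i) - pd (0, i) k (x, y + \<tau> *\<^sub>R i))"
  proof (rule mvt_symmetric[where F = "\<lambda>t. k (x + s *\<^sub>R i, y + t *\<^sub>R i) - k (x, y + t *\<^sub>R i)"])
    fix u :: real assume "\<bar>u\<bar> \<le> \<bar>t\<bar>"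
    then show "((\<lambda>t. k (x + s *\<^sub>R i, y + t *\<^sub>R i) - k (x, y + t *\<^sub>R i)) has_real_derivative
        pd (0, i) k (x + s *\<^sub>R i, y + u *\<^sub>R i) - pd (0, i) k (x, y + u *\<^sub>R i)) (at u)"
      using mixed_diffs(1)[OF i, of x 0 y u] mixed_diffs(1)[OF i, of x s y u] in\<Omega>(2) xy
      by (intro DERIV_diff) simp_all
  qed
  then obtain \<tau> where \<tau>: "\<bar>\<tau>\<bar> \<le> \<bar>t\<bar>" "(k (x + s *\<^sub>R i, y + t *\<^sub>R i) - k (x, y + t *\<^sub>R i))
      - (k (x + s *\<^sub>R i, y) - k (x, y))
    = t * (pd (0, i) k (x + s *\<^sub>R i, y + \<tau> *\<^sub>R i) - pd (0, i) k (x, y + \<tau> *\<^sub>R i))" by auto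
  have "\<exists>\<sigma>. \<bar>\<sigma>\<bar> \<le> \<bar>s\<bar> \<and> pd (0, i) k (x + s *\<^sub>R i, y + \<tau> *\<^sub>R i) - pd (0, i) k (x + 0 *\<^sub>R i, y + \<tau> *\<^sub>R i)
      = s * K1 i (x + \<sigma> *\<^sub>R i, y + \<tau> *\<^sub>R i)"
    by (rule mvt_symmetric[where F = "\<lambda>s. pd (0, i) k (x + s *\<^sub>R i, y + \<tau> *\<^sub>R i)"], rule mixed_diffs(3)[OF i])
      (use in\<Omega> \<tau>(1) in auto)
  then obtain \<sigma> where \<sigma>: "\<bar>\<sigma>\<bar> \<le> \<bar>s\<bar>" "pd (0, i) k (x + s *\<^sub>R i, y + \<tau> *\<^sub>R i) - pd (0, i) k (x, y + \<tau> *\<^sub>R i)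
      = s * K1 i (x + \<sigma> *\<^sub>R i, y + \<tau> *\<^sub>R i)" by auto
  have "diff1 i x s \<bullet> diff1 i y t = (1 / (s * t)) * ((k (x + s *\<^sub>R i, y + t *\<^sub>R i) - k (x, y + t *\<^sub>R i))
      - (k (x + s *\<^sub>R i, y) - k (x, y)))"
    using xy by (simp add: diff1_def k_inner inner_diff_left inner_diff_right diff_divide_distrib)
  also have "\<dots> = K1 i (x + \<sigma> *\<^sub>R i, y + \<tau> *\<^sub>R i)" using \<tau> \<sigma> st by simp
  finally show ?thesis using \<sigma>(1) \<tau>(1) by blast
qed

lemma diff2_inner:
  assumes i: "i \<in> Basis" and st: "0 < s" "0 < t"
    and in\<Omega>: "\<And>u. \<bar>u\<bar> \<le> s \<Longrightarrow> x + u *\<^sub>R i \<in> \<Omega>" "\<And>u. \<bar>u\<bar> \<le> t \<Longrightarrow> y + u *\<^sub>R i \<in> \<Omega>"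
  shows "\<exists>\<sigma> \<tau>. \<bar>\<sigma>\<bar> \<le> s \<and> \<bar>\<tau>\<bar> \<le> t \<and> diff2 i x s \<bullet> diff2 i y t = K2 i (x + \<sigma> *\<^sub>R i, y + \<tau> *\<^sub>R i)"
proof -
  \<comment> \<open>\<open>sd\<close> is the second difference in the first argument. It commutes
    with differentiation in the second argument, where the mean value theorem is applied
    first.\<close>
  define sd :: "('a \<Rightarrow> real) \<Rightarrow> real"
    where "sd = (\<lambda>F. F (x + s *\<^sub>R i) - 2 * F x + F (x + (- s) *\<^sub>R i))"
  have xy: "x \<in> \<Omega>" "y \<in> \<Omega>" "x + s *\<^sub>R i \<in> \<Omega>" "y + t *\<^sub>R i \<in> \<Omega>" "x + (- s) *\<^sub>R i \<in> \<Omega>" "y + (- t) *\<^sub>R i \<in> \<Omega>"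
  proof -
    have a: "\<bar>0\<bar> \<le> s" "\<bar>s\<bar> \<le> s" "\<bar>- s\<bar> \<le> s" "\<bar>0\<bar> \<le> t" "\<bar>t\<bar> \<le> t" "\<bar>- t\<bar> \<le> t" using st by auto
    show "x \<in> \<Omega>" "y \<in> \<Omega>" using in\<Omega>(1)[OF a(1)] in\<Omega>(2)[OF a(4)] by simp_all
    show "x + s *\<^sub>R i \<in> \<Omega>" "y + t *\<^sub>R i \<in> \<Omega>" "x + (- s) *\<^sub>R i \<in> \<Omega>" "y + (- t) *\<^sub>R i \<in> \<Omega>"
      by (rule in\<Omega>(1)[OF a(2)] in\<Omega>(2)[OF a(5)] in\<Omega>(1)[OF a(3)] in\<Omega>(2)[OF a(6)])+
  qed
  have "\<exists>\<tau>. \<bar>\<tau>\<bar> \<le> t \<and> sd (\<lambda>z. k (z, y + t *\<^sub>R i)) - 2 * sd (\<lambda>z. k (z, y + 0 *\<^sub>R i)) + sd (\<lambda>z. k (z, y + (- t) *\<^sub>R i))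
    = t\<^sup>2 * sd (\<lambda>z. pd (0, i) (pd (0, i) k) (z, y + \<tau> *\<^sub>R i))"
  proof (rule second_difference_mvt[where F = "\<lambda>u. sd (\<lambda>z. k (z, y + u *\<^sub>R i))"
        and ?F1.0 = "\<lambda>u. sd (\<lambda>z. pd (0, i) k (z, y + u *\<^sub>R i))", OF st(2)])
    fix u assume u: "\<bar>u\<bar> \<le> t"
    show "((\<lambda>u. sd (\<lambda>z. k (z, y + u *\<^sub>R i))) has_real_derivative sd (\<lambda>z. pd (0, i) k (z, y + u *\<^sub>R i))) (at u)"
      unfolding sd_def
      using mixed_diffs(1)[OF i, of x 0 y u] mixed_diffs(1)[OF i xy(3), of y u] mixed_diffs(1)[OF i xy(5), of y u]
        in\<Omega>(2)[OF u] xy(1)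
      by (intro DERIV_diff DERIV_add DERIV_cmult) simp_all
    show "((\<lambda>u. sd (\<lambda>z. pd (0, i) k (z, y + u *\<^sub>R i))) has_real_derivative
        sd (\<lambda>z. pd (0, i) (pd (0, i) k) (z, y + u *\<^sub>R i))) (at u)"
      unfolding sd_def
      using mixed_diffs(2)[OF i, of x 0 y u] mixed_diffs(2)[OF i xy(3), of y u] mixed_diffs(2)[OF i xy(5), of y u]
        in\<Omega>(2)[OF u] xy(1)
      by (intro DERIV_diff DERIV_add DERIV_cmult) simp_all
  qed
  then obtain \<tau> where \<tau>: "\<bar>\<tau>\<bar> \<le> t" "sd (\<lambda>z. k (z, y + t *\<^sub>R i)) - 2 * sd (\<lambda>z. k (z, y)) + sd (\<lambda>z. k (z, y + (- t) *\<^sub>R i))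
    = t\<^sup>2 * sd (\<lambda>z. pd (0, i) (pd (0, i) k) (z, y + \<tau> *\<^sub>R i))" by auto
  have "\<exists>\<sigma>. \<bar>\<sigma>\<bar> \<le> s \<and> pd (0, i) (pd (0, i) k) (x + s *\<^sub>R i, y + \<tau> *\<^sub>R i)
      - 2 * pd (0, i) (pd (0, i) k) (x + 0 *\<^sub>R i, y + \<tau> *\<^sub>R i) + pd (0, i) (pd (0, i) k) (x + (- s) *\<^sub>R i, y + \<tau> *\<^sub>R i)
      = s\<^sup>2 * K2 i (x + \<sigma> *\<^sub>R i, y + \<tau> *\<^sub>R i)"
  proof (rule second_difference_mvt[where F = "\<lambda>s. pd (0, i) (pd (0, i) k) (x + s *\<^sub>R i, y + \<tau> *\<^sub>R i)", OF st(1)])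
    fix u assume "\<bar>u\<bar> \<le> s"
    then have u: "x + u *\<^sub>R i \<in> \<Omega>" "y + \<tau> *\<^sub>R i \<in> \<Omega>" using in\<Omega> \<tau>(1) by auto
    show "((\<lambda>s. pd (0, i) (pd (0, i) k) (x + s *\<^sub>R i, y + \<tau> *\<^sub>R i)) has_real_derivative
      pd (i, 0) (pd (0, i) (pd (0, i) k)) (x + u *\<^sub>R i, y + \<tau> *\<^sub>R i)) (at u)"
      by (rule mixed_diffs(4)[OF i u])
    show "((\<lambda>s. pd (i, 0) (pd (0, i) (pd (0, i) k)) (x + s *\<^sub>R i, y + \<tau> *\<^sub>R i)) has_real_derivative
      K2 i (x + u *\<^sub>R i, y + \<tau> *\<^sub>R i)) (at u)"
      by (rule mixed_diffs(5)[OF i u])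
  qed
  then obtain \<sigma> where \<sigma>: "\<bar>\<sigma>\<bar> \<le> s" "sd (\<lambda>z. pd (0, i) (pd (0, i) k) (z, y + \<tau> *\<^sub>R i))
      = s\<^sup>2 * K2 i (x + \<sigma> *\<^sub>R i, y + \<tau> *\<^sub>R i)" unfolding sd_def by auto
  have "diff2 i x s \<bullet> diff2 i y t = (1 / (s\<^sup>2 * t\<^sup>2)) *
     (sd (\<lambda>z. k (z, y + t *\<^sub>R i)) - 2 * sd (\<lambda>z. k (z, y)) + sd (\<lambda>z. k (z, y + (- t) *\<^sub>R i)))"
    using xy unfolding sd_def diff2_def
    by (simp add: k_inner inner_diff_left inner_diff_right inner_add_left inner_add_right
        diff_divide_distrib add_divide_distrib)
  also have "\<dots> = K2 i (x + \<sigma> *\<^sub>R i, y + \<tau> *\<^sub>R i)" using \<tau> \<sigma> st by simp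
  finally show ?thesis using \<sigma>(1) \<tau>(1) by blast
qed

text \<open>The two step sizes vary independently, which is what \<open>hilbert_convergent\<close>
  asks for.\<close>

lemma diff1_inner_near:
  assumes i: "i \<in> Basis" and xy: "x \<in> \<Omega>" "y \<in> \<Omega>" and e: "0 < e"
  shows "\<exists>d>0. \<forall>s t. s \<noteq> 0 \<longrightarrow> \<bar>s\<bar> < d \<longrightarrow> t \<noteq> 0 \<longrightarrow> \<bar>t\<bar> < d \<longrightarrow> \<bar>diff1 i x s \<bullet> diff1 i y t - K1 i (x, y)\<bar> < e"
proof -
  have ni: "norm i = 1" using i by simp
  obtain d where d: "0 < d" and D: "\<And>s t. \<bar>s\<bar> < d \<Longrightarrow> \<bar>t\<bar> < d \<Longrightarrow> x + s *\<^sub>R i \<in> \<Omega> \<and> y + t *\<^sub>R i \<in> \<Omega> \<and>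
    \<bar>K1 i (x + s *\<^sub>R i, y + t *\<^sub>R i) - K1 i (x, y)\<bar> < e"
    using continuous_at_product_box[OF open_\<Omega> k_continuous[of "[i]"] xy ni e] i by auto
  have "\<bar>diff1 i x s \<bullet> diff1 i y t - K1 i (x, y)\<bar> < e" if st: "s \<noteq> 0" "\<bar>s\<bar> < d" "t \<noteq> 0" "\<bar>t\<bar> < d" for s t
  proof -
    have "\<exists>\<sigma> \<tau>. \<bar>\<sigma>\<bar> \<le> \<bar>s\<bar> \<and> \<bar>\<tau>\<bar> \<le> \<bar>t\<bar> \<and> diff1 i x s \<bullet> diff1 i y t = K1 i (x + \<sigma> *\<^sub>R i, y + \<tau> *\<^sub>R i)"
    proof (rule diff1_inner[OF i])
      show "x + u *\<^sub>R i \<in> \<Omega>" if "\<bar>u\<bar> \<le> \<bar>s\<bar>" for u using D[of u 0] st that d by simp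
      show "y + u *\<^sub>R i \<in> \<Omega>" if "\<bar>u\<bar> \<le> \<bar>t\<bar>" for u using D[of 0 u] st that d by simp
    qed (use st in auto)
    then show ?thesis using D st by fastforce
  qed
  then show ?thesis using d by blast
qed

lemma diff2_inner_near:
  assumes i: "i \<in> Basis" and xy: "x \<in> \<Omega>" "y \<in> \<Omega>" and e: "0 < e"
  shows "\<exists>d>0. \<forall>s t. 0 < s \<longrightarrow> s < d \<longrightarrow> 0 < t \<longrightarrow> t < d \<longrightarrow> \<bar>diff2 i x s \<bullet> diff2 i y t - K2 i (x, y)\<bar> < e"
proof -
  have ni: "norm i = 1" using i by simp
  obtain d where d: "0 < d" and D: "\<And>s t. \<bar>s\<bar> < d \<Longrightarrow> \<bar>t\<bar> < d \<Longrightarrow> x + s *\<^sub>R i \<in> \<Omega> \<and> y + t *\<^sub>R i \<in> \<Omega> \<and>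
    \<bar>K2 i (x + s *\<^sub>R i, y + t *\<^sub>R i) - K2 i (x, y)\<bar> < e"
    using continuous_at_product_box[OF open_\<Omega> k_continuous[of "[i, i]"] xy ni e] i by auto
  have "\<bar>diff2 i x s \<bullet> diff2 i y t - K2 i (x, y)\<bar> < e" if st: "0 < s" "s < d" "0 < t" "t < d" for s t
  proof -
    have "\<exists>\<sigma> \<tau>. \<bar>\<sigma>\<bar> \<le> s \<and> \<bar>\<tau>\<bar> \<le> t \<and> diff2 i x s \<bullet> diff2 i y t = K2 i (x + \<sigma> *\<^sub>R i, y + \<tau> *\<^sub>R i)"
    proof (rule diff2_inner[OF i])
      show "x + u *\<^sub>R i \<in> \<Omega>" if "\<bar>u\<bar> \<le> s" for u using D[of u 0] st that d by simp
      show "y + u *\<^sub>R i \<in> \<Omega>" if "\<bar>u\<bar> \<le> t" for u using D[of 0 u] st that d by simp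
    qed (use st in auto)
    then show ?thesis using D st by fastforce
  qed
  then show ?thesis using d by blast
qed

text \<open>The limit exists by \<open>hilbert_convergent\<close>; tested against
  \<open>kf y\<close> it is the partial derivative of \<open>k\<close>, so it is the element that
  the definite description in \<open>dk\<close> denotes.\<close>

lemma diff1_tendsto:
  assumes i: "i \<in> Basis" and x: "x \<in> \<Omega>"
  shows "(diff1 i x \<longlongrightarrow> dk \<Omega> k evf i x) (at 0)"
proof -
  have "\<exists>L. (diff1 i x \<longlongrightarrow> L) (at 0)"
  proof (rule hilbert_convergent)
    fix e :: real assume "0 < e"
    then obtain d where "0 < d" "\<And>s t. s \<noteq> 0 \<Longrightarrow> \<bar>s\<bar> < d \<Longrightarrow> t \<noteq> 0 \<Longrightarrow> \<bar>t\<bar> < d \<Longrightarrow>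
        \<bar>diff1 i x s \<bullet> diff1 i x t - K1 i (x, x)\<bar> < e"
      using diff1_inner_near[OF i x x] by blast
    then show "\<exists>P. eventually P (at 0) \<and> (\<forall>s t. P s \<longrightarrow> P t \<longrightarrow> \<bar>diff1 i x s \<bullet> diff1 i x t - K1 i (x, x)\<bar> < e)"
      by (intro exI[of _ "\<lambda>s. s \<noteq> 0 \<and> \<bar>s\<bar> < d"]) (auto simp: eventually_at)
  qed simp
  then obtain L where L: "(diff1 i x \<longlongrightarrow> L) (at 0)" by blast
  have "pd (i, 0) k (x, y) = L \<bullet> kf y" if y: "y \<in> \<Omega>" for y
  proof -
    have "((\<lambda>s. diff1 i x s \<bullet> kf y) \<longlongrightarrow> L \<bullet> kf y) (at 0)" by (intro tendsto_intros L)
    moreover have "\<forall>\<^sub>F s in at 0. diff1 i x s \<bullet> kf y = (k ((x, y) + s *\<^sub>R (i, 0)) - k ((x, y) + 0 *\<^sub>R (i, 0))) / s"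
    proof -
      have "\<forall>\<^sub>F s in at (0::real). x + s *\<^sub>R i \<in> \<Omega>"
        using line_at[of x 0 i] x by simp
      then show ?thesis
        by (rule eventually_mono) (use x y in \<open>simp add: diff1_def k_inner inner_diff_left\<close>)
    qed
    ultimately have "((\<lambda>s. (k ((x, y) + s *\<^sub>R (i, 0)) - k ((x, y) + 0 *\<^sub>R (i, 0))) / s) \<longlongrightarrow> L \<bullet> kf y) (at 0)"
      by (simp add: tendsto_cong)
    then have "((\<lambda>s. k ((x, y) + s *\<^sub>R (i, 0))) has_real_derivative L \<bullet> kf y) (at 0)"
      unfolding has_field_derivative_iff by simp
    then show ?thesis unfolding pd_def by (rule DERIV_imp_deriv)
  qed
  then have "dk \<Omega> k evf i x = L" unfolding dk_def by (intro elem_of_eq) simp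
  then show ?thesis using L by simp
qed

text \<open>By the reproducing property the difference quotient of the function is an inner product
  with \<open>diff1\<close>.\<close>

lemma evf_DERIV:
  assumes i: "i \<in> Basis" and x: "x + u *\<^sub>R i \<in> \<Omega>"
  shows "((\<lambda>s. evf f (x + s *\<^sub>R i)) has_real_derivative f \<bullet> dk \<Omega> k evf i (x + u *\<^sub>R i)) (at u)"
proof (rule DERIV_line_shift)
  let ?x = "x + u *\<^sub>R i"
  have "((\<lambda>s. f \<bullet> diff1 i ?x s) \<longlongrightarrow> f \<bullet> dk \<Omega> k evf i ?x) (at 0)"
    by (intro tendsto_intros diff1_tendsto i x)
  moreover have "\<forall>\<^sub>F s in at 0. f \<bullet> diff1 i ?x s = (evf f (?x + s *\<^sub>R i) - evf f ?x) / s"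
  proof -
    have "\<forall>\<^sub>F s in at (0::real). ?x + s *\<^sub>R i \<in> \<Omega>"
      using line_at[of ?x 0 i] x by simp
    then show ?thesis
      by (rule eventually_mono) (use x in \<open>simp add: diff1_def evf_inner inner_diff_right\<close>)
  qed
  ultimately have "((\<lambda>s. (evf f (?x + s *\<^sub>R i) - evf f ?x) / s) \<longlongrightarrow> f \<bullet> dk \<Omega> k evf i ?x) (at 0)"
    by (simp add: tendsto_cong)
  then show "((\<lambda>s. evf f (?x + s *\<^sub>R i)) has_real_derivative f \<bullet> dk \<Omega> k evf i ?x) (at 0)"
    unfolding has_field_derivative_iff by simp
qed

lemma dk_inner:
  assumes i: "i \<in> Basis" and xy: "x \<in> \<Omega>" "y \<in> \<Omega>"
  shows "dk \<Omega> k evf i x \<bullet> dk \<Omega> k evf i y = K1 i (x, y)"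
proof (rule LIM_unique)
  show "((\<lambda>s. diff1 i x s \<bullet> diff1 i y s) \<longlongrightarrow> dk \<Omega> k evf i x \<bullet> dk \<Omega> k evf i y) (at 0)"
    by (intro tendsto_intros diff1_tendsto assms)
  show "((\<lambda>s. diff1 i x s \<bullet> diff1 i y s) \<longlongrightarrow> K1 i (x, y)) (at 0)"
  proof (rule tendstoI)
    fix e :: real assume "0 < e"
    then obtain d where "0 < d" "\<And>s t. s \<noteq> 0 \<Longrightarrow> \<bar>s\<bar> < d \<Longrightarrow> t \<noteq> 0 \<Longrightarrow> \<bar>t\<bar> < d \<Longrightarrow>
        \<bar>diff1 i x s \<bullet> diff1 i y t - K1 i (x, y)\<bar> < e"
      using diff1_inner_near[OF i xy] by blast
    then show "\<forall>\<^sub>F s in at 0. dist (diff1 i x s \<bullet> diff1 i y s) (K1 i (x, y)) < e"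
      by (auto simp: eventually_at dist_real_def)
  qed
qed

lemma dk_continuous: "i \<in> Basis \<Longrightarrow> continuous_on \<Omega> (dk \<Omega> k evf i)"
  using k_continuous[of "[i]"] by (intro continuous_on_hilbert_kernel[where K = "K1 i"]) (auto simp: dk_inner)

lemma norm_dk: "i \<in> Basis \<Longrightarrow> x \<in> \<Omega> \<Longrightarrow> norm (dk \<Omega> k evf i x) = sqrt (K1 i (x, x))"
  by (simp add: dk_inner[symmetric] norm_eq_sqrt_inner)

lemma dk_kf_DERIV:
  assumes i: "i \<in> Basis" and xy: "x \<in> \<Omega>" "y \<in> \<Omega>"
  shows "((\<lambda>s. dk \<Omega> k evf i (x + s *\<^sub>R i) \<bullet> kf y) has_real_derivative pd (0, i) (pd (0, i) k) (y, x)) (at 0)"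
proof -
  have "\<forall>\<^sub>F s in nhds (0::real). x + s *\<^sub>R i \<in> \<Omega>"
    using line_nhds[of x 0 i] xy by simp
  then have ev: "\<forall>\<^sub>F s in nhds 0. dk \<Omega> k evf i (x + s *\<^sub>R i) \<bullet> kf y = pd (0, i) k (y, x + s *\<^sub>R i)"
  proof (rule eventually_mono)
    fix s :: real assume s: "x + s *\<^sub>R i \<in> \<Omega>"
    have "((\<lambda>t. k (y, x + t *\<^sub>R i)) has_real_derivative pd (0, i) k (y, x + s *\<^sub>R i)) (at s)"
      using mixed_diffs(1)[OF i, of y 0 x s] s xy by simp
    moreover have "((\<lambda>t. k (y, x + t *\<^sub>R i)) has_real_derivative kf y \<bullet> dk \<Omega> k evf i (x + s *\<^sub>R i)) (at s)"
    proof (subst DERIV_cong_ev[OF refl _ refl])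
      have "\<forall>\<^sub>F t in nhds s. x + t *\<^sub>R i \<in> \<Omega>"
        using line_nhds[of x s i] s by simp
      then show "\<forall>\<^sub>F t in nhds s. k (y, x + t *\<^sub>R i) = evf (kf y) (x + t *\<^sub>R i)"
        by (rule eventually_mono) (use xy in \<open>simp add: evf_kf\<close>)
      show "((\<lambda>t. evf (kf y) (x + t *\<^sub>R i)) has_real_derivative kf y \<bullet> dk \<Omega> k evf i (x + s *\<^sub>R i)) (at s)"
        by (rule evf_DERIV[OF i s])
    qed
    ultimately show "dk \<Omega> k evf i (x + s *\<^sub>R i) \<bullet> kf y = pd (0, i) k (y, x + s *\<^sub>R i)"
      using DERIV_unique by (metis inner_commute)
  qed
  show ?thesis
    by (subst DERIV_cong_ev[OF refl ev refl]) (use mixed_diffs(2)[OF i, of y 0 x 0] xy in simp)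
qed

text \<open>Two derivatives in the first argument are obtained from two in the second, the ones the
  assumptions provide, by symmetry of the kernel.\<close>

lemma ddk_kf:
  assumes i: "i \<in> Basis" and xy: "x \<in> \<Omega>" "y \<in> \<Omega>"
  shows "pd (i, 0) (pd (i, 0) k) (x, y) = pd (0, i) (pd (0, i) k) (y, x)"
proof -
  have "\<forall>\<^sub>F s in nhds (0::real). x + s *\<^sub>R i \<in> \<Omega>"
    using line_nhds[of x 0 i] xy by simp
  then have ev: "\<forall>\<^sub>F s in nhds 0. pd (i, 0) k ((x, y) + s *\<^sub>R (i, 0)) = dk \<Omega> k evf i (x + s *\<^sub>R i) \<bullet> kf y"
  proof (rule eventually_mono)
    fix s :: real assume s: "x + s *\<^sub>R i \<in> \<Omega>"
    have "((\<lambda>t. k ((x + s *\<^sub>R i, y) + t *\<^sub>R (i, 0))) has_real_derivative kf y \<bullet> dk \<Omega> k evf i (x + s *\<^sub>R i)) (at 0)"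
    proof (subst DERIV_cong_ev[OF refl _ refl])
      have "\<forall>\<^sub>F t in nhds (0::real). x + s *\<^sub>R i + t *\<^sub>R i \<in> \<Omega>"
        using line_nhds[of "x + s *\<^sub>R i" 0 i] s by simp
      then show "\<forall>\<^sub>F t in nhds 0. k ((x + s *\<^sub>R i, y) + t *\<^sub>R (i, 0)) = evf (kf y) (x + s *\<^sub>R i + t *\<^sub>R i)"
        by (rule eventually_mono) (use xy in \<open>simp add: evf_kf k_sym\<close>)
      show "((\<lambda>t. evf (kf y) (x + s *\<^sub>R i + t *\<^sub>R i)) has_real_derivative kf y \<bullet> dk \<Omega> k evf i (x + s *\<^sub>R i)) (at 0)"
        using evf_DERIV[OF i, of "x + s *\<^sub>R i" 0] s by simp
    qed
    then show "pd (i, 0) k ((x, y) + s *\<^sub>R (i, 0)) = dk \<Omega> k evf i (x + s *\<^sub>R i) \<bullet> kf y"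
      unfolding pd_def using DERIV_imp_deriv by (fastforce simp: inner_commute)
  qed
  have "((\<lambda>s. pd (i, 0) k ((x, y) + s *\<^sub>R (i, 0))) has_real_derivative pd (0, i) (pd (0, i) k) (y, x)) (at 0)"
    by (subst DERIV_cong_ev[OF refl ev refl]) (rule dk_kf_DERIV[OF assms])
  then show ?thesis unfolding pd_def[of "(i, 0)" "pd (i, 0) k"] by (rule DERIV_imp_deriv)
qed

lemma diff2_kf_tendsto:
  assumes i: "i \<in> Basis" and xy: "x \<in> \<Omega>" "y \<in> \<Omega>"
  shows "((\<lambda>s. diff2 i x s \<bullet> kf y) \<longlongrightarrow> pd (0, i) (pd (0, i) k) (y, x)) (at_right 0)"
proof -
  obtain r where r: "0 < r" "\<And>s. \<bar>s\<bar> < r \<Longrightarrow> x + s *\<^sub>R i \<in> \<Omega>"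
    using continuous_at_product_box[OF open_\<Omega> k_continuous[of "[i]"] xy(1) xy(1), of i 1] i by auto
  let ?F = "\<lambda>s. (evf (kf y) (x + s *\<^sub>R i) - 2 * evf (kf y) (x + 0 *\<^sub>R i) + evf (kf y) (x + (- s) *\<^sub>R i)) / s\<^sup>2"
  have "(?F \<longlongrightarrow> pd (0, i) (pd (0, i) k) (y, x)) (at_right 0)"
  proof (rule second_difference_limit[OF r(1)])
    show "((\<lambda>s. evf (kf y) (x + s *\<^sub>R i)) has_real_derivative dk \<Omega> k evf i (x + u *\<^sub>R i) \<bullet> kf y) (at u)"
      if "\<bar>u\<bar> < r" for u
      using evf_DERIV[OF i r(2)[OF that], of "kf y"] by (simp add: inner_commute)
  qed (rule dk_kf_DERIV[OF i xy])
  then show ?thesis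
  proof (rule Lim_transform_eventually)
    show "\<forall>\<^sub>F s in at_right 0. ?F s = diff2 i x s \<bullet> kf y"
    proof (rule eventually_at_rightI[OF _ r(1)])
      fix s :: real assume "s \<in> {0<..<r}"
      then have "x + s *\<^sub>R i \<in> \<Omega>" "x + (- s) *\<^sub>R i \<in> \<Omega>" by (auto intro!: r(2) simp del: scaleR_minus_left)
      then show "?F s = diff2 i x s \<bullet> kf y"
        using xy by (simp add: diff2_def evf_inner inner_diff_right inner_add_right inner_commute[of _ "kf y"])
    qed
  qed
qed

lemma diff2_tendsto:
  assumes i: "i \<in> Basis" and x: "x \<in> \<Omega>"
  shows "(diff2 i x \<longlongrightarrow> ddk \<Omega> k evf i x) (at_right 0)"
proof -
  have "\<exists>L. (diff2 i x \<longlongrightarrow> L) (at_right 0)"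
  proof (rule hilbert_convergent)
    fix e :: real assume "0 < e"
    then obtain d where "0 < d" "\<And>s t. 0 < s \<Longrightarrow> s < d \<Longrightarrow> 0 < t \<Longrightarrow> t < d \<Longrightarrow>
        \<bar>diff2 i x s \<bullet> diff2 i x t - K2 i (x, x)\<bar> < e"
      using diff2_inner_near[OF i x x] by blast
    then show "\<exists>P. eventually P (at_right 0) \<and> (\<forall>s t. P s \<longrightarrow> P t \<longrightarrow> \<bar>diff2 i x s \<bullet> diff2 i x t - K2 i (x, x)\<bar> < e)"
      by (intro exI[of _ "\<lambda>s. 0 < s \<and> s < d"]) (auto simp: eventually_at_right_field)
  qed simp
  then obtain L where L: "(diff2 i x \<longlongrightarrow> L) (at_right 0)" by blast
  have "L \<bullet> kf y = pd (i, 0) (pd (i, 0) k) (x, y)" if y: "y \<in> \<Omega>" for y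
    unfolding ddk_kf[OF i x y]
    by (rule tendsto_unique[OF trivial_limit_at_right_real _ diff2_kf_tendsto[OF i x y]]) (intro tendsto_intros L)
  then have "ddk \<Omega> k evf i x = L" unfolding ddk_def by (rule elem_of_eq)
  then show ?thesis using L by simp
qed

lemma ddk_inner_kf:
  assumes i: "i \<in> Basis" and xy: "x \<in> \<Omega>" "y \<in> \<Omega>"
  shows "ddk \<Omega> k evf i x \<bullet> kf y = pd (0, i) (pd (0, i) k) (y, x)"
  by (rule tendsto_unique[OF trivial_limit_at_right_real _ diff2_kf_tendsto[OF assms]])
    (intro tendsto_intros diff2_tendsto assms)

lemma ddk_inner:
  assumes i: "i \<in> Basis" and xy: "x \<in> \<Omega>" "y \<in> \<Omega>"
  shows "ddk \<Omega> k evf i x \<bullet> ddk \<Omega> k evf i y = K2 i (x, y)"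
proof (rule tendsto_unique[OF trivial_limit_at_right_real])
  show "((\<lambda>s. diff2 i x s \<bullet> diff2 i y s) \<longlongrightarrow> ddk \<Omega> k evf i x \<bullet> ddk \<Omega> k evf i y) (at_right 0)"
    by (intro tendsto_intros diff2_tendsto assms)
  show "((\<lambda>s. diff2 i x s \<bullet> diff2 i y s) \<longlongrightarrow> K2 i (x, y)) (at_right 0)"
  proof (rule tendstoI)
    fix e :: real assume "0 < e"
    then obtain d where "0 < d" "\<And>s t. 0 < s \<Longrightarrow> s < d \<Longrightarrow> 0 < t \<Longrightarrow> t < d \<Longrightarrow>
        \<bar>diff2 i x s \<bullet> diff2 i y t - K2 i (x, y)\<bar> < e"
      using diff2_inner_near[OF i xy] by blast
    then show "\<forall>\<^sub>F s in at_right 0. dist (diff2 i x s \<bullet> diff2 i y s) (K2 i (x, y)) < e"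
      by (auto simp: eventually_at_right_field dist_real_def)
  qed
qed

lemma ddk_continuous: "i \<in> Basis \<Longrightarrow> continuous_on \<Omega> (ddk \<Omega> k evf i)"
  using k_continuous[of "[i, i]"] by (intro continuous_on_hilbert_kernel[where K = "K2 i"]) (auto simp: ddk_inner)

lemma norm_ddk: "i \<in> Basis \<Longrightarrow> x \<in> \<Omega> \<Longrightarrow> norm (ddk \<Omega> k evf i x) = sqrt (K2 i (x, x))"
  by (simp add: ddk_inner[symmetric] norm_eq_sqrt_inner)

text \<open>Tested against \<^term>\<open>kf y\<close>, \<^term>\<open>dk \<Omega> k evf i\<close> is an integral of \<^term>\<open>ddk \<Omega> k evf i\<close> along
  lines; these functionals separate points, so the identity holds in the Hilbert space, where
  the continuity of the integrand gives the derivative.\<close>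

lemma dk_has_vector_derivative:
  assumes i: "i \<in> Basis" and x: "x \<in> \<Omega>"
  shows "((\<lambda>s. dk \<Omega> k evf i (x + s *\<^sub>R i)) has_vector_derivative ddk \<Omega> k evf i x) (at 0)"
proof -
  obtain r where r: "0 < r" "\<And>s. \<bar>s\<bar> < r \<Longrightarrow> x + s *\<^sub>R i \<in> \<Omega>"
    using continuous_at_product_box[OF open_\<Omega> k_continuous[of "[i]"] x x, of i 1] i by auto
  define a where "a = - (r / 2)"
  define b where "b = r / 2"
  have ab: "a < 0" "0 < b" using r by (auto simp: a_def b_def)
  have in\<Omega>: "x + s *\<^sub>R i \<in> \<Omega>" if "s \<in> {a..b}" for s
    using that r(1) by (intro r(2)) (auto simp: a_def b_def)
  have cont: "continuous_on {a..b} (\<lambda>s. ddk \<Omega> k evf i (x + s *\<^sub>R i))"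
    by (rule continuous_on_compose2[OF ddk_continuous[OF i]]) (use in\<Omega> in \<open>auto intro!: continuous_intros\<close>)
  define I where "I s = integral {a..s} (\<lambda>s. ddk \<Omega> k evf i (x + s *\<^sub>R i))" for s
  have eq: "dk \<Omega> k evf i (x + s *\<^sub>R i) = dk \<Omega> k evf i (x + a *\<^sub>R i) + I s" if s: "s \<in> {a..b}" for s
  proof (rule eq_by_kf)
    fix y assume y: "y \<in> \<Omega>"
    have int: "(\<lambda>s. ddk \<Omega> k evf i (x + s *\<^sub>R i)) integrable_on {a..s}"
      by (rule integrable_continuous_real) (rule continuous_on_subset[OF cont], use s in auto)
    have "((\<lambda>s. ddk \<Omega> k evf i (x + s *\<^sub>R i) \<bullet> kf y) has_integral
        dk \<Omega> k evf i (x + s *\<^sub>R i) \<bullet> kf y - dk \<Omega> k evf i (x + a *\<^sub>R i) \<bullet> kf y) {a..s}"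
    proof (rule fundamental_theorem_of_calculus)
      fix u assume u: "u \<in> {a..s}"
      then have u': "x + u *\<^sub>R i \<in> \<Omega>" using in\<Omega> s by auto
      have "((\<lambda>s. dk \<Omega> k evf i ((x + u *\<^sub>R i) + s *\<^sub>R i) \<bullet> kf y) has_real_derivative
          ddk \<Omega> k evf i (x + u *\<^sub>R i) \<bullet> kf y) (at 0)"
        using dk_kf_DERIV[OF i u' y] ddk_inner_kf[OF i u' y] by simp
      then have "((\<lambda>s. dk \<Omega> k evf i (x + s *\<^sub>R i) \<bullet> kf y) has_real_derivative
          ddk \<Omega> k evf i (x + u *\<^sub>R i) \<bullet> kf y) (at u)"
        by (rule DERIV_line_shift[where f = "\<lambda>z. dk \<Omega> k evf i z \<bullet> kf y"])
      then show "((\<lambda>s. dk \<Omega> k evf i (x + s *\<^sub>R i) \<bullet> kf y) has_vector_derivative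
          ddk \<Omega> k evf i (x + u *\<^sub>R i) \<bullet> kf y) (at u within {a..s})"
        by (simp add: has_real_derivative_iff_has_vector_derivative has_vector_derivative_at_within)
    qed (use s in auto)
    moreover have "((\<lambda>s. ddk \<Omega> k evf i (x + s *\<^sub>R i) \<bullet> kf y) has_integral I s \<bullet> kf y) {a..s}"
      using has_integral_linear[OF integrable_integral[OF int] bounded_linear_inner_left[of "kf y"]]
      by (simp add: I_def o_def)
    ultimately show "dk \<Omega> k evf i (x + s *\<^sub>R i) \<bullet> kf y = (dk \<Omega> k evf i (x + a *\<^sub>R i) + I s) \<bullet> kf y"
      by (auto dest: has_integral_unique simp: inner_add_left)
  qed
  have "(I has_vector_derivative ddk \<Omega> k evf i (x + 0 *\<^sub>R i)) (at 0 within {a..b})"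
    unfolding I_def by (rule integral_has_vector_derivative[OF cont]) (use ab in auto)
  then have I: "(I has_vector_derivative ddk \<Omega> k evf i x) (at 0)"
    using at_within_interior[of 0 "{a..b}"] ab by simp
  have "((\<lambda>s. dk \<Omega> k evf i (x + a *\<^sub>R i) + I s) has_vector_derivative ddk \<Omega> k evf i x) (at 0)"
    using I by (auto intro!: derivative_eq_intros)
  then show ?thesis
  proof (rule has_vector_derivative_transform_within_open[where S = "{a<..<b}"])
    show "dk \<Omega> k evf i (x + a *\<^sub>R i) + I s = dk \<Omega> k evf i (x + s *\<^sub>R i)" if "s \<in> {a<..<b}" for s
      by (rule eq[symmetric]) (use that in auto)
  qed (use ab in auto)
qed

end

section \<open>Integration by parts on an arbitrary open set\<close>

text \<open>Isolating neighbourhoods can be taken from a countable base, and different points need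
  different ones.\<close>

lemma countable_isolated:
  fixes S :: "'a::second_countable_topology set"
  assumes iso: "\<And>x. x \<in> S \<Longrightarrow> \<exists>U. open U \<and> U \<inter> S = {x}"
  shows "countable S"
proof -
  obtain B :: "'a set set" where B: "countable B" "topological_basis B" using ex_countable_basis by blast
  have "\<exists>b\<in>B. b \<inter> S = {x}" if x: "x \<in> S" for x
  proof -
    obtain U where U: "open U" "U \<inter> S = {x}" using iso[OF x] by blast
    then obtain b where "b \<in> B" "x \<in> b" "b \<subseteq> U" using topological_basisE[OF B(2), of U x] by blast
    then show ?thesis using U x by blast
  qed
  then obtain f where f: "\<And>x. x \<in> S \<Longrightarrow> f x \<in> B \<and> f x \<inter> S = {x}" by metis
  have "inj_on f S" by (rule inj_onI) (metis f singleton_inject)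
  moreover have "countable (f ` S)" by (rule countable_subset[OF _ B(1)]) (use f in auto)
  ultimately show ?thesis by (rule countable_image_inj_on[rotated])
qed

text \<open>Squaring removes the kink of the positive part at 0.\<close>

definition pos_sq :: "real \<Rightarrow> real" where "pos_sq z = (max 0 z)\<^sup>2"

lemma DERIV_pos_sq: "(pos_sq has_real_derivative 2 * max 0 z) (at z)"
proof (cases z "0::real" rule: linorder_cases)
  case less
  then have "\<forall>\<^sub>F y in nhds z. y < 0" by (rule order_tendstoD[OF filterlim_ident])
  then have ev: "\<forall>\<^sub>F y in nhds z. pos_sq y = 0" by (rule eventually_mono) (simp add: pos_sq_def)
  show ?thesis by (subst DERIV_cong_ev[OF refl ev refl]) (use less in simp)
next
  case equal
  have "((\<lambda>y. max 0 y) \<longlongrightarrow> max 0 0) (at (0::real))" by (intro tendsto_intros)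
  then have "((\<lambda>y. max 0 y) \<longlongrightarrow> 0) (at (0::real))" by simp
  then have "((\<lambda>y. (pos_sq y - pos_sq 0) / (y - 0)) \<longlongrightarrow> 0) (at 0)"
    by (rule Lim_transform_eventually)
      (auto simp: eventually_at_filter pos_sq_def max_def power2_eq_square)
  then show ?thesis using equal by (simp add: has_field_derivative_iff)
next
  case greater
  then have "\<forall>\<^sub>F y in nhds z. 0 < y" by (rule order_tendstoD[OF filterlim_ident])
  then have ev: "\<forall>\<^sub>F y in nhds z. pos_sq y = y\<^sup>2" by (rule eventually_mono) (simp add: pos_sq_def)
  show ?thesis
    by (subst DERIV_cong_ev[OF refl ev refl]) (use greater in \<open>auto intro!: derivative_eq_intros\<close>)
qed

text \<open>\<open>soft e y = sgn y * (max 0 (\<bar>y\<bar> - e))\<^sup>2 / \<bar>y\<bar>\<close> is a continuously differentiable approximation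
  of the identity that vanishes near \<open>0\<close>.\<close>

definition soft :: "real \<Rightarrow> real \<Rightarrow> real" where
  "soft e y = (pos_sq (y - e) + pos_sq (- y - e)) / y"

text \<open>At y = 0 division by zero gives the value 0, in agreement with \<open>soft e\<close>
  being zero near 0 for positive e.\<close>

definition soft' :: "real \<Rightarrow> real \<Rightarrow> real" where
  "soft' e y = (2 * max 0 (y - e) - 2 * max 0 (- y - e)) / y - (pos_sq (y - e) + pos_sq (- y - e)) / y\<^sup>2"

lemma DERIV_soft: assumes "y \<noteq> 0" shows "(soft e has_real_derivative soft' e y) (at y)"
proof -
  have "((\<lambda>y. y - e) has_real_derivative 1) (at y)" "((\<lambda>y. - y - e) has_real_derivative - 1) (at y)"
    by (auto intro!: derivative_eq_intros)
  from DERIV_chain2[OF DERIV_pos_sq this(1)] DERIV_chain2[OF DERIV_pos_sq this(2)]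
  have "((\<lambda>y. pos_sq (y - e)) has_real_derivative 2 * max 0 (y - e) * 1) (at y)"
    "((\<lambda>y. pos_sq (- y - e)) has_real_derivative 2 * max 0 (- y - e) * (- 1)) (at y)"
    by simp_all
  then have "((\<lambda>y. (pos_sq (y - e) + pos_sq (- y - e)) / y) has_real_derivative
    ((2 * max 0 (y - e) * 1 + 2 * max 0 (- y - e) * (- 1)) * y - (pos_sq (y - e) + pos_sq (- y - e)) * 1) / (y * y)) (at y)"
    by (intro DERIV_divide DERIV_add DERIV_ident assms)
  then have "((\<lambda>y. (pos_sq (y - e) + pos_sq (- y - e)) / y) has_real_derivative soft' e y) (at y)"
    by (rule DERIV_cong) (use assms in \<open>simp add: soft'_def field_simps power2_eq_square\<close>)
  moreover have "soft e = (\<lambda>y. (pos_sq (y - e) + pos_sq (- y - e)) / y)" by (auto simp: soft_def)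
  ultimately show ?thesis by simp
qed

lemma soft_near_0: "\<bar>y\<bar> \<le> e \<Longrightarrow> soft e y = 0"
  by (auto simp: soft_def pos_sq_def)

text \<open>The two quotients contribute 2 and 1. Uniformity in e supplies the majorant for
  dominated convergence.\<close>

lemma soft'_bound: assumes "0 \<le> e" shows "\<bar>soft' e y\<bar> \<le> 3"
proof (cases "y = 0")
  case False
  have a: "\<bar>(2 * max 0 (y - e) - 2 * max 0 (- y - e)) / y\<bar> \<le> 2"
    using False assms by (auto simp: field_simps max_def abs_if)
  have "pos_sq (y - e) + pos_sq (- y - e) \<le> y\<^sup>2"
  proof (cases "0 < y")
    case True
    then have "pos_sq (y - e) \<le> y\<^sup>2" unfolding pos_sq_def using assms by (intro power_mono) auto
    then show ?thesis using True assms by (simp add: pos_sq_def)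
  next
    case False
    then have "pos_sq (- y - e) \<le> (- y)\<^sup>2" unfolding pos_sq_def using assms by (intro power_mono) auto
    then show ?thesis using False assms by (simp add: pos_sq_def)
  qed
  moreover have "0 \<le> pos_sq (y - e) + pos_sq (- y - e)" by (simp add: pos_sq_def)
  ultimately have "0 \<le> (pos_sq (y - e) + pos_sq (- y - e)) / y\<^sup>2" "(pos_sq (y - e) + pos_sq (- y - e)) / y\<^sup>2 \<le> 1"
    using False by simp_all
  with a show ?thesis unfolding soft'_def by linarith
qed (simp add: soft'_def)

lemma soft_limit: "((\<lambda>e. soft e y) \<longlongrightarrow> y) (nhds 0)"
proof -
  have "((\<lambda>e. soft e y) \<longlongrightarrow> ((max 0 (y - 0))\<^sup>2 + (max 0 (- y - 0))\<^sup>2) / y) (nhds 0)"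
    unfolding soft_def pos_sq_def divide_inverse by (intro tendsto_intros filterlim_ident)
  also have "((max 0 (y - 0))\<^sup>2 + (max 0 (- y - 0))\<^sup>2) / y = y"
    by (cases "0 \<le> y") (auto simp: max_def power2_eq_square)
  finally show ?thesis .
qed

text \<open>The value 0 instead of 1 at y = 0 is the reason why the limiting integrand can differ
  from the derivative at zeros of the function.\<close>

lemma soft'_limit: "((\<lambda>e. soft' e y) \<longlongrightarrow> (if y = 0 then 0 else 1)) (nhds 0)"
proof -
  have "((\<lambda>e. soft' e y) \<longlongrightarrow> (2 * max 0 (y - 0) - 2 * max 0 (- y - 0)) / y
      - ((max 0 (y - 0))\<^sup>2 + (max 0 (- y - 0))\<^sup>2) / y\<^sup>2) (nhds 0)"
    unfolding soft'_def pos_sq_def divide_inverse by (intro tendsto_intros filterlim_ident)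
  also have "(2 * max 0 (y - 0) - 2 * max 0 (- y - 0)) / y - ((max 0 (y - 0))\<^sup>2 + (max 0 (- y - 0))\<^sup>2) / y\<^sup>2
      = (if y = 0 then 0 else 1)"
    by (cases "0 \<le> y") (auto simp: max_def power2_eq_square)
  finally show ?thesis .
qed

text \<open>The boundary of \<open>V\<close> may be uncountable, so the fundamental theorem is not applied to \<open>v\<close>
  but to \<^term>\<open>\<lambda>x. soft e (v x)\<close>, which is differentiable everywhere. In the limit the points
  with \<open>v = 0\<close> and \<open>w \<noteq> 0\<close> drop out; they are isolated zeros of \<open>v\<close>, hence countable.\<close>

lemma fundamental_theorem_open:
  fixes v w :: "real \<Rightarrow> real"
  assumes ab: "a \<le> b" and v: "continuous_on UNIV v"
    and out: "\<And>x. x \<notin> V \<Longrightarrow> v x = 0 \<and> w x = 0"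
    and der: "\<And>x. x \<in> V \<Longrightarrow> (v has_real_derivative w x) (at x)"
    and int: "set_integrable lborel {a..b} w"
  shows "(LINT x:{a..b}|lborel. w x) = v b - v a"
proof -
  define en where "en n = inverse (real (Suc n))" for n
  have en: "0 < en n" for n by (simp add: en_def)
  have en0: "filterlim en (nhds 0) sequentially" unfolding en_def by (rule LIMSEQ_inverse_real_of_nat)
  define h where "h x = (if v x = 0 then 0 else w x)" for x
  have "(h has_integral v b - v a) {a..b}"
  proof (rule has_integral_dominated_convergence[where f = "\<lambda>n x. soft' (en n) (v x) * w x"
        and y = "\<lambda>n. soft (en n) (v b) - soft (en n) (v a)" and h = "\<lambda>x. 3 * \<bar>w x\<bar>"])
    fix n
    show "((\<lambda>x. soft' (en n) (v x) * w x) has_integral soft (en n) (v b) - soft (en n) (v a)) {a..b}"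
    proof (rule fundamental_theorem_of_calculus[OF ab])
      fix x
      have "((\<lambda>x. soft (en n) (v x)) has_real_derivative soft' (en n) (v x) * w x) (at x)"
      proof (cases "v x = 0")
        \<comment> \<open>By continuity v stays below the threshold near x, so the composition is
          locally constant whether or not v is differentiable there.\<close>
        case True
        have "isCont v x" using v by (simp add: continuous_on_eq_continuous_at)
        then have "filterlim v (nhds 0) (nhds x)"
          using True continuous_at_imp_continuous_at_within[of x v UNIV]
          by (metis isCont_def tendsto_at_iff_tendsto_nhds)
        then have "\<forall>\<^sub>F y in nhds x. dist (v y) 0 < en n" using en tendstoD by blast
        then have ev: "\<forall>\<^sub>F y in nhds x. soft (en n) (v y) = 0"
          by (rule eventually_mono) (simp add: soft_near_0)
        show ?thesis by (subst DERIV_cong_ev[OF refl ev refl]) (simp add: True soft'_def)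
      next
        case False
        then show ?thesis using out der by (intro DERIV_chain2[OF DERIV_soft]) auto
      qed
      then show "((\<lambda>x. soft (en n) (v x)) has_vector_derivative soft' (en n) (v x) * w x) (at x within {a..b})"
        by (simp add: has_real_derivative_iff_has_vector_derivative has_vector_derivative_at_within)
    qed
    show "\<forall>x\<in>{a..b}. norm (soft' (en n) (v x) * w x) \<le> 3 * \<bar>w x\<bar>"
      using soft'_bound[of "en n"] en[of n] by (auto simp: abs_mult intro!: mult_right_mono)
  next
    show "(\<lambda>x. 3 * \<bar>w x\<bar>) integrable_on {a..b}"
      using integrable_cmul[OF set_borel_integral_eq_integral(1)[OF set_integrable_abs[OF int]], of 3] by simp
    show "\<forall>x\<in>{a..b}. (\<lambda>n. soft' (en n) (v x) * w x) \<longlonglongrightarrow> h x"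
    proof
      fix x
      have "(\<lambda>n. soft' (en n) (v x) * w x) \<longlonglongrightarrow> (if v x = 0 then 0 else 1) * w x"
        by (intro tendsto_intros filterlim_compose[OF soft'_limit en0])
      then show "(\<lambda>n. soft' (en n) (v x) * w x) \<longlonglongrightarrow> h x" by (simp add: h_def split: if_splits)
    qed
    show "(\<lambda>n. soft (en n) (v b) - soft (en n) (v a)) \<longlonglongrightarrow> v b - v a"
      by (intro tendsto_intros filterlim_compose[OF soft_limit en0])
  qed
  moreover define Z where "Z = {x. v x = 0 \<and> w x \<noteq> 0}"
  moreover have "countable Z"
  proof (rule countable_isolated)
    fix x assume x: "x \<in> Z"
    then have "x \<in> V" using out by (auto simp: Z_def)
    then have "((\<lambda>y. (v y - v x) / (y - x)) \<longlongrightarrow> w x) (at x)"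
      using der by (simp add: has_field_derivative_iff)
    then have "\<forall>\<^sub>F y in at x. (v y - v x) / (y - x) \<noteq> 0"
      using x by (intro tendsto_imp_eventually_ne) (auto simp: Z_def)
    then obtain U where "open U" "x \<in> U" "\<And>y. y \<in> U \<Longrightarrow> y \<noteq> x \<Longrightarrow> (v y - v x) / (y - x) \<noteq> 0"
      unfolding eventually_at_topological by blast
    then show "\<exists>U. open U \<and> U \<inter> Z = {x}" using x by (intro exI[of _ U]) (auto simp: Z_def)
  qed
  ultimately have "(w has_integral v b - v a) {a..b}"
    by (intro has_integral_spike[of Z _ w h])
      (auto simp: h_def Z_def negligible_iff_null_sets intro!: null_sets_completionI countable_imp_null_set_lborel)
  then show ?thesis using set_borel_integral_eq_integral(2)[OF int] by (simp add: integral_unique)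
qed

lemma lborel_integral_translate:
  fixes f :: "'a::euclidean_space \<Rightarrow> 'b::{banach,second_countable_topology}"
  assumes f: "f \<in> borel_measurable borel"
  shows "(LINT x|lborel. f (x + c)) = (LINT x|lborel. f x)"
    and "integrable lborel (\<lambda>x. f (x + c)) \<longleftrightarrow> integrable lborel f"
proof -
  have c: "(\<lambda>x. c + x) \<in> lborel \<rightarrow>\<^sub>M (borel :: 'a measure)" by simp
  have "(LINT x|lborel. f x) = (LINT x|distr lborel borel ((+) c). f x)" by (simp add: lborel_distr_plus)
  also have "\<dots> = (LINT x|lborel. f (c + x))" by (rule integral_distr[OF c f])
  finally show "(LINT x|lborel. f (x + c)) = (LINT x|lborel. f x)" by (simp add: add.commute)
  have "integrable lborel f \<longleftrightarrow> integrable (distr lborel borel ((+) c)) f" by (simp add: lborel_distr_plus)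
  also have "\<dots> \<longleftrightarrow> integrable lborel (\<lambda>x. f (c + x))" by (rule integrable_distr_eq[OF c f])
  finally show "integrable lborel (\<lambda>x. f (x + c)) \<longleftrightarrow> integrable lborel f" by (simp add: add.commute)
qed

text \<open>Integrating the fundamental theorem on the segments from \<open>x\<close> to \<open>x + i\<close> over all \<open>x\<close>, the
  left-hand side gives the integral of \<open>w\<close> and the right-hand side cancels by translation
  invariance. No regularity of the boundary and no decay at infinity is needed.\<close>

lemma integral_directional_derivative:
  fixes u w :: "'a::euclidean_space \<Rightarrow> real"
  assumes cont: "continuous_on UNIV u" and u: "integrable lborel u" and w: "integrable lborel w"
    and out: "\<And>x. x \<notin> \<Omega> \<Longrightarrow> u x = 0 \<and> w x = 0"
    and der: "\<And>x. x \<in> \<Omega> \<Longrightarrow> ((\<lambda>s. u (x + s *\<^sub>R i)) has_real_derivative w x) (at 0)"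
  shows "(LINT x|lborel. w x) = 0"
proof -
  have [measurable]: "w \<in> borel_measurable borel" "u \<in> borel_measurable borel"
    using u w by (auto dest: borel_measurable_integrable)
  define F where "F s x = indicator {0..1::real} s * w (x + s *\<^sub>R i)" for s x
  have Fm: "case_prod F \<in> borel_measurable (lborel \<Otimes>\<^sub>M lborel)"
    unfolding F_def case_prod_beta by measurable
  have tr: "(LINT x|lborel. F s x) = indicator {0..1} s * (LINT x|lborel. w x)"
    "(LINT x|lborel. norm (F s x)) = indicator {0..1} s * (LINT x|lborel. norm (w x))"
    "integrable lborel (F s)" for s
    unfolding F_def using lborel_integral_translate[of w "s *\<^sub>R i"] lborel_integral_translate[of "\<lambda>x. norm (w x)" "s *\<^sub>R i"] w
    by (auto simp: abs_mult)
  have int: "integrable (lborel \<Otimes>\<^sub>M lborel) (case_prod F)"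
  proof (rule lborel_pair.Fubini_integrable[OF Fm])
    have "integrable lborel (\<lambda>s::real. indicator {0..1} s * (LINT x|lborel. norm (w x)))"
      by (intro integrable_mult_left integrable_real_indicator) auto
    then show "integrable lborel (\<lambda>s. LINT x|lborel. norm (case_prod F (s, x)))"
      using tr(2) by simp
  qed (use tr in simp)
  have "AE x in lborel. integrable lborel (\<lambda>s. F s x)" by (rule lborel_pair.AE_integrable_snd[OF int])
  \<comment> \<open>Fubini yields integrability along the segment for almost every starting point
    only, hence the identity holds almost everywhere.\<close>
  then have AE: "AE x in lborel. (LINT s|lborel. F s x) = u (x + i) - u x"
  proof (rule AE_mp, intro AE_I2 impI)
    fix x assume x: "integrable lborel (\<lambda>s. F s x)"
    have "(LINT s:{0..1}|lborel. w (x + s *\<^sub>R i)) = u (x + 1 *\<^sub>R i) - u (x + 0 *\<^sub>R i)"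
    proof (rule fundamental_theorem_open[where V = "{s. x + s *\<^sub>R i \<in> \<Omega>}"])
      show "continuous_on UNIV (\<lambda>s. u (x + s *\<^sub>R i))"
        by (rule continuous_on_compose2[OF cont]) (auto intro!: continuous_intros)
      show "((\<lambda>s. u (x + s *\<^sub>R i)) has_real_derivative w (x + s *\<^sub>R i)) (at s)" if "s \<in> {s. x + s *\<^sub>R i \<in> \<Omega>}" for s
        by (rule DERIV_line_shift) (use der that in auto)
      show "set_integrable lborel {0..1} (\<lambda>s. w (x + s *\<^sub>R i))"
        using x by (simp add: F_def set_integrable_def)
    qed (use out in auto)
    then show "(LINT s|lborel. F s x) = u (x + i) - u x"
      by (simp add: F_def set_lebesgue_integral_def)
  qed
  have "(LINT x|lborel. w x) = (LINT s|lborel. indicator {0..1::real} s * (LINT x|lborel. w x))"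
    by simp
  also have "\<dots> = (LINT s|lborel. LINT x|lborel. F s x)" by (simp add: tr)
  also have "\<dots> = (LINT x|lborel. LINT s|lborel. F s x)"
    using lborel_pair.integral_fst[OF int] lborel_pair.integral_snd[OF int] by simp
  also have "\<dots> = (LINT x|lborel. u (x + i) - u x)"
    by (rule integral_cong_AE) (use AE Fm in \<open>auto intro!: lborel.borel_measurable_lebesgue_integral[of "\<lambda>x s. F s x", simplified] simp: split_beta' F_def\<close>)
  also have "\<dots> = 0"
    using lborel_integral_translate[of u i] u by simp
  finally show ?thesis .
qed

section \<open>The score vector of an exponential family\<close>

text \<open>Passes from the boundary condition on the diagonal of \<open>K1\<close> to its square
  root, which is the norm of \<open>dk\<close>.\<close>

lemma eq_0_if_mult_sqrt: "(a::real) * b = 0 \<Longrightarrow> b * sqrt a = 0"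
  by auto

locale score_family = smooth_rkhs \<Omega> k evf
  for \<Omega> :: "'a::euclidean_space set" and k :: "'a \<times> 'a \<Rightarrow> real"
    and evf :: "'h::{real_inner,banach,second_countable_topology} \<Rightarrow> 'a \<Rightarrow> real" +
  fixes q0 p0 :: "'a \<Rightarrow> real" and f0 :: 'h
  assumes q0_nonneg: "\<And>x. x \<in> \<Omega> \<Longrightarrow> 0 \<le> q0 x"
    and p0: "p0 = exp_family_density \<Omega> q0 evf f0"
    and p0_prob: "prob_space (density lborel (\<lambda>x. ennreal (p0 x) * indicator \<Omega> x))"
    and assm_B: "smoothness_assm \<Omega> k p0"
    and assm_C: "boundary_assm \<Omega> k p0"
    and assm_D: "integrability_assm 2 \<Omega> k q0 p0"
    and diag_bdd: "bdd_above (diag_values \<Omega> k)"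
begin

abbreviation D :: "'a \<Rightarrow> 'a \<Rightarrow> 'h" where "D \<equiv> dk \<Omega> k evf"
abbreviation DD :: "'a \<Rightarrow> 'a \<Rightarrow> 'h" where "DD \<equiv> ddk \<Omega> k evf"

text \<open>The logarithm of \<open>q0\<close> is meaningful here only, and this set carries all
  mass of \<open>p0\<close>.\<close>

definition P :: "'a set" where "P = {x \<in> \<Omega>. 0 < q0 x}"
definition pp :: "'a \<Rightarrow> real" where "pp x = (if x \<in> \<Omega> then p0 x else 0)"
definition \<mu> :: "'a measure" where "\<mu> = density lborel (\<lambda>x. ennreal (pp x))"

lemma \<mu>_eq: "density lborel (\<lambda>x. ennreal (p0 x) * indicator \<Omega> x) = \<mu>"
  unfolding \<mu>_def by (rule arg_cong[where f = "density lborel"]) (auto simp: pp_def fun_eq_iff)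

lemma sets_\<mu>[simp, measurable_cong]: "sets \<mu> = sets borel" and space_\<mu>[simp]: "space \<mu> = UNIV"
  by (auto simp: \<mu>_def)

lemma measurable_\<mu>: "Y \<in> \<mu> \<rightarrow>\<^sub>M N \<longleftrightarrow> Y \<in> borel \<rightarrow>\<^sub>M N"
  by (subst measurable_cong_sets[OF sets_\<mu> refl]) simp

sublocale \<mu>: prob_space \<mu>
  using p0_prob unfolding \<mu>_eq .

lemma q0_C1:
  obtains q0' where "\<And>x. x \<in> \<Omega> \<Longrightarrow> (q0 has_derivative blinfun_apply (q0' x)) (at x)" "continuous_on \<Omega> q0'"
  using assm_D unfolding integrability_assm_def C1_on_def by blast

lemma q0_continuous: "continuous_on \<Omega> q0"
  using q0_C1 by (metis continuous_at_imp_continuous_on has_derivative_continuous)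

lemma
  shows q0_DERIV: "x \<in> \<Omega> \<Longrightarrow> ((\<lambda>s. q0 (x + s *\<^sub>R i)) has_real_derivative pd i q0 x) (at 0)"
    and pd_q0_continuous: "continuous_on \<Omega> (pd i q0)"
proof -
  obtain q0' where q0': "\<And>x. x \<in> \<Omega> \<Longrightarrow> (q0 has_derivative blinfun_apply (q0' x)) (at x)"
    and cont: "continuous_on \<Omega> q0'" using q0_C1 by blast
  have D: "((\<lambda>s. q0 (x + s *\<^sub>R i)) has_real_derivative blinfun_apply (q0' x) i) (at 0)" if "x \<in> \<Omega>" for x
  proof -
    have "((\<lambda>s. x + s *\<^sub>R i) has_derivative (\<lambda>s. s *\<^sub>R i)) (at (0::real))"
      by (auto intro!: derivative_eq_intros)
    then have "((\<lambda>s. q0 (x + s *\<^sub>R i)) has_derivative (\<lambda>s. blinfun_apply (q0' x) (s *\<^sub>R i))) (at 0)"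
      by (rule has_derivative_compose) (use q0'[OF that] in simp)
    then show ?thesis
      unfolding has_field_derivative_def by (simp add: blinfun.scaleR_right mult_commute_abs)
  qed
  then have pd: "pd i q0 x = blinfun_apply (q0' x) i" if "x \<in> \<Omega>" for x
    unfolding pd_def using that by (intro DERIV_imp_deriv) auto
  show "((\<lambda>s. q0 (x + s *\<^sub>R i)) has_real_derivative pd i q0 x) (at 0)" if x: "x \<in> \<Omega>"
    using D[OF x] pd[OF x] by simp
  have "continuous_on \<Omega> (\<lambda>x. blinfun_apply (q0' x) i)" by (intro continuous_intros cont)
  then show "continuous_on \<Omega> (pd i q0)" by (rule continuous_on_eq) (simp add: pd)
qed

lemma open_P: "open P"
proof -
  have "P = \<Omega> \<inter> q0 -` {0<..}" by (auto simp: P_def)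
  then show ?thesis using continuous_open_preimage[OF q0_continuous open_\<Omega>] by simp
qed

lemma P_subset: "P \<subseteq> \<Omega>" by (auto simp: P_def)

lemma ln_q0_DERIV:
  assumes "x \<in> P"
  shows "((\<lambda>s. ln (q0 (x + s *\<^sub>R i))) has_real_derivative pd i q0 x / q0 x) (at 0)"
    and pd_ln_q0: "pd i (\<lambda>y. ln (q0 y)) x = pd i q0 x / q0 x"
proof -
  show D: "((\<lambda>s. ln (q0 (x + s *\<^sub>R i))) has_real_derivative pd i q0 x / q0 x) (at 0)"
    using q0_DERIV[of x i] assms by (auto intro!: derivative_eq_intros simp: P_def)
  then show "pd i (\<lambda>y. ln (q0 y)) x = pd i q0 x / q0 x" unfolding pd_def[of i "\<lambda>y. ln (q0 y)"] by (rule DERIV_imp_deriv)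
qed

lemma p0_eq: "p0 x = exp (evf f0 x - log_partition \<Omega> q0 evf f0) * q0 x"
  by (simp add: p0 exp_family_density_def)

lemma p0_nonneg: "x \<in> \<Omega> \<Longrightarrow> 0 \<le> p0 x"
  by (simp add: p0_eq q0_nonneg)

lemma pp_nonneg: "0 \<le> pp x" by (simp add: pp_def p0_nonneg)

lemma pp_notin_P: "x \<notin> P \<Longrightarrow> pp x = 0"
  using q0_nonneg[of x] by (auto simp: pp_def p0_eq P_def)

lemma evf_continuous: "continuous_on \<Omega> (evf f)"
proof -
  have "continuous_on \<Omega> (\<lambda>x. f \<bullet> kf x)" by (intro continuous_intros kf_continuous)
  then show ?thesis by (rule continuous_on_eq) (simp add: evf_inner)
qed

lemma p0_continuous: "continuous_on \<Omega> p0"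
  unfolding p0_eq[abs_def] by (intro continuous_intros evf_continuous q0_continuous)

lemma pp_measurable[measurable]: "pp \<in> borel_measurable borel"
proof -
  have "(\<lambda>x. indicator \<Omega> x *\<^sub>R p0 x) \<in> borel_measurable borel"
    by (intro borel_measurable_continuous_on_indicator p0_continuous) (simp add: open_\<Omega>)
  then show ?thesis by (rule measurable_cong[THEN iffD1, rotated]) (auto simp: pp_def)
qed

lemma AE_P: "AE x in \<mu>. x \<in> P"
  unfolding \<mu>_def by (subst AE_density) (auto intro!: AE_I2, metis less_irrefl pp_notin_P)

lemma K1_diag_bound: "\<lbrakk>i \<in> Basis; x \<in> \<Omega>\<rbrakk> \<Longrightarrow> K1 i (x, x) \<le> Sup (diag_values \<Omega> k)"
  using diag_bdd by (intro cSup_upper) (auto simp: diag_values_def)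

lemma K1_nonneg: "\<lbrakk>i \<in> Basis; x \<in> \<Omega>\<rbrakk> \<Longrightarrow> 0 \<le> K1 i (x, x)"
  by (simp add: dk_inner[symmetric])

lemma norm_dk_bound: "\<lbrakk>i \<in> Basis; x \<in> \<Omega>\<rbrakk> \<Longrightarrow> (norm (D i x))\<^sup>2 \<le> Sup (diag_values \<Omega> k)"
  using K1_diag_bound K1_nonneg by (simp add: norm_dk)

text \<open>Component i of the vector field p0 grad h, since \<open>h \<bullet> D i x\<close> is the
  partial derivative of the function of h.\<close>

definition flux :: "'a \<Rightarrow> 'h \<Rightarrow> 'a \<Rightarrow> real" where
  "flux i h x = pp x * (h \<bullet> D i x)"

text \<open>Product rule, with the derivative of p0 written as p0 times that of f0 + log q0.\<close>

definition flux_div :: "'a \<Rightarrow> 'h \<Rightarrow> 'a \<Rightarrow> real" where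
  "flux_div i h x = pp x * (h \<bullet> DD i x + (h \<bullet> D i x) * (f0 \<bullet> D i x + pd i (\<lambda>y. ln (q0 y)) x))"

text \<open>Only boundary points need an argument. There the flux is dominated by a multiple of
  \<open>b\<close>, which extends continuously to the closure and vanishes on the boundary by
  assumption (C).\<close>

lemma flux_continuous:
  assumes i: "i \<in> Basis"
  shows "continuous_on UNIV (flux i h)"
proof (intro continuous_at_imp_continuous_on ballI)
  fix x
  show "isCont (flux i h) x"
  proof (cases "x \<in> \<Omega>")
    case True
    have "continuous_on \<Omega> (\<lambda>x. p0 x * (h \<bullet> D i x))"
      by (intro continuous_intros p0_continuous dk_continuous i)
    then have "continuous_on \<Omega> (flux i h)" by (rule continuous_on_eq) (simp add: flux_def pp_def)
    then show ?thesis using True open_\<Omega> by (simp add: continuous_on_eq_continuous_at)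
  next
    case False
    define b where "b y = cont_ext \<Omega> p0 y * sqrt (cont_ext (\<Omega> \<times> \<Omega>) (K1 i) (y, y))" for y
    have c: "continuous_on (closure \<Omega> \<times> closure \<Omega>) (cont_ext (\<Omega> \<times> \<Omega>) (K1 i))"
      using assm_B[unfolded smoothness_assm_def, THEN conjunct2, rule_format, of "[i]"] i by simp
    have "continuous_on (closure \<Omega>) (\<lambda>y. cont_ext (\<Omega> \<times> \<Omega>) (K1 i) (y, y))"
      by (rule continuous_on_compose2[OF c]) (auto intro!: continuous_intros)
    moreover have "continuous_on (closure \<Omega>) (cont_ext \<Omega> p0)" using assm_B by (simp add: smoothness_assm_def)
    ultimately have b_cont: "continuous_on (closure \<Omega>) b"
      unfolding b_def by (intro continuous_intros)
    have le: "\<bar>flux i h y\<bar> \<le> norm h * \<bar>b y\<bar>" if "y \<in> \<Omega>" for y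
    proof -
      have "\<bar>flux i h y\<bar> = p0 y * \<bar>h \<bullet> D i y\<bar>"
        using that by (simp add: flux_def pp_def abs_mult p0_nonneg)
      also have "\<dots> \<le> p0 y * (norm h * norm (D i y))"
        using that by (intro mult_left_mono Cauchy_Schwarz_ineq2 p0_nonneg)
      also have "\<dots> = norm h * b y" using that i by (simp add: b_def cont_ext_def norm_dk)
      finally show ?thesis using norm_ge_zero[of h] by (meson abs_ge_self mult_left_mono order_trans)
    qed
    have zero: "flux i h y = 0" if "y \<notin> \<Omega>" for y using that by (simp add: flux_def pp_def)
    have "\<exists>d>0. \<forall>y. dist y x < d \<longrightarrow> \<bar>flux i h y\<bar> < e" if e: "0 < e" for e
    proof (cases "x \<in> closure \<Omega>")
      case True
      then have "b x = 0"
        unfolding b_def using assm_C i False by (intro eq_0_if_mult_sqrt) (auto simp: boundary_assm_def)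
      moreover have "0 < e / (norm h + 1)" using e by (simp add: add_nonneg_pos)
      ultimately obtain d where d: "0 < d" "\<And>y. y \<in> closure \<Omega> \<Longrightarrow> dist y x < d \<Longrightarrow> \<bar>b y\<bar> < e / (norm h + 1)"
        using b_cont True unfolding continuous_on_iff by (metis dist_real_def diff_zero)
      have "\<bar>flux i h y\<bar> < e" if y: "dist y x < d" for y
      proof (cases "y \<in> \<Omega>")
        case True
        then have "\<bar>b y\<bar> * (norm h + 1) < e"
          using d(2)[of y] y closure_subset[of \<Omega>] by (auto simp: pos_less_divide_eq add_nonneg_pos)
        then have "norm h * \<bar>b y\<bar> < e" using abs_ge_zero[of "b y"] by (simp add: algebra_simps)
        then show ?thesis using le[OF True] by linarith
      qed (use zero e in simp)
      then show ?thesis using d(1) by blast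
    next
      case False
      then obtain d where d: "0 < d" "ball x d \<subseteq> - closure \<Omega>"
        using open_contains_ball[of "- closure \<Omega>"] by auto
      have "y \<notin> \<Omega>" if "dist y x < d" for y
        using d(2) that closure_subset[of \<Omega>] by (auto simp: dist_commute subset_iff)
      then show ?thesis using zero e d(1) by auto
    qed
    then show ?thesis using zero[OF False] by (simp add: continuous_at_eps_delta dist_real_def)
  qed
qed

lemma flux_DERIV:
  assumes i: "i \<in> Basis" and x: "x \<in> \<Omega>"
  shows "((\<lambda>s. flux i h (x + s *\<^sub>R i)) has_real_derivative flux_div i h x) (at 0)"
proof -
  let ?c = "log_partition \<Omega> q0 evf f0"
  have ev: "\<forall>\<^sub>F s in nhds 0. flux i h (x + s *\<^sub>R i)
      = exp (evf f0 (x + s *\<^sub>R i) - ?c) * q0 (x + s *\<^sub>R i) * (h \<bullet> D i (x + s *\<^sub>R i))"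
    using line_nhds[of x 0 i] x by (auto elim!: eventually_mono simp: flux_def pp_def p0_eq)
  have hD: "((\<lambda>s. h \<bullet> D i (x + s *\<^sub>R i)) has_real_derivative h \<bullet> DD i x) (at 0)"
    using bounded_linear.has_vector_derivative[OF bounded_linear_inner_right dk_has_vector_derivative[OF i x]]
    by (simp add: has_real_derivative_iff_has_vector_derivative)
  have E: "((\<lambda>s. evf f0 (x + s *\<^sub>R i)) has_real_derivative f0 \<bullet> D i x) (at 0)"
    using evf_DERIV[OF i, of x 0 f0] x by simp
  have "((\<lambda>s. exp (evf f0 (x + s *\<^sub>R i) - ?c) * q0 (x + s *\<^sub>R i) * (h \<bullet> D i (x + s *\<^sub>R i))) has_real_derivative
     p0 x * (h \<bullet> DD i x) + (p0 x * (f0 \<bullet> D i x) + exp (evf f0 x - ?c) * pd i q0 x) * (h \<bullet> D i x)) (at 0)"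
    by (auto intro!: derivative_eq_intros hD E q0_DERIV x simp: p0_eq algebra_simps)
  also have "p0 x * (h \<bullet> DD i x) + (p0 x * (f0 \<bullet> D i x) + exp (evf f0 x - ?c) * pd i q0 x) * (h \<bullet> D i x)
      = flux_div i h x"
  proof (cases "q0 x = 0")
    \<comment> \<open>A zero of \<open>q0\<close> is a minimum, so its derivative vanishes as well;
      both sides are then 0, whatever value the logarithmic derivative has.\<close>
    case True
    have "\<forall>\<^sub>F s in nhds 0. q0 x \<le> q0 (x + s *\<^sub>R i)"
      using line_nhds[of x 0 i] x True q0_nonneg by (auto elim!: eventually_mono)
    then obtain d where d: "0 < d" "\<And>s. \<bar>s\<bar> < d \<Longrightarrow> q0 x \<le> q0 (x + s *\<^sub>R i)"
      unfolding eventually_nhds_metric by (auto simp: dist_real_def)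
    have "pd i q0 x = 0"
      by (rule DERIV_local_min[OF q0_DERIV[OF x] d(1)]) (use d(2) in auto)
    then show ?thesis using True x by (simp add: flux_div_def p0_eq pp_def)
  next
    case False
    then have "x \<in> P" using q0_nonneg[OF x] x by (simp add: P_def)
    then show ?thesis using False x by (simp add: flux_div_def pp_def pd_ln_q0 p0_eq field_simps)
  qed
  finally show ?thesis by (subst DERIV_cong_ev[OF refl ev refl])
qed

text \<open>The random vectors to which the variance bound applies; the class is closed under sums
  and its members are integrable, the measure being finite.\<close>

definition sqint :: "('a \<Rightarrow> 'h) \<Rightarrow> bool" where
  "sqint Y \<longleftrightarrow> Y \<in> borel_measurable borel \<and> integrable \<mu> (\<lambda>x. (norm (Y x))\<^sup>2)"

lemma sqint_integrable:
  assumes "sqint Y" shows "integrable \<mu> Y"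
proof (rule Bochner_Integration.integrable_bound[of _ "\<lambda>x. 1 + (norm (Y x))\<^sup>2"])
  show "integrable \<mu> (\<lambda>x. 1 + (norm (Y x))\<^sup>2)" using assms by (simp add: sqint_def)
  have "t \<le> 1 + t\<^sup>2" for t :: real using sum_squares_ge_zero[of "t - 1/2" 0] zero_le_power2[of "t - 1"] by (simp add: power2_eq_square algebra_simps)
  then show "AE x in \<mu>. norm (Y x) \<le> norm (1 + (norm (Y x))\<^sup>2)"
    by (auto intro: order_trans[OF _ abs_ge_self])
qed (use assms in \<open>simp add: sqint_def measurable_\<mu>\<close>)

lemma sqint_bound:
  assumes Y: "Y \<in> borel_measurable borel" and Z: "integrable \<mu> Z" and le: "AE x in \<mu>. (norm (Y x))\<^sup>2 \<le> Z x"
  shows "sqint Y"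
  unfolding sqint_def
proof (intro conjI Y Bochner_Integration.integrable_bound[OF Z])
  show "(\<lambda>x. (norm (Y x))\<^sup>2) \<in> borel_measurable \<mu>" using Y by measurable
  show "AE x in \<mu>. norm ((norm (Y x))\<^sup>2) \<le> norm (Z x)"
    using le by eventually_elim auto
qed

lemma sqint_add:
  assumes "sqint Y" "sqint Z" shows "sqint (\<lambda>x. Y x + Z x)"
proof (rule sqint_bound)
  show "(\<lambda>x. Y x + Z x) \<in> borel_measurable borel" using assms by (auto simp: sqint_def)
  show "integrable \<mu> (\<lambda>x. 2 * (norm (Y x))\<^sup>2 + 2 * (norm (Z x))\<^sup>2)" using assms by (simp add: sqint_def)
  have "(norm (Y x + Z x))\<^sup>2 \<le> 2 * (norm (Y x))\<^sup>2 + 2 * (norm (Z x))\<^sup>2" for x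
  proof -
    have "0 \<le> (norm (Y x - Z x))\<^sup>2" by simp
    then show ?thesis unfolding power2_norm_eq_inner by (simp add: algebra_simps inner_commute)
  qed
  then show "AE x in \<mu>. (norm (Y x + Z x))\<^sup>2 \<le> 2 * (norm (Y x))\<^sup>2 + 2 * (norm (Z x))\<^sup>2" by simp
qed

lemma sqint_sum: "(\<And>i. i \<in> I \<Longrightarrow> sqint (Y i)) \<Longrightarrow> sqint (\<lambda>x. \<Sum>i\<in>I. Y i x)"
proof (induction I rule: infinite_finite_induct)
  case (insert i I)
  then show ?case using sqint_add[of "Y i" "\<lambda>x. \<Sum>i\<in>I. Y i x"] by simp
qed (auto simp: sqint_def)

text \<open>The three kinds of terms of the score. Cutting off outside \<open>P\<close> makes them
  Borel functions on the whole space and changes no integral, as \<open>P\<close> has full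
  measure.\<close>

definition Y1 :: "'a \<Rightarrow> 'a \<Rightarrow> 'h" where "Y1 i x = indicator P x *\<^sub>R D i x"
definition Y2 :: "'a \<Rightarrow> 'a \<Rightarrow> 'h" where "Y2 i x = indicator P x *\<^sub>R (pd i (\<lambda>y. ln (q0 y)) x *\<^sub>R D i x)"
definition Y3 :: "'a \<Rightarrow> 'a \<Rightarrow> 'h" where "Y3 i x = indicator P x *\<^sub>R DD i x"

lemma Y_measurable:
  assumes i: "i \<in> Basis"
  shows Y1_measurable: "Y1 i \<in> borel_measurable borel" and Y2_measurable: "Y2 i \<in> borel_measurable borel"
    and Y3_measurable: "Y3 i \<in> borel_measurable borel"
proof -
  have P: "P \<in> sets borel" using open_P by simp
  note cont = continuous_on_subset[OF _ P_subset]
  show "Y1 i \<in> borel_measurable borel" "Y3 i \<in> borel_measurable borel"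
    unfolding Y1_def[abs_def] Y3_def[abs_def]
    by (intro borel_measurable_continuous_on_indicator P cont[OF dk_continuous[OF i]] cont[OF ddk_continuous[OF i]])+
  have "continuous_on P (\<lambda>x. pd i q0 x / q0 x)"
    using cont[OF q0_continuous]
    by (intro continuous_intros) (auto simp: P_def intro: cont[OF pd_q0_continuous, unfolded P_def])
  then have "continuous_on P (\<lambda>x. pd i (\<lambda>y. ln (q0 y)) x)" by (rule continuous_on_eq) (simp add: pd_ln_q0)
  then show "Y2 i \<in> borel_measurable borel"
    unfolding Y2_def[abs_def]
    by (intro borel_measurable_continuous_on_indicator P continuous_intros cont[OF dk_continuous[OF i]])
qed

lemma in_L2_finite:
  assumes "in_Lp (density (restrict_space lborel \<Omega>) (\<lambda>x. ennreal (p0 x))) (ennreal 2) \<phi>"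
  shows "(\<integral>\<^sup>+x. ennreal (indicator \<Omega> x * (\<phi> x)\<^sup>2) \<partial>\<mu>) < \<infinity>"
proof -
  let ?M = "density (restrict_space lborel \<Omega>) (\<lambda>x. ennreal (p0 x))"
  have \<Omega>: "\<Omega> \<in> sets borel" using open_\<Omega> by simp
  have \<phi>: "\<phi> \<in> borel_measurable ?M" and fin: "Lp_norm ?M (ennreal 2) \<phi> < \<infinity>"
    using assms by (auto simp: in_Lp_def)
  have \<phi>m: "\<phi> \<in> borel_measurable (restrict_space lborel \<Omega>)"
    using \<phi> by simp
  have p0m: "p0 \<in> borel_measurable (restrict_space lborel \<Omega>)"
    using borel_measurable_continuous_on_restrict[OF p0_continuous]
    by (simp add: measurable_def sets_restrict_space space_restrict_space)
  have \<phi>b: "(\<lambda>x. indicator \<Omega> x *\<^sub>R \<phi> x) \<in> borel_measurable borel"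
    using \<phi>m \<Omega> by (simp add: borel_measurable_restrict_space_iff)
  have "(\<integral>\<^sup>+x. ennreal (\<bar>\<phi> x\<bar> powr 2) \<partial>?M) < \<infinity>"
    using fin by (simp add: Lp_norm_def Let_def less_top split: if_splits)
  moreover have "(\<integral>\<^sup>+x. ennreal (\<bar>\<phi> x\<bar> powr 2) \<partial>?M) = (\<integral>\<^sup>+x. ennreal ((\<phi> x)\<^sup>2) \<partial>?M)"
    by (simp add: powr_numeral)
  moreover have "(\<integral>\<^sup>+x. ennreal ((\<phi> x)\<^sup>2) \<partial>?M) = (\<integral>\<^sup>+x. ennreal (p0 x) * ennreal ((\<phi> x)\<^sup>2) * indicator \<Omega> x \<partial>lborel)"
    using \<phi>m p0m \<Omega> by (subst nn_integral_density) (auto simp: nn_integral_restrict_space)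
  moreover have "\<dots> = (\<integral>\<^sup>+x. ennreal (pp x) * ennreal ((indicator \<Omega> x *\<^sub>R \<phi> x)\<^sup>2) \<partial>lborel)"
    by (rule nn_integral_cong) (auto simp: pp_def indicator_def)
  moreover have "\<dots> = (\<integral>\<^sup>+x. ennreal ((indicator \<Omega> x *\<^sub>R \<phi> x)\<^sup>2) \<partial>\<mu>)"
    unfolding \<mu>_def using \<phi>b by (subst nn_integral_density) auto
  moreover have "(indicator \<Omega> x *\<^sub>R \<phi> x)\<^sup>2 = indicator \<Omega> x * (\<phi> x)\<^sup>2" for x by (auto simp: indicator_def)
  ultimately show ?thesis by simp
qed

lemma sqint_from_L2:
  assumes Y: "Y \<in> borel_measurable borel" and le: "\<And>x. x \<in> P \<Longrightarrow> (norm (Y x))\<^sup>2 \<le> (\<phi> x)\<^sup>2"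
    and \<phi>: "in_Lp (density (restrict_space lborel \<Omega>) (\<lambda>x. ennreal (p0 x))) (ennreal 2) \<phi>"
  shows "sqint Y"
  unfolding sqint_def
proof (intro conjI Y integrableI_bounded)
  show "(\<lambda>x. (norm (Y x))\<^sup>2) \<in> borel_measurable \<mu>" using Y by measurable
  have "(\<integral>\<^sup>+x. ennreal (norm ((norm (Y x))\<^sup>2)) \<partial>\<mu>) \<le> (\<integral>\<^sup>+x. ennreal (indicator \<Omega> x * (\<phi> x)\<^sup>2) \<partial>\<mu>)"
    by (rule nn_integral_mono_AE)
      (use AE_P in eventually_elim, use le P_subset in \<open>auto simp: indicator_def intro!: ennreal_leI\<close>)
  then show "(\<integral>\<^sup>+x. ennreal (norm ((norm (Y x))\<^sup>2)) \<partial>\<mu>) < \<infinity>"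
    using in_L2_finite[OF \<phi>] by simp
qed

lemma norm_Y1: "i \<in> Basis \<Longrightarrow> (norm (Y1 i x))\<^sup>2 \<le> Sup (diag_values \<Omega> k)"
proof (cases "x \<in> P")
  case False
  assume i: "i \<in> Basis"
  \<comment> \<open>A set of full probability is nonempty, so the supremum dominates a square and is
    nonnegative.\<close>
  obtain y where "y \<in> P" using AE_P \<mu>.not_empty \<mu>.AE_False \<mu>.AE_prob_1
    by (metis (mono_tags, lifting) eventually_mono \<mu>.AE_E_prob equals0I)
  then have "0 \<le> Sup (diag_values \<Omega> k)"
    using norm_dk_bound[OF i, of y] P_subset by (metis order_trans subsetD zero_le_power2)
  then show ?thesis using False by (simp add: Y1_def)
qed (use norm_dk_bound P_subset in \<open>auto simp: Y1_def\<close>)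

lemma Y_sqint:
  assumes i: "i \<in> Basis"
  shows sqint_Y1: "sqint (Y1 i)" and sqint_Y2: "sqint (Y2 i)" and sqint_Y3: "sqint (Y3 i)"
    and sqint_Y11: "sqint (\<lambda>x. (f \<bullet> Y1 i x) *\<^sub>R Y1 i x)"
proof -
  let ?\<mu> = "density (restrict_space lborel \<Omega>) (\<lambda>x. ennreal (p0 x))"
  let ?S = "Sup (diag_values \<Omega> k)"
  have D: "in_Lp ?\<mu> (ennreal 2) (\<lambda>x. sqrt (K2 i (x, x)))"
    "in_Lp ?\<mu> (ennreal 2) (\<lambda>x. sqrt (K1 i (x, x)) * pd i (\<lambda>y. ln (q0 y)) x)"
    using assm_D i by (simp_all add: integrability_assm_def Let_def)
  show "sqint (Y1 i)"
    by (rule sqint_bound[where Z = "\<lambda>_. ?S"]) (use Y1_measurable[OF i] norm_Y1[OF i] in auto)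
  show "sqint (Y2 i)"
    by (rule sqint_from_L2[OF Y2_measurable[OF i] _ D(2)])
      (use i P_subset K1_nonneg in \<open>auto simp: Y2_def norm_dk power_mult_distrib subset_iff\<close>)
  show "sqint (Y3 i)"
    by (rule sqint_from_L2[OF Y3_measurable[OF i] _ D(1)])
      (use i P_subset in \<open>auto simp: Y3_def norm_ddk subset_iff\<close>)
  show "sqint (\<lambda>x. (f \<bullet> Y1 i x) *\<^sub>R Y1 i x)"
  proof (rule sqint_bound[where Z = "\<lambda>_. (norm f)\<^sup>2 * ?S * ?S"])
    show "(\<lambda>x. (f \<bullet> Y1 i x) *\<^sub>R Y1 i x) \<in> borel_measurable borel" using Y1_measurable[OF i] by measurable
    have "(norm ((f \<bullet> Y1 i x) *\<^sub>R Y1 i x))\<^sup>2 \<le> (norm f)\<^sup>2 * ?S * ?S" for x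
    proof -
      have "(f \<bullet> Y1 i x)\<^sup>2 \<le> (norm f)\<^sup>2 * (norm (Y1 i x))\<^sup>2"
        using Cauchy_Schwarz_ineq[of f "Y1 i x"] by (simp add: power2_norm_eq_inner)
      also have "\<dots> \<le> (norm f)\<^sup>2 * ?S" by (intro mult_left_mono norm_Y1 i) auto
      finally have "(f \<bullet> Y1 i x)\<^sup>2 * (norm (Y1 i x))\<^sup>2 \<le> ((norm f)\<^sup>2 * ?S) * ?S"
        using norm_Y1[OF i, of x] order_trans[OF zero_le_power2 norm_Y1[OF i, of x]]
        by (intro mult_mono) auto
      then show ?thesis by (simp add: power_mult_distrib)
    qed
    then show "AE x in \<mu>. (norm ((f \<bullet> Y1 i x) *\<^sub>R Y1 i x))\<^sup>2 \<le> (norm f)\<^sup>2 * ?S * ?S" by simp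
  qed simp
qed

lemma flux_div_eq:
  "flux_div i h x = pp x *\<^sub>R (h \<bullet> ((f0 \<bullet> Y1 i x) *\<^sub>R Y1 i x + Y2 i x + Y3 i x))"
  using pp_notin_P[of x]
  by (cases "x \<in> P") (simp_all add: flux_div_def Y1_def Y2_def Y3_def algebra_simps)

text \<open>On \<open>P\<close> this is what one sample point contributes to \<open>emp_xi\<close>
  plus the empirical operator applied to \<open>f0\<close>.\<close>

definition score :: "'a \<Rightarrow> 'h" where
  "score x = (\<Sum>i\<in>Basis. (f0 \<bullet> Y1 i x) *\<^sub>R Y1 i x + Y2 i x + Y3 i x)"

lemma sqint_score: "sqint score"
  unfolding score_def[abs_def] by (intro sqint_sum sqint_add Y_sqint)

text \<open>Against a fixed h, the density times the score is a sum over the coordinates of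
  derivatives of the flux, each of integral 0.\<close>

lemma score_centred: "(LINT x|\<mu>. h \<bullet> score x) = 0"
proof -
  have zero: "(LINT x|\<mu>. h \<bullet> ((f0 \<bullet> Y1 i x) *\<^sub>R Y1 i x + Y2 i x + Y3 i x)) = 0"
    and int: "integrable \<mu> (\<lambda>x. h \<bullet> ((f0 \<bullet> Y1 i x) *\<^sub>R Y1 i x + Y2 i x + Y3 i x))" if i: "i \<in> Basis" for i
  proof -
    let ?Y = "\<lambda>x. (f0 \<bullet> Y1 i x) *\<^sub>R Y1 i x + Y2 i x + Y3 i x"
    have sq: "sqint ?Y" by (intro sqint_add Y_sqint i)
    show int: "integrable \<mu> (\<lambda>x. h \<bullet> ?Y x)"
      by (rule integrable_inner_right) (use sqint_integrable[OF sq] in simp)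
    have m: "(\<lambda>x. h \<bullet> ?Y x) \<in> borel_measurable lborel" using sq by (auto simp: sqint_def)
    have eq: "flux_div i h = (\<lambda>x. pp x *\<^sub>R (h \<bullet> ?Y x))" by (rule ext) (rule flux_div_eq)
    have fint: "integrable lborel (flux_div i h)"
      unfolding eq using int m by (simp add: \<mu>_def integrable_density pp_nonneg)
    have "integrable \<mu> (\<lambda>x. h \<bullet> Y1 i x)"
      by (rule integrable_inner_right) (use sqint_integrable[OF sqint_Y1[OF i]] in simp)
    then have "integrable lborel (\<lambda>x. pp x *\<^sub>R (h \<bullet> Y1 i x))"
      using Y1_measurable[OF i] by (simp add: \<mu>_def integrable_density pp_nonneg)
    also have "(\<lambda>x. pp x *\<^sub>R (h \<bullet> Y1 i x)) = flux i h"
      using pp_notin_P by (auto simp: fun_eq_iff flux_def Y1_def indicator_def)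
    finally have "(LINT x|lborel. flux_div i h x) = 0"
      by (rule integral_directional_derivative[OF flux_continuous[OF i] _ fint _ flux_DERIV[OF i]])
        (auto simp: flux_def flux_div_def pp_def)
    then show "(LINT x|\<mu>. h \<bullet> ?Y x) = 0"
      unfolding eq \<mu>_def using m by (subst integral_density) (auto simp: pp_nonneg)
  qed
  have "(LINT x|\<mu>. h \<bullet> score x) = (LINT x|\<mu>. (\<Sum>i\<in>Basis. h \<bullet> ((f0 \<bullet> Y1 i x) *\<^sub>R Y1 i x + Y2 i x + Y3 i x)))"
    by (simp add: score_def inner_sum_right)
  also have "\<dots> = 0" using int zero by (subst Bochner_Integration.integral_sum) auto
  finally show ?thesis .
qed

text \<open>The contribution of a single point to the population and to the empirical
  operator.\<close>

definition Zop :: "'a \<Rightarrow> 'h \<Rightarrow> 'h" where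
  "Zop x f = (\<Sum>i\<in>Basis. (f \<bullet> Y1 i x) *\<^sub>R Y1 i x)"

lemma sqint_Zop: "sqint (\<lambda>x. Zop x f)"
  unfolding Zop_def by (intro sqint_sum Y_sqint)

lemma Zop_eq: "x \<in> P \<Longrightarrow> Zop x f = (\<Sum>i\<in>Basis. rank_one (D i x) (D i x) f)"
  by (simp add: Zop_def Y1_def rank_one_def inner_commute)

lemma pop_op_eq: "pop_op \<Omega> k evf p0 f = (LINT x|\<mu>. Zop x f)"
proof -
  have "(LINT x|\<mu>. Zop x f) = (LINT x|lborel. pp x *\<^sub>R Zop x f)"
    unfolding \<mu>_def using sqint_Zop[of f]
    by (subst integral_density) (auto simp: pp_nonneg sqint_def)
  also have "\<dots> = (LINT x|lborel. indicator \<Omega> x *\<^sub>R (p0 x *\<^sub>R (\<Sum>i\<in>Basis. rank_one (D i x) (D i x) f)))"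
  proof (rule Bochner_Integration.integral_cong)
    fix x
    show "pp x *\<^sub>R Zop x f = indicator \<Omega> x *\<^sub>R (p0 x *\<^sub>R (\<Sum>i\<in>Basis. rank_one (D i x) (D i x) f))"
      using pp_notin_P[of x] Zop_eq[of x f] by (cases "x \<in> P"; cases "x \<in> \<Omega>") (auto simp: pp_def)
  qed simp
  finally show ?thesis by (simp add: pop_op_def set_lebesgue_integral_def)
qed

lemma score_eq:
  "x \<in> P \<Longrightarrow> score x = Zop x f0 + (\<Sum>i\<in>Basis. pd i (\<lambda>y. ln (q0 y)) x *\<^sub>R D i x + DD i x)"
  by (simp add: score_def Zop_def Y1_def Y2_def Y3_def sum.distrib)

end

section \<open>Concentration of Hilbert space valued averages\<close>

lemma (in prob_space) indep_vars_pair: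
  assumes ind: "indep_vars (\<lambda>_. S) X UNIV" and ab: "a \<noteq> b"
  shows "indep_var S (X a) S (X b)"
proof -
  have "indep_var (PiM {a} (\<lambda>_. S)) (\<lambda>\<omega>. restrict (\<lambda>i. X i \<omega>) {a}) (PiM {b} (\<lambda>_. S)) (\<lambda>\<omega>. restrict (\<lambda>i. X i \<omega>) {b})"
    by (rule indep_var_restrict[OF ind]) (use ab in auto)
  then have "indep_var S ((\<lambda>f. f a) \<circ> (\<lambda>\<omega>. restrict (\<lambda>i. X i \<omega>) {a})) S ((\<lambda>f. f b) \<circ> (\<lambda>\<omega>. restrict (\<lambda>i. X i \<omega>) {b}))"
    by (rule indep_var_compose) auto
  then show ?thesis by (simp add: o_def)
qed

lemma abs_inner_le_sum_squares: "\<bar>x \<bullet> y\<bar> \<le> (norm x)\<^sup>2 + (norm y)\<^sup>2"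
proof -
  have "\<bar>x \<bullet> y\<bar> \<le> norm x * norm y" by (rule Cauchy_Schwarz_ineq2)
  moreover have "0 \<le> (norm x - norm y)\<^sup>2" by simp
  ultimately show ?thesis
    using mult_nonneg_nonneg[of "norm x" "norm y"] by (simp add: power2_diff)
qed

text \<open>Expanding the square, independence makes the joint law of two samples a product, and
  Fubini kills the cross terms: for fixed x the inner integral is the centring condition with h = Y
  x.\<close>

lemma (in prob_space) mean_square_average:
  fixes Y :: "'b \<Rightarrow> 'h::{real_inner,banach,second_countable_topology}"
  assumes ind: "indep_vars (\<lambda>_. S) X UNIV" and distr: "\<And>a::nat. distr M S (X a) = \<mu>"
    and Y[measurable]: "Y \<in> borel_measurable S" and int: "integrable \<mu> (\<lambda>x. (norm (Y x))\<^sup>2)"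
    and centred: "\<And>h. (LINT x|\<mu>. h \<bullet> Y x) = 0" and n: "0 < n"
  shows "(\<integral>\<^sup>+\<omega>. ennreal ((norm ((1 / real n) *\<^sub>R (\<Sum>a<n. Y (X a \<omega>))))\<^sup>2) \<partial>M)
    \<le> ennreal ((LINT x|\<mu>. (norm (Y x))\<^sup>2) / n)"
proof -
  let ?V = "LINT x|\<mu>. (norm (Y x))\<^sup>2"
  have X[measurable]: "random_variable S (X a)" for a using ind by (simp add: indep_vars_def)
  interpret \<mu>: prob_space \<mu> using prob_space_distr[OF X[of 0]] unfolding distr .
  interpret \<mu>2: pair_sigma_finite \<mu> \<mu> ..
  have sets_\<mu>[measurable_cong]: "sets \<mu> = sets S" using distr[of 0] by (metis sets_distr)
  have sq: "integrable M (\<lambda>\<omega>. (norm (Y (X a \<omega>)))\<^sup>2)" "expectation (\<lambda>\<omega>. (norm (Y (X a \<omega>)))\<^sup>2) = ?V" for a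
  proof -
    have "integrable (distr M S (X a)) (\<lambda>x. (norm (Y x))\<^sup>2)" using int by (simp add: distr)
    then show "integrable M (\<lambda>\<omega>. (norm (Y (X a \<omega>)))\<^sup>2)" by (subst (asm) integrable_distr_eq) auto
    have "?V = (LINT x|distr M S (X a). (norm (Y x))\<^sup>2)" by (simp add: distr)
    also have "\<dots> = expectation (\<lambda>\<omega>. (norm (Y (X a \<omega>)))\<^sup>2)" by (rule integral_distr) auto
    finally show "expectation (\<lambda>\<omega>. (norm (Y (X a \<omega>)))\<^sup>2) = ?V" ..
  qed
  have cross_int: "integrable M (\<lambda>\<omega>. Y (X a \<omega>) \<bullet> Y (X b \<omega>))" for a b
  proof (rule Bochner_Integration.integrable_bound)
    show "integrable M (\<lambda>\<omega>. (norm (Y (X a \<omega>)))\<^sup>2 + (norm (Y (X b \<omega>)))\<^sup>2)" using sq by simp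
    show "AE \<omega> in M. norm (Y (X a \<omega>) \<bullet> Y (X b \<omega>)) \<le> norm ((norm (Y (X a \<omega>)))\<^sup>2 + (norm (Y (X b \<omega>)))\<^sup>2)"
      using abs_inner_le_sum_squares by auto
  qed simp
  have cross: "expectation (\<lambda>\<omega>. Y (X a \<omega>) \<bullet> Y (X b \<omega>)) = 0" if ab: "a \<noteq> b" for a b
  proof -
    let ?G = "\<lambda>(x, y). Y x \<bullet> Y y"
    have eq: "\<mu> \<Otimes>\<^sub>M \<mu> = distr M (S \<Otimes>\<^sub>M S) (\<lambda>\<omega>. (X a \<omega>, X b \<omega>))"
      using indep_vars_pair[OF ind ab] by (simp add: indep_var_distribution_eq distr)
    have Gm: "?G \<in> borel_measurable (S \<Otimes>\<^sub>M S)" by measurable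
    have "integrable (\<mu> \<Otimes>\<^sub>M \<mu>) ?G"
      unfolding eq using cross_int[of a b] Gm by (subst integrable_distr_eq) auto
    then have "integral\<^sup>L (\<mu> \<Otimes>\<^sub>M \<mu>) ?G = (LINT x|\<mu>. LINT y|\<mu>. Y x \<bullet> Y y)"
      using \<mu>2.integral_fst[of "\<lambda>x y. Y x \<bullet> Y y"] by simp
    also have "\<dots> = 0" by (simp add: centred)
    finally have "integral\<^sup>L (distr M (S \<Otimes>\<^sub>M S) (\<lambda>\<omega>. (X a \<omega>, X b \<omega>))) ?G = 0" unfolding eq .
    then show ?thesis using Gm by (subst (asm) integral_distr) auto
  qed
  have expand: "(norm ((1 / real n) *\<^sub>R (\<Sum>a<n. Y (X a \<omega>))))\<^sup>2
      = (1 / (real n)\<^sup>2) * (\<Sum>a<n. \<Sum>b<n. Y (X a \<omega>) \<bullet> Y (X b \<omega>))" for \<omega>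
  proof -
    let ?s = "\<Sum>a<n. Y (X a \<omega>)"
    have "(norm ((1 / real n) *\<^sub>R ?s))\<^sup>2 = (1 / (real n)\<^sup>2) * (?s \<bullet> ?s)"
      by (simp add: power_mult_distrib power_divide power2_norm_eq_inner)
    also have "?s \<bullet> ?s = (\<Sum>a<n. \<Sum>b<n. Y (X a \<omega>) \<bullet> Y (X b \<omega>))"
      by (simp only: inner_sum_left) (simp only: inner_sum_right)
    finally show ?thesis .
  qed
  have "expectation (\<lambda>\<omega>. (norm ((1 / real n) *\<^sub>R (\<Sum>a<n. Y (X a \<omega>))))\<^sup>2)
      = (1 / (real n)\<^sup>2) * (\<Sum>a<n. \<Sum>b<n. expectation (\<lambda>\<omega>. Y (X a \<omega>) \<bullet> Y (X b \<omega>)))"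
    unfolding expand using cross_int by (simp add: Bochner_Integration.integral_sum)
  also have "(\<Sum>a<n. \<Sum>b<n. expectation (\<lambda>\<omega>. Y (X a \<omega>) \<bullet> Y (X b \<omega>))) = (\<Sum>a<n. \<Sum>b<n. if a = b then ?V else 0)"
    by (intro sum.cong refl) (use cross sq(2) in \<open>auto simp: power2_norm_eq_inner\<close>)
  also have "\<dots> = real n * ?V" by simp
  also have "1 / (real n)\<^sup>2 * (real n * ?V) = ?V / n" using n by (simp add: power2_eq_square)
  finally have E: "expectation (\<lambda>\<omega>. (norm ((1 / real n) *\<^sub>R (\<Sum>a<n. Y (X a \<omega>))))\<^sup>2) = ?V / n" .
  have "integrable M (\<lambda>\<omega>. (norm ((1 / real n) *\<^sub>R (\<Sum>a<n. Y (X a \<omega>))))\<^sup>2)"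
    unfolding expand using cross_int by (intro integrable_mult_right Bochner_Integration.integrable_sum)
  then have "(\<integral>\<^sup>+\<omega>. ennreal ((norm ((1 / real n) *\<^sub>R (\<Sum>a<n. Y (X a \<omega>))))\<^sup>2) \<partial>M) = ennreal (?V / n)"
    unfolding E[symmetric] by (rule nn_integral_eq_integral) simp
  then show ?thesis by simp
qed

text \<open>Distinct members are at distance sqrt 2, hence isolated.\<close>

lemma orthonormal_countable:
  fixes \<Phi> :: "'h::{real_inner,second_countable_topology} set"
  assumes "orthonormal \<Phi>" shows "countable \<Phi>"
proof (rule countable_isolated)
  fix \<phi> assume \<phi>: "\<phi> \<in> \<Phi>"
  have "\<psi> = \<phi>" if "\<psi> \<in> \<Phi>" "dist \<phi> \<psi> < 1" for \<psi>
  proof (rule ccontr)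
    assume "\<psi> \<noteq> \<phi>"
    then have "(dist \<phi> \<psi>)\<^sup>2 = 2"
      using assms \<phi> that(1) unfolding dist_norm power2_norm_eq_inner
      by (simp add: inner_diff_left inner_diff_right orthonormal_inner)
    then show False using that(2) power_mono[of "dist \<phi> \<psi>" 1 2] by simp
  qed
  then have "ball \<phi> 1 \<inter> \<Phi> = {\<phi>}" using \<phi> by auto
  then show "\<exists>U. open U \<and> U \<inter> \<Phi> = {\<phi>}" by (intro exI[of _ "ball \<phi> 1"]) simp
qed

section \<open>Averages of the one-point operators\<close>

context score_family begin

abbreviation chi_k :: real where "chi_k \<equiv> chi \<Omega> k"

lemma sum_norm_Y1: "(\<Sum>i\<in>Basis. (norm (Y1 i x))\<^sup>2) \<le> chi_k"
  using sum_bounded_above[of Basis "\<lambda>i. (norm (Y1 i x))\<^sup>2", OF norm_Y1] by (simp add: chi_def)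

lemma chi_nonneg: "0 \<le> chi_k"
  using order_trans[OF sum_nonneg sum_norm_Y1[of undefined]] by simp

lemma Zop_add: "Zop x (f + g) = Zop x f + Zop x g"
  by (simp add: Zop_def inner_add_left scaleR_add_left sum.distrib)

lemma Zop_scaleR: "Zop x (c *\<^sub>R f) = c *\<^sub>R Zop x f"
  by (simp add: Zop_def scaleR_sum_right)

lemma Zop_zero[simp]: "Zop x 0 = 0"
  by (simp add: Zop_def)

lemma inner_Zop: "g \<bullet> Zop x f = (\<Sum>i\<in>Basis. (f \<bullet> Y1 i x) * (g \<bullet> Y1 i x))"
  by (simp add: Zop_def inner_sum_right)

lemma Zop_measurable[measurable]: "(\<lambda>x. Zop x f) \<in> borel_measurable borel"
  using sqint_Zop by (simp add: sqint_def)

text \<open>Cauchy--Schwarz over the coordinates. One factor is kept as a quadratic form in f, so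
  that Bessel can be used when summing over an orthonormal set.\<close>

lemma norm_Zop_squared: "(norm (Zop x f))\<^sup>2 \<le> chi_k * (\<Sum>i\<in>Basis. (f \<bullet> Y1 i x)\<^sup>2)"
proof -
  have "norm (Zop x f) \<le> (\<Sum>i\<in>Basis. \<bar>f \<bullet> Y1 i x\<bar> * \<bar>norm (Y1 i x)\<bar>)"
    unfolding Zop_def by (rule order_trans[OF norm_sum]) simp
  also have "\<dots> \<le> L2_set (\<lambda>i. f \<bullet> Y1 i x) Basis * L2_set (\<lambda>i. norm (Y1 i x)) Basis"
    by (rule L2_set_mult_ineq)
  finally have "(norm (Zop x f))\<^sup>2 \<le> (L2_set (\<lambda>i. f \<bullet> Y1 i x) Basis * L2_set (\<lambda>i. norm (Y1 i x)) Basis)\<^sup>2"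
    by (rule power_mono) simp
  also have "\<dots> = (\<Sum>i\<in>Basis. (f \<bullet> Y1 i x)\<^sup>2) * (\<Sum>i\<in>Basis. (norm (Y1 i x))\<^sup>2)"
    by (simp add: power_mult_distrib L2_set_def sum_nonneg)
  also have "\<dots> \<le> (\<Sum>i\<in>Basis. (f \<bullet> Y1 i x)\<^sup>2) * chi_k"
    by (intro mult_left_mono sum_norm_Y1 sum_nonneg) simp
  finally show ?thesis by (simp add: mult.commute)
qed

lemma quadratic_Zop: "(\<Sum>i\<in>Basis. (f \<bullet> Y1 i x)\<^sup>2) \<le> chi_k * (norm f)\<^sup>2"
proof -
  have "(\<Sum>i\<in>Basis. (f \<bullet> Y1 i x)\<^sup>2) \<le> (\<Sum>i\<in>Basis. (norm (Y1 i x))\<^sup>2 * (norm f)\<^sup>2)"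
    by (intro sum_mono) (metis Cauchy_Schwarz_ineq power2_norm_eq_inner mult.commute)
  also have "\<dots> = (\<Sum>i\<in>Basis. (norm (Y1 i x))\<^sup>2) * (norm f)\<^sup>2" by (simp add: sum_distrib_right)
  also have "\<dots> \<le> chi_k * (norm f)\<^sup>2" by (intro mult_right_mono sum_norm_Y1) simp
  finally show ?thesis .
qed

lemma norm_Zop: "norm (Zop x f) \<le> chi_k * norm f"
proof (rule power2_le_imp_le)
  have "(norm (Zop x f))\<^sup>2 \<le> chi_k * (chi_k * (norm f)\<^sup>2)"
    by (rule order_trans[OF norm_Zop_squared]) (intro mult_left_mono quadratic_Zop chi_nonneg)
  then show "(norm (Zop x f))\<^sup>2 \<le> (chi_k * norm f)\<^sup>2" by (simp add: power2_eq_square algebra_simps)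
qed (simp add: chi_nonneg)

text \<open>After exchanging the sums, Bessel bounds the sum over F for each vector
  \<open>Y1 i x\<close>; the bound does not depend on the size of F.\<close>

lemma HS_Zop:
  assumes "finite F" "orthonormal F"
  shows "(\<Sum>e\<in>F. (norm (Zop x e))\<^sup>2) \<le> chi_k\<^sup>2"
proof -
  have "(\<Sum>e\<in>F. (norm (Zop x e))\<^sup>2) \<le> (\<Sum>e\<in>F. chi_k * (\<Sum>i\<in>Basis. (e \<bullet> Y1 i x)\<^sup>2))"
    by (intro sum_mono norm_Zop_squared)
  also have "\<dots> = chi_k * (\<Sum>i\<in>Basis. \<Sum>e\<in>F. (e \<bullet> Y1 i x)\<^sup>2)"
    by (subst sum.swap) (simp add: sum_distrib_left)
  also have "\<dots> \<le> chi_k * (\<Sum>i\<in>Basis. (norm (Y1 i x))\<^sup>2)"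
    by (intro mult_left_mono sum_mono bessel_finite assms chi_nonneg)
  also have "\<dots> \<le> chi_k * chi_k" by (intro mult_left_mono sum_norm_Y1 chi_nonneg)
  finally show ?thesis by (simp add: power2_eq_square)
qed

text \<open>The population and the empirical operator are the averages over \<^term>\<open>\<mu>\<close> and over the
  empirical distribution.\<close>

definition avg :: "'a measure \<Rightarrow> 'h \<Rightarrow> 'h" where
  "avg \<nu> f = (LINT x|\<nu>. Zop x f)"

context
  fixes \<nu> :: "'a measure"
  assumes \<nu>: "prob_space \<nu>" and sets_\<nu>[measurable_cong]: "sets \<nu> = sets borel"
begin

interpretation \<nu>: prob_space \<nu> by (rule \<nu>)

lemma Zop_integrable: "integrable \<nu> (\<lambda>x. Zop x f)"
  by (rule \<nu>.integrable_const_bound[of _ "chi_k * norm f"]) (simp_all add: norm_Zop)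

lemma Zop_sq_integrable: "integrable \<nu> (\<lambda>x. (norm (Zop x f))\<^sup>2)"
  by (rule \<nu>.integrable_const_bound[of _ "(chi_k * norm f)\<^sup>2"]) (simp_all add: norm_Zop power_mono)

lemma inner_avg: "g \<bullet> avg \<nu> f = (LINT x|\<nu>. g \<bullet> Zop x f)"
  unfolding avg_def by (rule integral_inner_right[symmetric]) (simp add: Zop_integrable)

lemma avg_bounded_linear: "bounded_linear (avg \<nu>)"
proof (rule bounded_linear_intro)
  show "avg \<nu> (f + g) = avg \<nu> f + avg \<nu> g" for f g
    unfolding avg_def Zop_add by (intro Bochner_Integration.integral_add Zop_integrable)
  show "avg \<nu> (c *\<^sub>R f) = c *\<^sub>R avg \<nu> f" for c f
    unfolding avg_def Zop_scaleR by simp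
  show "norm (avg \<nu> f) \<le> norm f * chi_k" for f
  proof -
    have "norm (avg \<nu> f) \<le> (LINT x|\<nu>. norm (Zop x f))" unfolding avg_def by (rule integral_norm_bound)
    also have "\<dots> \<le> (LINT x|\<nu>. chi_k * norm f)"
      by (intro integral_mono integrable_norm Zop_integrable norm_Zop) simp
    finally show ?thesis by (simp add: mult.commute \<nu>.prob_space)
  qed
qed

lemma avg_symmetric: "f \<bullet> avg \<nu> g = avg \<nu> f \<bullet> g"
proof -
  have "f \<bullet> avg \<nu> g = g \<bullet> avg \<nu> f"
    unfolding inner_avg inner_Zop by (intro Bochner_Integration.integral_cong refl sum.cong) (simp add: mult.commute)
  then show ?thesis by (simp add: inner_commute)
qed

lemma avg_quadratic: "f \<bullet> avg \<nu> f = (LINT x|\<nu>. (\<Sum>i\<in>Basis. (f \<bullet> Y1 i x)\<^sup>2))"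
  by (simp add: inner_avg inner_Zop power2_eq_square)

lemma avg_nonneg: "0 \<le> f \<bullet> avg \<nu> f"
  unfolding avg_quadratic by (intro Bochner_Integration.integral_nonneg sum_nonneg) simp

lemma avg_le: "f \<bullet> avg \<nu> f \<le> chi_k * (norm f)\<^sup>2"
proof -
  have "integrable \<nu> (\<lambda>x. f \<bullet> Zop x f)" by (intro integrable_inner_right) (simp add: Zop_integrable)
  then have "f \<bullet> avg \<nu> f \<le> (LINT x|\<nu>. chi_k * (norm f)\<^sup>2)"
    unfolding inner_avg by (intro integral_mono) (use quadratic_Zop in \<open>auto simp: inner_Zop power2_eq_square\<close>)
  then show ?thesis by (simp add: \<nu>.prob_space)
qed

text \<open>Jensen for the squared norm: integrate a \<bullet> z \<le> |a|^2/2 + |z|^2/2 with a the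
  average itself, and absorb the first term.\<close>

lemma norm_avg_squared: "(norm (avg \<nu> f))\<^sup>2 \<le> (LINT x|\<nu>. (norm (Zop x f))\<^sup>2)"
proof -
  have "(norm (avg \<nu> f))\<^sup>2 = (LINT x|\<nu>. avg \<nu> f \<bullet> Zop x f)"
    unfolding power2_norm_eq_inner by (rule inner_avg)
  also have "\<dots> \<le> (LINT x|\<nu>. (norm (avg \<nu> f))\<^sup>2 / 2 + (norm (Zop x f))\<^sup>2 / 2)"
  proof (rule integral_mono)
    show "integrable \<nu> (\<lambda>x. avg \<nu> f \<bullet> Zop x f)" by (intro integrable_inner_right) (simp add: Zop_integrable)
    show "integrable \<nu> (\<lambda>x. (norm (avg \<nu> f))\<^sup>2 / 2 + (norm (Zop x f))\<^sup>2 / 2)"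
      using Zop_sq_integrable by simp
    fix x
    have "0 \<le> (norm (avg \<nu> f - Zop x f))\<^sup>2" by simp
    then show "avg \<nu> f \<bullet> Zop x f \<le> (norm (avg \<nu> f))\<^sup>2 / 2 + (norm (Zop x f))\<^sup>2 / 2"
      unfolding power2_norm_eq_inner by (simp add: inner_diff_left inner_diff_right inner_commute)
  qed
  also have "\<dots> = (norm (avg \<nu> f))\<^sup>2 / 2 + (LINT x|\<nu>. (norm (Zop x f))\<^sup>2) / 2"
    using Zop_sq_integrable by (simp add: \<nu>.prob_space)
  finally show ?thesis by simp
qed

lemma avg_HS:
  assumes "finite F" "orthonormal F"
  shows "(\<Sum>e\<in>F. (norm (avg \<nu> e))\<^sup>2) \<le> chi_k\<^sup>2"
proof -
  have "(\<Sum>e\<in>F. (norm (avg \<nu> e))\<^sup>2) \<le> (\<Sum>e\<in>F. LINT x|\<nu>. (norm (Zop x e))\<^sup>2)"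
    by (intro sum_mono norm_avg_squared)
  also have "\<dots> = (LINT x|\<nu>. (\<Sum>e\<in>F. (norm (Zop x e))\<^sup>2))"
    by (intro Bochner_Integration.integral_sum[symmetric] Zop_sq_integrable)
  also have "\<dots> \<le> (LINT x|\<nu>. chi_k\<^sup>2)"
    by (intro integral_mono Bochner_Integration.integrable_sum Zop_sq_integrable HS_Zop assms) simp
  finally show ?thesis by (simp add: \<nu>.prob_space)
qed

text \<open>Holds for the population and the empirical measure alike, so the choice inside
  \<open>op_fun\<close> returns a genuine eigenbasis in both cases.\<close>

lemma avg_eigenbasis: "\<exists>\<Phi>. eigenbasis (avg \<nu>) \<Phi>"
  by (rule eigenbasis_exists_HS[OF avg_bounded_linear avg_symmetric avg_nonneg avg_HS])

end

lemma pop_op_avg: "pop_op \<Omega> k evf p0 = avg \<mu>"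
  by (rule ext) (simp add: pop_op_eq avg_def)

text \<open>The image of the uniform law on the indices: coinciding sample points keep their
  multiplicity, and all facts on \<open>avg\<close> apply to the sample.\<close>

definition emp_measure :: "nat \<Rightarrow> (nat \<Rightarrow> 'a) \<Rightarrow> 'a measure" where
  "emp_measure n xs = distr (measure_pmf (pmf_of_set {..<n})) borel xs"

lemma emp_measure: "prob_space (emp_measure n xs)" "sets (emp_measure n xs) = sets borel"
  by (auto simp: emp_measure_def intro!: prob_space.prob_space_distr prob_space_measure_pmf)

lemma avg_emp:
  assumes n: "0 < n"
  shows "avg (emp_measure n xs) f = (1 / real n) *\<^sub>R (\<Sum>a<n. Zop (xs a) f)"
proof -
  have "avg (emp_measure n xs) f = (LINT a|measure_pmf (pmf_of_set {..<n}). Zop (xs a) f)"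
    unfolding avg_def emp_measure_def by (rule integral_distr) auto
  also have "\<dots> = (\<Sum>a\<in>{..<n}. pmf (pmf_of_set {..<n}) a *\<^sub>R Zop (xs a) f)"
    by (rule integral_measure_pmf) (use n in \<open>auto simp: set_pmf_of_set lessThan_empty_iff\<close>)
  also have "\<dots> = (\<Sum>a<n. (1 / real n) *\<^sub>R Zop (xs a) f)"
    by (rule sum.cong) (use n in \<open>auto simp: pmf_of_set lessThan_empty_iff\<close>)
  finally show ?thesis by (simp add: scaleR_sum_right)
qed

lemma emp_op_avg:
  assumes n: "0 < n" and xs: "\<And>a. xs a \<in> P"
  shows "emp_op \<Omega> k evf n xs = avg (emp_measure n xs)"
proof
  fix f
  have "(\<Sum>a<n. \<Sum>i\<in>Basis. rank_one (D i (xs a)) (D i (xs a)) f) = (\<Sum>a<n. Zop (xs a) f)"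
    by (simp add: Zop_eq[OF xs])
  then show "emp_op \<Omega> k evf n xs f = avg (emp_measure n xs) f"
    unfolding emp_op_def avg_emp[OF n] by simp
qed

text \<open>This identity makes the noise vector of the error decomposition an average of
  independent centred vectors.\<close>

lemma emp_xi_score:
  assumes n: "0 < n" and xs: "\<And>a. xs a \<in> P"
  shows "emp_xi \<Omega> k evf q0 n xs + emp_op \<Omega> k evf n xs f0 = (1 / real n) *\<^sub>R (\<Sum>a<n. score (xs a))"
  unfolding emp_op_avg[OF assms] avg_emp[OF n] emp_xi_def
  by (simp add: score_eq[OF xs] sum.distrib scaleR_add_right add.commute)

end

section \<open>Mean-square control of the sample\<close>

locale sampled_family = score_family \<Omega> k evf q0 p0 f0 + M: prob_space M
  for \<Omega> :: "'a::euclidean_space set" and k :: "'a \<times> 'a \<Rightarrow> real"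
    and evf :: "'h::{real_inner,banach,second_countable_topology} \<Rightarrow> 'a \<Rightarrow> real"
    and q0 p0 :: "'a \<Rightarrow> real" and f0 :: 'h and M :: "'w measure" +
  fixes X :: "nat \<Rightarrow> 'w \<Rightarrow> 'a"
  assumes indep: "M.indep_vars (\<lambda>_. borel) X UNIV"
    and distr_X: "\<And>a. distr M borel (X a) = \<mu>"
begin

lemma X_measurable[measurable]: "X a \<in> M \<rightarrow>\<^sub>M borel"
  using indep by (simp add: M.indep_vars_def)

lemma AE_X_P: "AE \<omega> in M. \<forall>a. X a \<omega> \<in> P"
proof (subst AE_all_countable, intro allI)
  fix a
  have "AE x in distr M borel (X a). x \<in> P" unfolding distr_X by (rule AE_P)
  then show "AE \<omega> in M. X a \<omega> \<in> P" using open_P by (subst (asm) AE_distr_iff) auto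
qed

lemma mean_square:
  assumes "sqint Y" "\<And>h. (LINT x|\<mu>. h \<bullet> Y x) = 0" "0 < n"
  shows "(\<integral>\<^sup>+\<omega>. ennreal ((norm ((1 / real n) *\<^sub>R (\<Sum>a<n. Y (X a \<omega>))))\<^sup>2) \<partial>M)
    \<le> ennreal ((LINT x|\<mu>. (norm (Y x))\<^sup>2) / n)"
  by (rule M.mean_square_average[OF indep distr_X]) (use assms in \<open>auto simp: sqint_def\<close>)

definition emp :: "nat \<Rightarrow> 'w \<Rightarrow> 'h \<Rightarrow> 'h" where
  "emp n \<omega> = avg (emp_measure n (\<lambda>a. X a \<omega>))"

text \<open>The variance is at most the second moment. Extended integrals are used because the bound
  is to be summed over a whole basis.\<close>

lemma mean_square_op:
  assumes n: "0 < n"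
  shows "(\<integral>\<^sup>+\<omega>. ennreal ((norm (emp n \<omega> f - avg \<mu> f))\<^sup>2) \<partial>M)
    \<le> ennreal (1 / n) * (\<integral>\<^sup>+x. ennreal ((norm (Zop x f))\<^sup>2) \<partial>\<mu>)"
proof -
  let ?Y = "\<lambda>x. Zop x f - avg \<mu> f"
  note \<mu> = \<mu>.prob_space_axioms sets_\<mu>
  have int: "integrable \<mu> (\<lambda>x. Zop x f)" "integrable \<mu> (\<lambda>x. (norm (Zop x f))\<^sup>2)"
    by (rule Zop_integrable[OF \<mu>], rule Zop_sq_integrable[OF \<mu>])
  have eq: "(norm (?Y x))\<^sup>2 = (norm (Zop x f))\<^sup>2 - 2 * (avg \<mu> f \<bullet> Zop x f) + (norm (avg \<mu> f))\<^sup>2" for x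
    unfolding power2_norm_eq_inner by (simp add: inner_diff_left inner_diff_right inner_commute)
  have int_inner: "integrable \<mu> (\<lambda>x. h \<bullet> Zop x f)" for h
    by (intro integrable_inner_right) (simp add: int)
  have "sqint ?Y" unfolding sqint_def eq using int int_inner by simp
  moreover have "(LINT x|\<mu>. h \<bullet> ?Y x) = 0" for h
    using int_inner \<mu>.prob_space by (simp add: inner_diff_right inner_avg[OF \<mu>])
  ultimately have "(\<integral>\<^sup>+\<omega>. ennreal ((norm ((1 / real n) *\<^sub>R (\<Sum>a<n. ?Y (X a \<omega>))))\<^sup>2) \<partial>M)
    \<le> ennreal ((LINT x|\<mu>. (norm (?Y x))\<^sup>2) / n)" by (rule mean_square[OF _ _ n])
  also have "(LINT x|\<mu>. (norm (?Y x))\<^sup>2) = (LINT x|\<mu>. (norm (Zop x f))\<^sup>2) - (norm (avg \<mu> f))\<^sup>2"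
    unfolding eq using int int_inner
    using \<mu>.prob_space by (simp add: inner_avg[OF \<mu>, symmetric] power2_norm_eq_inner)
  also have "ennreal (((LINT x|\<mu>. (norm (Zop x f))\<^sup>2) - (norm (avg \<mu> f))\<^sup>2) / n)
      \<le> ennreal ((1 / n) * (LINT x|\<mu>. (norm (Zop x f))\<^sup>2))"
    by (intro ennreal_leI) (simp add: divide_right_mono)
  also have "\<dots> = ennreal (1 / n) * (\<integral>\<^sup>+x. ennreal ((norm (Zop x f))\<^sup>2) \<partial>\<mu>)"
    using int by (subst ennreal_mult) (auto simp: nn_integral_eq_integral)
  also have "(\<lambda>\<omega>. (1 / real n) *\<^sub>R (\<Sum>a<n. ?Y (X a \<omega>))) = (\<lambda>\<omega>. emp n \<omega> f - avg \<mu> f)"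
    unfolding emp_def avg_emp[OF n] using n
    by (simp add: sum_subtractf scaleR_diff_right sum_constant_scaleR)
  finally show ?thesis by (simp only:)
qed

definition enum :: "'h set \<Rightarrow> nat \<Rightarrow> 'h" where
  "enum \<Phi> m = (if m \<in> to_nat_on \<Phi> ` \<Phi> then from_nat_into \<Phi> m else 0)"

lemma enum_sum_le:
  assumes "countable \<Phi>" "finite F" "F \<subseteq> \<Phi>"
  shows "(\<Sum>\<phi>\<in>F. (a \<phi> :: ennreal)) \<le> (\<Sum>m. a (enum \<Phi> m))"
proof -
  have inj: "inj_on (to_nat_on \<Phi>) F" using inj_on_to_nat_on[OF assms(1)] assms(3) by (rule inj_on_subset)
  have "(\<Sum>\<phi>\<in>F. a \<phi>) = (\<Sum>\<phi>\<in>F. a (enum \<Phi> (to_nat_on \<Phi> \<phi>)))"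
    by (rule sum.cong) (use assms in \<open>auto simp: enum_def\<close>)
  also have "\<dots> = (\<Sum>m\<in>to_nat_on \<Phi> ` F. a (enum \<Phi> m))" by (simp add: sum.reindex[OF inj])
  also have "\<dots> \<le> (\<Sum>m. a (enum \<Phi> m))"
    using assms(2) by (intro sum_le_suminf) auto
  finally show ?thesis .
qed

text \<open>Partial sums of the enumeration are sums over finite orthonormal sets, the form in which
  Hilbert--Schmidt bounds are available.\<close>

lemma enum_orthonormal_sum:
  assumes \<Phi>: "countable \<Phi>" "orthonormal \<Phi>" and a: "a 0 = 0"
  shows "\<exists>F. finite F \<and> orthonormal F \<and> (\<Sum>m<N. (a (enum \<Phi> m) :: real)) = (\<Sum>\<phi>\<in>F. a \<phi>)"
proof -
  let ?I = "{..<N} \<inter> to_nat_on \<Phi> ` \<Phi>"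
  have inj: "inj_on (from_nat_into \<Phi>) ?I"
    by (rule inj_onI) (use \<Phi> in auto)
  have "(\<Sum>m<N. a (enum \<Phi> m)) = (\<Sum>m\<in>?I. a (from_nat_into \<Phi> m))"
    by (rule sum.mono_neutral_cong_right) (auto simp: enum_def a)
  also have "\<dots> = (\<Sum>\<phi>\<in>from_nat_into \<Phi> ` ?I. a \<phi>)" by (simp add: sum.reindex[OF inj])
  finally show ?thesis
    using \<Phi> by (intro exI[of _ "from_nat_into \<Phi> ` ?I"] conjI orthonormal_subset[OF \<Phi>(2)]) auto
qed

text \<open>Tonelli moves the series out of the expectation, \<open>mean_square_op\<close> bounds
  each term, and Tonelli moves the series back under the integral, where \<open>HS_Zop\<close>
  bounds it pointwise.\<close>

lemma mean_square_HS:
  assumes n: "0 < n" and \<Phi>: "orthonormal \<Phi>"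
  shows "(\<integral>\<^sup>+\<omega>. (\<Sum>m. ennreal ((norm (emp n \<omega> (enum \<Phi> m) - avg \<mu> (enum \<Phi> m)))\<^sup>2)) \<partial>M) \<le> ennreal (chi_k\<^sup>2 / n)"
proof -
  have c: "countable \<Phi>" by (rule orthonormal_countable[OF \<Phi>])
  have [measurable]: "(\<lambda>\<omega>. emp n \<omega> f) \<in> borel_measurable M" for f
    unfolding emp_def avg_emp[OF n] by measurable
  have "(\<integral>\<^sup>+\<omega>. (\<Sum>m. ennreal ((norm (emp n \<omega> (enum \<Phi> m) - avg \<mu> (enum \<Phi> m)))\<^sup>2)) \<partial>M)
      = (\<Sum>m. \<integral>\<^sup>+\<omega>. ennreal ((norm (emp n \<omega> (enum \<Phi> m) - avg \<mu> (enum \<Phi> m)))\<^sup>2) \<partial>M)"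
    by (rule nn_integral_suminf) measurable
  also have "\<dots> \<le> (\<Sum>m. ennreal (1 / n) * (\<integral>\<^sup>+x. ennreal ((norm (Zop x (enum \<Phi> m)))\<^sup>2) \<partial>\<mu>))"
    by (intro suminf_le mean_square_op n) auto
  also have "\<dots> = ennreal (1 / n) * (\<integral>\<^sup>+x. (\<Sum>m. ennreal ((norm (Zop x (enum \<Phi> m)))\<^sup>2)) \<partial>\<mu>)"
    by (subst nn_integral_suminf) (auto simp: measurable_\<mu>)
  also have "\<dots> \<le> ennreal (1 / n) * (\<integral>\<^sup>+x. ennreal (chi_k\<^sup>2) \<partial>\<mu>)"
  proof (intro mult_left_mono nn_integral_mono suminf_le_const)
    fix x N
    obtain F where F: "finite F" "orthonormal F"
      "(\<Sum>m<N. (norm (Zop x (enum \<Phi> m)))\<^sup>2) = (\<Sum>\<phi>\<in>F. (norm (Zop x \<phi>))\<^sup>2)"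
      using enum_orthonormal_sum[OF c \<Phi>, of "\<lambda>\<phi>. (norm (Zop x \<phi>))\<^sup>2" N] by auto
    then show "(\<Sum>m<N. ennreal ((norm (Zop x (enum \<Phi> m)))\<^sup>2)) \<le> ennreal (chi_k\<^sup>2)"
      using HS_Zop[OF F(1,2), of x] by (simp add: ennreal_leI)
  qed auto
  also have "\<dots> = ennreal (chi_k\<^sup>2 / n)"
    by (simp add: \<mu>.emeasure_space_1[simplified] ennreal_mult[symmetric])
  finally show ?thesis .
qed

text \<open>Markov's inequality for the sum \<open>W\<close> of the squared score average and the
  squared Hilbert--Schmidt distance gives one exceptional event for both. The null set of samples
  leaving \<open>P\<close> is added to it.\<close>

lemma stochastic_control:
  assumes \<Phi>: "orthonormal \<Phi>" and \<delta>: "0 < \<delta>"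
  shows "\<exists>K>0. \<forall>n\<ge>1. \<exists>E\<in>sets M. measure M E < \<delta> \<and> (\<forall>\<omega>\<in>space M - E. (\<forall>a. X a \<omega> \<in> P) \<and>
    norm ((1 / real n) *\<^sub>R (\<Sum>a<n. score (X a \<omega>))) \<le> K / sqrt n \<and>
    (\<forall>F. finite F \<longrightarrow> F \<subseteq> \<Phi> \<longrightarrow> (\<Sum>\<phi>\<in>F. (norm (emp n \<omega> \<phi> - avg \<mu> \<phi>))\<^sup>2) \<le> (K / sqrt n)\<^sup>2))"
proof -
  define V where "V = (LINT x|\<mu>. (norm (score x))\<^sup>2) + chi_k\<^sup>2"
  have V0: "0 \<le> (LINT x|\<mu>. (norm (score x))\<^sup>2)" by (intro Bochner_Integration.integral_nonneg) simp
  have V: "0 \<le> V" using V0 by (simp add: V_def)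
  \<comment> \<open>With this choice Markov gives the probability V/K^2 = \<delta> V/(V + 1), and
    the added 1 makes it strictly smaller than \<delta>.\<close>
  define K where "K = sqrt ((V + 1) / \<delta>)"
  have K: "0 < K" "K\<^sup>2 = (V + 1) / \<delta>" using V \<delta> by (auto simp: K_def)
  have "\<exists>E\<in>sets M. measure M E < \<delta> \<and> (\<forall>\<omega>\<in>space M - E. (\<forall>a. X a \<omega> \<in> P) \<and>
    norm ((1 / real n) *\<^sub>R (\<Sum>a<n. score (X a \<omega>))) \<le> K / sqrt n \<and>
    (\<forall>F. finite F \<longrightarrow> F \<subseteq> \<Phi> \<longrightarrow> (\<Sum>\<phi>\<in>F. (norm (emp n \<omega> \<phi> - avg \<mu> \<phi>))\<^sup>2) \<le> (K / sqrt n)\<^sup>2))"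
    if n: "1 \<le> n" for n
  proof -
    have n0: "0 < n" using n by simp
    have [measurable]: "score \<in> borel_measurable borel" using sqint_score by (simp add: sqint_def)
    have [measurable]: "(\<lambda>\<omega>. emp n \<omega> f) \<in> borel_measurable M" for f
      unfolding emp_def avg_emp[OF n0] by measurable
    define W where "W \<omega> = ennreal ((norm ((1 / real n) *\<^sub>R (\<Sum>a<n. score (X a \<omega>))))\<^sup>2)
       + (\<Sum>m. ennreal ((norm (emp n \<omega> (enum \<Phi> m) - avg \<mu> (enum \<Phi> m)))\<^sup>2))" for \<omega>
    have W[measurable]: "W \<in> borel_measurable M" unfolding W_def[abs_def] by measurable
    have "(\<integral>\<^sup>+\<omega>. W \<omega> \<partial>M) = (\<integral>\<^sup>+\<omega>. ennreal ((norm ((1 / real n) *\<^sub>R (\<Sum>a<n. score (X a \<omega>))))\<^sup>2) \<partial>M)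
        + (\<integral>\<^sup>+\<omega>. (\<Sum>m. ennreal ((norm (emp n \<omega> (enum \<Phi> m) - avg \<mu> (enum \<Phi> m)))\<^sup>2)) \<partial>M)"
      unfolding W_def by (rule nn_integral_add) measurable
    also have "\<dots> \<le> ennreal ((LINT x|\<mu>. (norm (score x))\<^sup>2) / n) + ennreal (chi_k\<^sup>2 / n)"
      by (intro add_mono mean_square mean_square_HS n0 \<Phi> sqint_score score_centred)
    also have "\<dots> = ennreal (V / n)"
      using V0 by (subst ennreal_plus[symmetric]) (auto simp: V_def add_divide_distrib)
    finally have EW: "(\<integral>\<^sup>+\<omega>. W \<omega> \<partial>M) \<le> ennreal (V / n)" .
    \<comment> \<open>The event that W is at least K^2/n, scaled to the form of Markov's inequality
      for extended reals.\<close>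
    define A where "A = {\<omega>\<in>space M. 1 \<le> ennreal (n / K\<^sup>2) * W \<omega>}"
    have A: "A \<in> sets M" unfolding A_def by measurable
    have "emeasure M A \<le> ennreal (n / K\<^sup>2) * (\<integral>\<^sup>+\<omega>. W \<omega> * indicator (space M) \<omega> \<partial>M)"
      using nn_integral_Markov_inequality[of W "space M" M "ennreal (n / K\<^sup>2)"] by (simp add: A_def)
    also have "\<dots> \<le> ennreal (n / K\<^sup>2) * ennreal (V / n)"
      using EW by (intro mult_left_mono) (auto simp: nn_integral_restrict_space[symmetric] cong: nn_integral_cong_simp)
    also have "\<dots> = ennreal (V / K\<^sup>2)" using n0 V by (subst ennreal_mult[symmetric]) auto
    finally have "measure M A \<le> V / K\<^sup>2"
      using V by (simp add: M.emeasure_eq_measure ennreal_le_iff)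
    also have "\<dots> < \<delta>" using V \<delta> by (simp add: K(2) field_simps)
    finally have mA: "measure M A < \<delta>" .
    obtain N where N: "N \<in> null_sets M" "{\<omega>\<in>space M. \<not> (\<forall>a. X a \<omega> \<in> P)} \<subseteq> N"
      using AE_X_P unfolding eventually_ae_filter by auto
    have "(\<forall>a. X a \<omega> \<in> P) \<and> norm ((1 / real n) *\<^sub>R (\<Sum>a<n. score (X a \<omega>))) \<le> K / sqrt n \<and>
      (\<forall>F. finite F \<longrightarrow> F \<subseteq> \<Phi> \<longrightarrow> (\<Sum>\<phi>\<in>F. (norm (emp n \<omega> \<phi> - avg \<mu> \<phi>))\<^sup>2) \<le> (K / sqrt n)\<^sup>2)"
      if \<omega>: "\<omega> \<in> space M - (A \<union> N)" for \<omega>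
    proof (intro conjI allI impI)
      show "X a \<omega> \<in> P" for a using N(2) \<omega> by blast
      have WK: "W \<omega> \<le> ennreal ((K / sqrt n)\<^sup>2)"
      proof -
        have "ennreal (n / K\<^sup>2) * W \<omega> \<le> 1" using \<omega> by (auto simp: A_def not_le)
        then have "ennreal (K\<^sup>2 / n) * (ennreal (n / K\<^sup>2) * W \<omega>) \<le> ennreal (K\<^sup>2 / n) * 1"
          by (rule mult_left_mono) simp
        moreover have "ennreal (K\<^sup>2 / n) * ennreal (n / K\<^sup>2) = 1"
          using n0 K(1) by (subst ennreal_mult[symmetric]) auto
        ultimately show ?thesis by (simp add: mult.assoc[symmetric] power_divide)
      qed
      have summands: "a \<le> c" "b \<le> c" if "a + b \<le> c" for a b c :: ennreal
        by (rule order_trans[OF _ that], simp)+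
      have W1: "ennreal ((norm ((1 / real n) *\<^sub>R (\<Sum>a<n. score (X a \<omega>))))\<^sup>2) \<le> ennreal ((K / sqrt n)\<^sup>2)"
        and W2: "(\<Sum>m. ennreal ((norm (emp n \<omega> (enum \<Phi> m) - avg \<mu> (enum \<Phi> m)))\<^sup>2)) \<le> ennreal ((K / sqrt n)\<^sup>2)"
        using summands[OF WK[unfolded W_def]] by simp_all
      show "norm ((1 / real n) *\<^sub>R (\<Sum>a<n. score (X a \<omega>))) \<le> K / sqrt n"
        by (rule power2_le_imp_le) (use W1 K(1) in \<open>simp_all only: ennreal_le_iff zero_le_power2, simp\<close>)
      fix F assume F: "finite F" "F \<subseteq> \<Phi>"
      have "ennreal (\<Sum>\<phi>\<in>F. (norm (emp n \<omega> \<phi> - avg \<mu> \<phi>))\<^sup>2) = (\<Sum>\<phi>\<in>F. ennreal ((norm (emp n \<omega> \<phi> - avg \<mu> \<phi>))\<^sup>2))"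
        by simp
      also have "\<dots> \<le> ennreal ((K / sqrt n)\<^sup>2)"
        by (rule order_trans[OF enum_sum_le[OF orthonormal_countable[OF \<Phi>] F] W2])
      finally show "(\<Sum>\<phi>\<in>F. (norm (emp n \<omega> \<phi> - avg \<mu> \<phi>))\<^sup>2) \<le> (K / sqrt n)\<^sup>2"
        by (simp add: ennreal_le_iff)
    qed
    moreover have "measure M (A \<union> N) < \<delta>"
      using mA A N(1) by (simp add: measure_Un_null_set)
    ultimately show ?thesis using A N(1) by (intro bexI[of _ "A \<union> N"]) auto
  qed
  then show ?thesis using K(1) by blast
qed

end

section \<open>Spectral regularisation under perturbation of the operator\<close>

text \<open>What the functional calculus needs from an operator. The bound c on the quadratic form
  confines the eigenvalues to [0, c].\<close>

definition posdiag :: "real \<Rightarrow> ('h::{real_inner,banach} \<Rightarrow> 'h) \<Rightarrow> bool" where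
  "posdiag c A \<longleftrightarrow> bounded_linear A \<and> (\<forall>x y. x \<bullet> A y = A x \<bullet> y) \<and>
     (\<forall>x. 0 \<le> x \<bullet> A x \<and> x \<bullet> A x \<le> c * (norm x)\<^sup>2) \<and> (\<exists>\<Phi>. eigenbasis A \<Phi>)"

text \<open>The very basis that \<open>op_fun\<close> chooses, so that coefficient formulas refer to
  it.\<close>

definition basis_of :: "('h::real_inner \<Rightarrow> 'h) \<Rightarrow> 'h set" where
  "basis_of A = (SOME \<Phi>. eigenbasis A \<Phi>)"

definition le_on :: "real \<Rightarrow> (real \<Rightarrow> real) \<Rightarrow> real \<Rightarrow> bool" where
  "le_on c g B \<longleftrightarrow> (\<forall>\<alpha>\<in>{0..c}. \<bar>g \<alpha>\<bar> \<le> B)"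

lemma le_onI: "(\<And>\<alpha>. \<alpha> \<in> {0..c} \<Longrightarrow> \<bar>g \<alpha>\<bar> \<le> B) \<Longrightarrow> le_on c g B"
  by (simp add: le_on_def)

lemma le_onD: "le_on c g B \<Longrightarrow> \<alpha> \<in> {0..c} \<Longrightarrow> \<bar>g \<alpha>\<bar> \<le> B"
  by (simp add: le_on_def)

context
  fixes c :: real and A :: "'h::{real_inner,banach} \<Rightarrow> 'h"
  assumes A: "posdiag c A"
begin

lemma basis_of: "eigenbasis A (basis_of A)"
proof -
  have "\<exists>\<Phi>. eigenbasis A \<Phi>" using A by (simp add: posdiag_def)
  then show ?thesis unfolding basis_of_def by (rule someI_ex)
qed

lemma basis_of_orthonormal: "orthonormal (basis_of A)"
  by (rule eigenbasis_orthonormal[OF basis_of])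

lemma basis_of_dense: "closure (span (basis_of A)) = UNIV"
  by (rule eigenbasis_dense[OF basis_of])

lemma eigenvalue_range: "\<phi> \<in> basis_of A \<Longrightarrow> \<phi> \<bullet> A \<phi> \<in> {0..c}"
  using A basis_of_orthonormal unfolding posdiag_def orthonormal_def
  by (metis atLeastAtMost_iff mult.right_neutral one_power2)

lemma basis_inner_op: "\<phi> \<in> basis_of A \<Longrightarrow> \<phi> \<bullet> A f = (\<phi> \<bullet> A \<phi>) * (\<phi> \<bullet> f)"
  using eigenbasis_eigenvector[OF basis_of] A unfolding posdiag_def
  by (metis inner_scaleR_left)

lemma op_fun_inner:
  assumes "le_on c g B" "\<phi> \<in> basis_of A"
  shows "\<phi> \<bullet> op_fun g A f = g (\<phi> \<bullet> A \<phi>) * (\<phi> \<bullet> f)"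
  by (rule op_fun_coeff[where B = B]) (use A assms eigenvalue_range le_onD in \<open>auto simp: posdiag_def basis_of_def\<close>)

lemma norm_op_fun_le:
  assumes B: "le_on c g B" "0 \<le> B"
  shows "norm (op_fun g A f) \<le> B * norm f"
proof (rule norm_le_coeffs[OF basis_of_orthonormal basis_of_dense B(2)])
  fix \<phi> assume "\<phi> \<in> basis_of A"
  then show "\<bar>\<phi> \<bullet> op_fun g A f\<bar> \<le> B * \<bar>\<phi> \<bullet> f\<bar>"
    using le_onD[OF B(1) eigenvalue_range] by (simp add: op_fun_inner[OF B(1)] abs_mult mult_right_mono)
qed

lemma op_fun_bounded_linear:
  assumes B: "le_on c g B" "0 \<le> B"
  shows "bounded_linear (op_fun g A)"
proof (rule bounded_linear_intro)
  note coeff = op_fun_inner[OF B(1)] and eq = eq_by_coeffs[OF basis_of_orthonormal basis_of_dense]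
  show "op_fun g A (f + h) = op_fun g A f + op_fun g A h" for f h
    by (rule eq) (simp add: coeff inner_add_right distrib_left)
  show "op_fun g A (r *\<^sub>R f) = r *\<^sub>R op_fun g A f" for r f
    by (rule eq) (simp add: coeff)
  show "norm (op_fun g A f) \<le> norm f * B" for f
    using norm_op_fun_le[OF B] by (simp add: mult.commute)
qed

text \<open>The form is the sum of eigenvalues times squared coefficients; placing square roots on
  the coefficients gives bounds for the square root of the operator without constructing it.\<close>

lemma quadratic_le_coeffs:
  assumes B: "0 \<le> B" and le: "\<And>\<phi>. \<phi> \<in> basis_of A \<Longrightarrow> sqrt (\<phi> \<bullet> A \<phi>) * \<bar>\<phi> \<bullet> v\<bar> \<le> B * \<bar>\<phi> \<bullet> y\<bar>"
  shows "v \<bullet> A v \<le> B\<^sup>2 * (norm y)\<^sup>2"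
proof -
  have v: "((\<lambda>\<phi>. (\<phi> \<bullet> v) * (\<phi> \<bullet> A v)) has_sum v \<bullet> A v) (basis_of A)"
    and y: "((\<lambda>\<phi>. (\<phi> \<bullet> y) * (\<phi> \<bullet> y)) has_sum y \<bullet> y) (basis_of A)"
    using parseval[OF basis_of_orthonormal] basis_of_dense by auto
  have "(\<phi> \<bullet> v) * (\<phi> \<bullet> A v) \<le> B\<^sup>2 * ((\<phi> \<bullet> y) * (\<phi> \<bullet> y))" if \<phi>: "\<phi> \<in> basis_of A" for \<phi>
  proof -
    have nn: "0 \<le> \<phi> \<bullet> A \<phi>" using eigenvalue_range[OF \<phi>] by simp
    have "(sqrt (\<phi> \<bullet> A \<phi>) * \<bar>\<phi> \<bullet> v\<bar>)\<^sup>2 \<le> (B * \<bar>\<phi> \<bullet> y\<bar>)\<^sup>2"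
      by (rule power_mono[OF le[OF \<phi>]]) (simp add: nn)
    moreover have "(\<phi> \<bullet> v) * (\<phi> \<bullet> A v) = (sqrt (\<phi> \<bullet> A \<phi>) * \<bar>\<phi> \<bullet> v\<bar>)\<^sup>2"
      using nn by (simp add: basis_inner_op[OF \<phi>, of v] power_mult_distrib) (simp add: power2_eq_square)
    ultimately show ?thesis by (simp only: power_mult_distrib power2_abs power2_eq_square[of "\<phi> \<bullet> y", symmetric])
  qed
  then have "v \<bullet> A v \<le> B\<^sup>2 * (y \<bullet> y)"
    by (rule has_sum_mono[OF v has_sum_cmult_right[OF y]])
  then show ?thesis by (simp add: power2_norm_eq_inner)
qed

lemma quadratic_op_fun_le:
  assumes bdd: "le_on c g B'" and B: "le_on c (\<lambda>\<alpha>. sqrt \<alpha> * g \<alpha>) B" "0 \<le> B"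
  shows "op_fun g A f \<bullet> A (op_fun g A f) \<le> B\<^sup>2 * (norm f)\<^sup>2"
proof (rule quadratic_le_coeffs[OF B(2)])
  fix \<phi> assume \<phi>: "\<phi> \<in> basis_of A"
  show "sqrt (\<phi> \<bullet> A \<phi>) * \<bar>\<phi> \<bullet> op_fun g A f\<bar> \<le> B * \<bar>\<phi> \<bullet> f\<bar>"
    using mult_right_mono[OF le_onD[OF B(1) eigenvalue_range[OF \<phi>]], of "\<bar>\<phi> \<bullet> f\<bar>"] eigenvalue_range[OF \<phi>]
    by (simp add: op_fun_inner[OF bdd \<phi>] abs_mult mult.assoc)
qed

text \<open>Positivity of the form at u - v.\<close>

lemma quadratic_add_le: "(u + v) \<bullet> A (u + v) \<le> 2 * (u \<bullet> A u) + 2 * (v \<bullet> A v)"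
proof -
  have lin: "linear A" and sym: "u \<bullet> A v = v \<bullet> A u" and pos: "0 \<le> (u - v) \<bullet> A (u - v)"
    using A bounded_linear.linear by (auto simp: posdiag_def inner_commute)
  show ?thesis using pos sym
    by (simp add: linear_add[OF lin] linear_diff[OF lin] inner_add_left inner_add_right
        inner_diff_left inner_diff_right)
qed

lemma quadratic_minus: "(- u) \<bullet> A (- u) = u \<bullet> A u"
proof -
  have "linear A" using A bounded_linear.linear by (auto simp: posdiag_def)
  then show ?thesis by (simp add: linear_neg)
qed

end

section \<open>Comparison of the functional calculi of two close operators\<close>

context
  fixes c S :: real and C T :: "'h::{real_inner,banach} \<Rightarrow> 'h"
  assumes C: "posdiag c C" and T: "posdiag c T" and S0: "0 \<le> S"
    and S: "\<And>F. finite F \<Longrightarrow> F \<subseteq> basis_of C \<Longrightarrow> (\<Sum>\<phi>\<in>F. (norm (T \<phi> - C \<phi>))\<^sup>2) \<le> S\<^sup>2"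
begin

lemma basis_of_expansion: "((\<lambda>\<phi>. (\<phi> \<bullet> x) *\<^sub>R \<phi>) has_sum x) (basis_of C)"
  by (rule orthonormal_expansion[OF basis_of_orthonormal[OF C]]) (simp add: basis_of_dense[OF C])

lemma norm_diff_le: "norm (T v - C v) \<le> S * norm v"
  by (rule norm_le_HS[OF _ basis_of_expansion basis_of_orthonormal[OF C] S0 S])
    (use C T in \<open>auto simp: posdiag_def intro: bounded_linear_sub\<close>)

text \<open>The Fisher distance is a form of \<open>C\<close>, while the calculus lives on
  \<open>T\<close>; the last term is the price of the exchange.\<close>

lemma quadratic_transfer: "v \<bullet> C v \<le> v \<bullet> T v + S * (norm v)\<^sup>2"
proof -
  have "v \<bullet> C v - v \<bullet> T v = v \<bullet> (C v - T v)" by (simp add: inner_diff_right)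
  also have "\<dots> \<le> norm v * norm (C v - T v)" by (rule norm_cauchy_schwarz)
  also have "\<dots> \<le> norm v * (S * norm v)"
    using norm_diff_le[of v] by (intro mult_left_mono) (auto simp: norm_minus_commute)
  finally show ?thesis by (simp add: power2_eq_square algebra_simps)
qed

text \<open>In the two eigenbases the matrix of \<open>F C - F T\<close> is the matrix of \<open>C - T\<close> multiplied
  entrywise by the difference quotients of \<open>F\<close>.\<close>

lemma op_fun_perturbation:
  assumes B: "le_on c F B" "0 \<le> B" and L: "0 \<le> L"
    and lip: "\<And>\<alpha> \<alpha>'. \<alpha> \<in> {0..c} \<Longrightarrow> \<alpha>' \<in> {0..c} \<Longrightarrow> \<bar>F \<alpha> - F \<alpha>'\<bar> \<le> L * \<bar>\<alpha> - \<alpha>'\<bar>"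
  shows "norm (op_fun F C h - op_fun F T h) \<le> L * S * norm h"
proof -
  define \<Delta> where "\<Delta> x = op_fun F C x - op_fun F T x" for x
  have lin: "bounded_linear \<Delta>" unfolding \<Delta>_def
    by (intro bounded_linear_sub op_fun_bounded_linear[OF C B] op_fun_bounded_linear[OF T B])
  \<comment> \<open>Columns suffice: a squared Hilbert--Schmidt norm is the sum of the squared norms
    of the images of the eigenvectors of \<open>C\<close>.\<close>
  have le: "norm (\<Delta> \<phi>) \<le> L * norm (T \<phi> - C \<phi>)" if \<phi>: "\<phi> \<in> basis_of C" for \<phi>
  proof (rule norm_le_coeffs[OF basis_of_orthonormal[OF T] basis_of_dense[OF T] L])
    fix \<psi> assume \<psi>: "\<psi> \<in> basis_of T"
    let ?a = "\<phi> \<bullet> C \<phi>" and ?b = "\<psi> \<bullet> T \<psi>"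
    have "op_fun F C \<phi> = F ?a *\<^sub>R \<phi>"
    proof (rule eq_by_coeffs[OF basis_of_orthonormal[OF C] basis_of_dense[OF C]])
      fix \<phi>' assume "\<phi>' \<in> basis_of C"
      then show "\<phi>' \<bullet> op_fun F C \<phi> = \<phi>' \<bullet> F ?a *\<^sub>R \<phi>"
        using \<phi> by (simp add: op_fun_inner[OF C B(1)] orthonormal_inner[OF basis_of_orthonormal[OF C]])
    qed
    then have "\<psi> \<bullet> \<Delta> \<phi> = (F ?a - F ?b) * (\<psi> \<bullet> \<phi>)"
      by (simp add: \<Delta>_def inner_diff_right op_fun_inner[OF T B(1) \<psi>] left_diff_distrib)
    moreover have "\<psi> \<bullet> (T \<phi> - C \<phi>) = (?b - ?a) * (\<psi> \<bullet> \<phi>)"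
    proof -
      have "C \<phi> = ?a *\<^sub>R \<phi>" by (rule eigenbasis_eigenvector[OF basis_of[OF C] \<phi>])
      then have "\<psi> \<bullet> C \<phi> = ?a * (\<psi> \<bullet> \<phi>)" by (metis inner_scaleR_right)
      then show ?thesis by (simp add: inner_diff_right basis_inner_op[OF T \<psi>, of \<phi>] left_diff_distrib)
    qed
    ultimately show "\<bar>\<psi> \<bullet> \<Delta> \<phi>\<bar> \<le> L * \<bar>\<psi> \<bullet> (T \<phi> - C \<phi>)\<bar>"
      using mult_right_mono[OF lip[OF eigenvalue_range[OF C \<phi>] eigenvalue_range[OF T \<psi>]], of "\<bar>\<psi> \<bullet> \<phi>\<bar>"]
      by (simp add: abs_mult mult.assoc abs_minus_commute)
  qed
  have "norm (\<Delta> h) \<le> (L * S) * norm h"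
  proof (rule norm_le_HS[OF lin basis_of_expansion basis_of_orthonormal[OF C]])
    fix G assume G: "finite G" "G \<subseteq> basis_of C"
    have "(\<Sum>\<phi>\<in>G. (norm (\<Delta> \<phi>))\<^sup>2) \<le> (\<Sum>\<phi>\<in>G. L\<^sup>2 * (norm (T \<phi> - C \<phi>))\<^sup>2)"
    proof (rule sum_mono)
      fix \<phi> assume "\<phi> \<in> G"
      then have "(norm (\<Delta> \<phi>))\<^sup>2 \<le> (L * norm (T \<phi> - C \<phi>))\<^sup>2" using G by (intro power_mono le) auto
      then show "(norm (\<Delta> \<phi>))\<^sup>2 \<le> L\<^sup>2 * (norm (T \<phi> - C \<phi>))\<^sup>2" by (simp add: power_mult_distrib)
    qed
    also have "\<dots> \<le> L\<^sup>2 * S\<^sup>2" using S[OF G] by (simp add: sum_distrib_left[symmetric] mult_left_mono)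
    finally show "(\<Sum>\<phi>\<in>G. (norm (\<Delta> \<phi>))\<^sup>2) \<le> (L * S)\<^sup>2" by (simp add: power_mult_distrib)
  qed (use L S0 in simp)
  then show ?thesis by (simp add: \<Delta>_def)
qed

end

text \<open>The derivative is b (z + \<lambda>)^b / (z + \<lambda>): the numerator is at most (c +
  1)^b because \<lambda> \<le> 1, and the denominator at least \<lambda>. Exponents below 1 are
  included.\<close>

lemma shifted_power_lipschitz:
  fixes b lam c :: real
  assumes b: "0 \<le> b" and lam: "0 < lam" "lam \<le> 1" and xy: "x \<in> {0..c}" "y \<in> {0..c}"
  shows "\<bar>(x + lam) powr b - (y + lam) powr b\<bar> \<le> b * (c + 1) powr b / lam * \<bar>x - y\<bar>"
proof -
  have main: "\<bar>(x + lam) powr b - (y + lam) powr b\<bar> \<le> b * (c + 1) powr b / lam * \<bar>x - y\<bar>"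
    if xy: "x < y" "0 \<le> x" "y \<le> c" for x y
  proof -
    have "((\<lambda>z. (z + lam) powr b) has_real_derivative b * (z + lam) powr (b - 1)) (at z)" if "x \<le> z" for z
      using that xy lam by (auto intro!: derivative_eq_intros)
    then obtain z where z: "x < z" "z < y" "(y + lam) powr b - (x + lam) powr b = (y - x) * (b * (z + lam) powr (b - 1))"
      using MVT2[OF xy(1), of "\<lambda>z. (z + lam) powr b" "\<lambda>z. b * (z + lam) powr (b - 1)"] by auto
    have "(z + lam) powr (b - 1) = (z + lam) powr b / (z + lam)" using z xy lam by (simp add: powr_diff)
    also have "\<dots> \<le> (c + 1) powr b / lam"
      using z xy lam b by (intro frac_le powr_mono2) auto
    finally have "(y - x) * (b * (z + lam) powr (b - 1)) \<le> (y - x) * (b * ((c + 1) powr b / lam))"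
      using xy b by (intro mult_left_mono) auto
    moreover have "0 \<le> (y - x) * (b * (z + lam) powr (b - 1))" using xy b by simp
    ultimately show ?thesis using z(3) xy(1) by (simp add: abs_minus_commute mult.commute)
  qed
  show ?thesis
    using main[of x y] main[of y x] xy by (cases x y rule: linorder_cases) (auto simp: abs_minus_commute)
qed

text \<open>The sum is at most twice the larger of \<alpha> and \<lambda>.\<close>

lemma shifted_power_le:
  fixes \<alpha> b lam :: real
  assumes "0 \<le> \<alpha>" "0 < lam" "0 \<le> b"
  shows "(\<alpha> + lam) powr b \<le> 2 powr b * (\<alpha> powr b + lam powr b)"
proof (cases "\<alpha> \<le> lam")
  case True
  then have "(\<alpha> + lam) powr b \<le> (2 * lam) powr b" using assms by (intro powr_mono2) auto
  also have "\<dots> = 2 powr b * lam powr b" using assms by (simp add: powr_mult)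
  also have "\<dots> \<le> 2 powr b * (\<alpha> powr b + lam powr b)" by (intro mult_left_mono) auto
  finally show ?thesis .
next
  case False
  then have "(\<alpha> + lam) powr b \<le> (2 * \<alpha>) powr b" using assms by (intro powr_mono2) auto
  also have "\<dots> = 2 powr b * \<alpha> powr b" using assms by (simp add: powr_mult)
  also have "\<dots> \<le> 2 powr b * (\<alpha> powr b + lam powr b)" by (intro mult_left_mono) auto
  finally show ?thesis .
qed

text \<open>The quotient of \<alpha>^\<beta> by (\<alpha> + \<lambda>)^b is bounded uniformly in
  \<lambda>, and applying this function of \<open>C\<close> to the old source element gives the new
  one.\<close>

lemma op_powr_range_shifted:
  assumes C: "posdiag c C" and b: "0 \<le> b" "b \<le> \<beta>" and f0: "f0 \<in> range (op_powr C \<beta>)"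
  shows "\<exists>R\<ge>0. \<forall>lam. 0 < lam \<longrightarrow> lam \<le> 1 \<longrightarrow> (\<exists>h. norm h \<le> R \<and> f0 = op_fun (\<lambda>a. (a + lam) powr b) C h)"
proof -
  obtain h where h: "f0 = op_powr C \<beta> h" using f0 by blast
  have "\<exists>h'. norm h' \<le> (c + 1) powr (\<beta> - b) * norm h \<and> f0 = op_fun (\<lambda>a. (a + lam) powr b) C h'"
    if lam: "0 < lam" "lam \<le> 1" for lam
  proof -
    \<comment> \<open>For \<beta> = 0 the power is the identity by convention, also at the
      eigenvalue 0; then b = 0 as well.\<close>
    define G where "G a = (if \<beta> = 0 then 1 else a powr \<beta>) / (a + lam) powr b" for a
    have Gb: "le_on c G ((c + 1) powr (\<beta> - b))"
    proof (rule le_onI)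
    fix a assume a: "a \<in> {0..c}"
    show "\<bar>G a\<bar> \<le> (c + 1) powr (\<beta> - b)"
    proof (cases "\<beta> = 0")
      case True
      then show ?thesis using a b lam by (simp add: G_def)
    next
      case False
      have "a powr \<beta> \<le> a powr (\<beta> - b) * (a + lam) powr b"
      proof (cases "a = 0")
        case False
        then have "a powr \<beta> = a powr (\<beta> - b) * a powr b" using a by (simp add: powr_add[symmetric])
        also have "\<dots> \<le> a powr (\<beta> - b) * (a + lam) powr b" using a b lam by (intro mult_left_mono powr_mono2) auto
        finally show ?thesis .
      qed simp
      also have "\<dots> \<le> (c + 1) powr (\<beta> - b) * (a + lam) powr b"
        using a b by (intro mult_right_mono powr_mono2) auto
      finally show ?thesis using False a lam by (simp add: G_def pos_divide_le_eq)
    qed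
    qed
    have Fb: "le_on c (\<lambda>a. (a + lam) powr b) ((c + 1) powr b)"
      using b lam by (auto intro!: le_onI powr_mono2)
    have Pb: "le_on c (\<lambda>a. a powr \<beta>) (c powr \<beta>)"
      using b by (auto intro!: le_onI powr_mono2)
    have eq: "f0 = op_fun (\<lambda>a. (a + lam) powr b) C (op_fun G C h)"
    proof (rule eq_by_coeffs[OF basis_of_orthonormal[OF C] basis_of_dense[OF C]])
      fix \<phi> assume \<phi>: "\<phi> \<in> basis_of C"
      let ?a = "\<phi> \<bullet> C \<phi>"
      have a: "?a \<in> {0..c}" by (rule eigenvalue_range[OF C \<phi>])
      have "\<phi> \<bullet> f0 = (if \<beta> = 0 then 1 else ?a powr \<beta>) * (\<phi> \<bullet> h)"
        using op_fun_inner[OF C Pb \<phi>, of h] h by (simp add: op_powr_def)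
      also have "\<dots> = (?a + lam) powr b * (G ?a * (\<phi> \<bullet> h))"
        using a lam by (simp add: G_def)
      finally show "\<phi> \<bullet> f0 = \<phi> \<bullet> op_fun (\<lambda>a. (a + lam) powr b) C (op_fun G C h)"
        by (simp only: op_fun_inner[OF C Fb \<phi>] op_fun_inner[OF C Gb \<phi>])
    qed
    show ?thesis using eq norm_op_fun_le[OF C Gb powr_ge_zero] by blast
  qed
  then show ?thesis by (intro exI[of _ "(c + 1) powr (\<beta> - b) * norm h"]) simp
qed

text \<open>Interface between probability and analysis: e bounds both the noise and the
  Hilbert--Schmidt distance, and will be a multiple of n^(-1/2).\<close>

definition close_data ::
    "real \<Rightarrow> ('h::{real_inner,banach} \<Rightarrow> 'h) \<Rightarrow> 'h \<Rightarrow> real \<Rightarrow> ('h \<Rightarrow> 'h) \<Rightarrow> 'h \<Rightarrow> bool" where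
  "close_data c C f0 e T \<xi> \<longleftrightarrow> posdiag c T \<and> norm (\<xi> + T f0) \<le> e \<and>
     (\<forall>F. finite F \<longrightarrow> F \<subseteq> basis_of C \<longrightarrow> (\<Sum>\<phi>\<in>F. (norm (T \<phi> - C \<phi>))\<^sup>2) \<le> e\<^sup>2)"

locale spectral_regularizer =
  fixes c :: real and g :: "real \<Rightarrow> real \<Rightarrow> real" and Ag Bg Cg \<eta>0 :: real and \<gamma> :: "real \<Rightarrow> real"
  assumes pos: "0 < Ag" "0 < Bg" "0 < Cg" "0 < \<eta>0" "\<And>\<eta>. \<eta> \<in> {0<..\<eta>0} \<Longrightarrow> 0 < \<gamma> \<eta>"
    and gA: "\<And>lam \<alpha>. 0 < lam \<Longrightarrow> \<alpha> \<in> {0..c} \<Longrightarrow> \<bar>\<alpha> * g lam \<alpha>\<bar> \<le> Ag"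
    and gB: "\<And>lam \<alpha>. 0 < lam \<Longrightarrow> \<alpha> \<in> {0..c} \<Longrightarrow> \<bar>g lam \<alpha>\<bar> \<le> Bg / lam"
    and gC: "\<And>lam \<alpha>. 0 < lam \<Longrightarrow> \<alpha> \<in> {0..c} \<Longrightarrow> \<bar>1 - \<alpha> * g lam \<alpha>\<bar> \<le> Cg"
    and gD: "\<And>lam \<alpha> \<eta>. 0 < lam \<Longrightarrow> \<alpha> \<in> {0..c} \<Longrightarrow> \<eta> \<in> {0<..\<eta>0} \<Longrightarrow>
      \<bar>1 - \<alpha> * g lam \<alpha>\<bar> * \<alpha> powr \<eta> \<le> \<gamma> \<eta> * lam powr \<eta>"
begin

definition resid :: "real \<Rightarrow> real \<Rightarrow> real" where "resid lam \<alpha> = 1 - \<alpha> * g lam \<alpha>"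

lemma g_le_on: "0 < lam \<Longrightarrow> le_on c (g lam) (Bg / lam)"
  by (rule le_onI) (rule gB)

lemma resid_le_on: "0 < lam \<Longrightarrow> le_on c (resid lam) Cg"
  unfolding resid_def by (rule le_onI) (rule gC)

lemmas resid_bound = le_onD[OF resid_le_on]

lemma error_decomposition:
  assumes T: "posdiag c T" and lam: "0 < lam"
  shows "- op_fun (g lam) T \<xi> - f0 = - (op_fun (g lam) T (\<xi> + T f0) + op_fun (resid lam) T f0)"
proof (rule eq_by_coeffs[OF basis_of_orthonormal[OF T] basis_of_dense[OF T]])
  fix \<phi> assume \<phi>: "\<phi> \<in> basis_of T"
  note G = op_fun_inner[OF T g_le_on[OF lam] \<phi>] and R = op_fun_inner[OF T resid_le_on[OF lam] \<phi>]
  show "\<phi> \<bullet> (- op_fun (g lam) T \<xi> - f0) = \<phi> \<bullet> (- (op_fun (g lam) T (\<xi> + T f0) + op_fun (resid lam) T f0))"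
    by (simp add: G R inner_diff_right inner_add_right basis_inner_op[OF T \<phi>, of f0])
      (simp add: resid_def algebra_simps)
qed

lemma noise_norm:
  assumes T: "posdiag c T" and lam: "0 < lam"
  shows "norm (op_fun (g lam) T e) \<le> Bg / lam * norm e"
  by (rule norm_op_fun_le[OF T g_le_on[OF lam]]) (use pos lam in auto)

text \<open>The function sqrt \<alpha> |g| is the geometric mean of |\<alpha> g| and |g|, bounded by
  (a) and (b). In the quadratic form this gains a factor \<lambda> over
  \<open>noise_norm\<close>.\<close>

lemma noise_quadratic:
  assumes T: "posdiag c T" and lam: "0 < lam"
  shows "op_fun (g lam) T e \<bullet> T (op_fun (g lam) T e) \<le> Ag * Bg / lam * (norm e)\<^sup>2"
proof -
  have "op_fun (g lam) T e \<bullet> T (op_fun (g lam) T e) \<le> (sqrt (Ag * (Bg / lam)))\<^sup>2 * (norm e)\<^sup>2"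
  proof (rule quadratic_op_fun_le[OF T g_le_on[OF lam]], rule le_onI)
    fix \<alpha> assume \<alpha>: "\<alpha> \<in> {0..c}"
    have "(sqrt \<alpha> * \<bar>g lam \<alpha>\<bar>)\<^sup>2 = \<bar>\<alpha> * g lam \<alpha>\<bar> * \<bar>g lam \<alpha>\<bar>"
      using \<alpha> by (simp add: power_mult_distrib abs_mult) (simp add: power2_eq_square)
    also have "\<dots> \<le> Ag * (Bg / lam)" using gA[OF lam \<alpha>] gB[OF lam \<alpha>] pos by (intro mult_mono) auto
    finally have "sqrt \<alpha> * \<bar>g lam \<alpha>\<bar> \<le> sqrt (Ag * (Bg / lam))" by (rule real_le_rsqrt)
    then show "\<bar>sqrt \<alpha> * g lam \<alpha>\<bar> \<le> sqrt (Ag * (Bg / lam))" using \<alpha> by (simp add: abs_mult)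
  qed (use pos lam in auto)
  also have "(sqrt (Ag * (Bg / lam)))\<^sup>2 = Ag * Bg / lam" using pos lam by simp
  finally show ?thesis .
qed

text \<open>The exponent 0 lies outside the qualification condition (d); the bound (c) takes its
  place.\<close>

lemma resid_power:
  assumes lam: "0 < lam" and \<alpha>: "\<alpha> \<in> {0..c}" and b: "0 \<le> b" "b \<le> \<eta>0"
  shows "\<bar>resid lam \<alpha>\<bar> * \<alpha> powr b \<le> (if b = 0 then Cg else \<gamma> b) * lam powr b"
proof (cases "b = 0")
  case True
  then show ?thesis using resid_bound[OF lam \<alpha>] lam pos by auto
next
  case False
  then show ?thesis using gD[OF lam \<alpha>, of b] b by (simp add: resid_def)
qed

lemma resid_shifted:
  assumes lam: "0 < lam" and \<alpha>: "\<alpha> \<in> {0..c}" and b: "0 \<le> b" "b \<le> \<eta>0"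
  shows "\<bar>resid lam \<alpha>\<bar> * (\<alpha> + lam) powr b \<le> 2 powr b * ((if b = 0 then Cg else \<gamma> b) + Cg) * lam powr b"
proof -
  have "\<bar>resid lam \<alpha>\<bar> * (\<alpha> + lam) powr b \<le> \<bar>resid lam \<alpha>\<bar> * (2 powr b * (\<alpha> powr b + lam powr b))"
    using \<alpha> lam b by (intro mult_left_mono shifted_power_le) auto
  also have "\<dots> = 2 powr b * (\<bar>resid lam \<alpha>\<bar> * \<alpha> powr b + \<bar>resid lam \<alpha>\<bar> * lam powr b)"
    by (simp add: algebra_simps)
  also have "\<dots> \<le> 2 powr b * ((if b = 0 then Cg else \<gamma> b) * lam powr b + Cg * lam powr b)"
    by (intro mult_left_mono add_mono mult_right_mono resid_power resid_bound assms) auto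
  finally show ?thesis by (simp add: algebra_simps)
qed

lemma resid_sqrt:
  assumes lam: "0 < lam" and \<alpha>: "\<alpha> \<in> {0..c}" and \<eta>: "1/2 \<le> \<eta>0"
  shows "\<bar>sqrt \<alpha> * resid lam \<alpha>\<bar> \<le> \<gamma> (1/2) * lam powr (1/2)"
  using gD[OF lam \<alpha>, of "1/2"] \<eta> \<alpha> by (simp add: resid_def powr_half_sqrt mult.commute abs_mult)

text \<open>The square root raises the exponent by 1/2, so the qualification is used at b + 1/2 and
  at 1/2. This is the source of the restriction b + 1/2 \<le> \<eta>0.\<close>

lemma resid_shifted_sqrt:
  assumes lam: "0 < lam" and \<alpha>: "\<alpha> \<in> {0..c}" and b: "0 \<le> b" "b + 1/2 \<le> \<eta>0"
  shows "\<bar>sqrt \<alpha> * (resid lam \<alpha> * (\<alpha> + lam) powr b)\<bar> \<le> 2 powr b * (\<gamma> (b + 1/2) + \<gamma> (1/2)) * lam powr (b + 1/2)"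
proof -
  have "\<bar>sqrt \<alpha> * (resid lam \<alpha> * (\<alpha> + lam) powr b)\<bar> = \<bar>sqrt \<alpha> * resid lam \<alpha>\<bar> * (\<alpha> + lam) powr b"
    by (simp add: abs_mult)
  also have "\<dots> \<le> \<bar>sqrt \<alpha> * resid lam \<alpha>\<bar> * (2 powr b * (\<alpha> powr b + lam powr b))"
    using \<alpha> lam b by (intro mult_left_mono shifted_power_le) auto
  also have "\<dots> = 2 powr b * (\<bar>resid lam \<alpha>\<bar> * (\<alpha> powr b * sqrt \<alpha>) + \<bar>sqrt \<alpha> * resid lam \<alpha>\<bar> * lam powr b)"
    using \<alpha> by (simp add: abs_mult algebra_simps)
  also have "\<alpha> powr b * sqrt \<alpha> = \<alpha> powr (b + 1/2)"
    using \<alpha> by (simp add: powr_add powr_half_sqrt)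
  also have "2 powr b * (\<bar>resid lam \<alpha>\<bar> * \<alpha> powr (b + 1/2) + \<bar>sqrt \<alpha> * resid lam \<alpha>\<bar> * lam powr b)
     \<le> 2 powr b * (\<gamma> (b + 1/2) * lam powr (b + 1/2) + (\<gamma> (1/2) * lam powr (1/2)) * lam powr b)"
    using gD[OF lam \<alpha>, of "b + 1/2"] b
    by (intro mult_left_mono add_mono mult_right_mono resid_sqrt lam \<alpha>) (auto simp: resid_def)
  also have "\<dots> = 2 powr b * (\<gamma> (b + 1/2) + \<gamma> (1/2)) * lam powr (b + 1/2)"
    by (simp add: powr_add algebra_simps)
  finally show ?thesis .
qed

text \<open>The data error \<lambda>^(b + 1), divided by \<lambda>, is \<lambda>^b. Both noise and
  operator perturbation lose exactly this factor, so all terms balance with the bias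
  \<lambda>^b.\<close>

theorem deterministic_rates:
  fixes C :: "'h::{real_inner,banach} \<Rightarrow> 'h"
  assumes C: "posdiag c C" and c: "0 \<le> c" and b: "0 \<le> b" "b \<le> \<eta>0" and K: "0 < K" and R: "0 \<le> R"
    and source: "\<forall>lam. 0 < lam \<longrightarrow> lam \<le> 1 \<longrightarrow> (\<exists>h. norm h \<le> R \<and> f0 = op_fun (\<lambda>a. (a + lam) powr b) C h)"
  shows "\<exists>k\<ge>0. \<forall>lam T \<xi>. 0 < lam \<longrightarrow> lam \<le> 1 \<longrightarrow> close_data c C f0 (K * lam powr (b + 1)) T \<xi> \<longrightarrow>
    (let w = - op_fun (g lam) T \<xi> - f0 in
      norm w \<le> k * lam powr b \<and> (b + 1/2 \<le> \<eta>0 \<longrightarrow> w \<bullet> C w \<le> k * lam powr (2 * b + 1)))"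
proof -
  \<comment> \<open>\<open>l\<close> is the Lipschitz constant of the shifted power times \<lambda>
    K. \<open>k1\<close> adds up the three norm bounds; in \<open>k2\<close> the factors 2 and 4
    come from splitting the form twice, and the last term from replacing \<open>T\<close> by
    \<open>C\<close>.\<close>
  define l where "l = b * (c + 1) powr b * K"
  define k1 where "k1 = Bg * K + (2 powr b * ((if b = 0 then Cg else \<gamma> b) + Cg) * R + Cg * l * R)"
  define k3 where "k3 = 2 powr b * (\<gamma> (b + 1/2) + \<gamma> (1/2))"
  define k2 where "k2 = 2 * (Ag * Bg * K\<^sup>2) + 4 * (k3\<^sup>2 * R\<^sup>2 + (\<gamma> (1/2))\<^sup>2 * (l * R)\<^sup>2) + K * k1\<^sup>2"
  have l: "0 \<le> l" using b K by (simp add: l_def)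
  have gb: "0 \<le> (if b = 0 then Cg else \<gamma> b)" using pos(3) pos(5)[of b] b by (cases "b = 0") auto
  have k1: "0 \<le> k1"
    unfolding k1_def using pos K R l gb by (intro add_nonneg_nonneg mult_nonneg_nonneg) auto
  have k2: "0 \<le> k2"
    unfolding k2_def using pos K by (intro add_nonneg_nonneg mult_nonneg_nonneg) auto
  have main: "norm w \<le> k1 * lam powr b \<and> (b + 1/2 \<le> \<eta>0 \<longrightarrow> w \<bullet> C w \<le> k2 * lam powr (2 * b + 1))"
    if lam: "0 < lam" "lam \<le> 1" and T: "posdiag c T" and e: "norm (\<xi> + T f0) \<le> K * lam powr (b + 1)"
      and S: "\<And>F. finite F \<Longrightarrow> F \<subseteq> basis_of C \<Longrightarrow> (\<Sum>\<phi>\<in>F. (norm (T \<phi> - C \<phi>))\<^sup>2) \<le> (K * lam powr (b + 1))\<^sup>2"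
      and w: "w = - op_fun (g lam) T \<xi> - f0" for lam T \<xi> w
  proof -
    let ?F = "\<lambda>a. (a + lam) powr b" and ?r = "resid lam" and ?S = "K * lam powr (b + 1)"
    obtain h where h: "norm h \<le> R" "f0 = op_fun ?F C h" using source lam by blast
    have S0: "0 \<le> ?S" using K by simp
    have lam_powr: "lam powr (b + 1) = lam powr b * lam" using lam by (simp add: powr_add)
    have Fb: "le_on c ?F ((c + 1) powr b)"
      using b lam by (auto intro!: le_onI powr_mono2)
    \<comment> \<open>The defect of the source condition once \<open>C\<close> has been replaced by
      \<open>T\<close>.\<close>
    define d where "d = f0 - op_fun ?F T h"
    have "norm d \<le> (b * (c + 1) powr b / lam) * ?S * norm h"
      unfolding d_def h(2)
      by (rule op_fun_perturbation[OF C T S0 S Fb])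
        (use shifted_power_lipschitz b lam in auto)
    also have "\<dots> \<le> (b * (c + 1) powr b / lam) * ?S * R"
      using b lam K h(1) by (intro mult_left_mono mult_nonneg_nonneg) auto
    also have "\<dots> = l * R * lam powr b" using lam by (simp add: l_def lam_powr)
    finally have d: "norm d \<le> l * R * lam powr b" .
    \<comment> \<open>\<open>v1\<close> is the noise, \<open>u\<close> the bias of the part of
      \<open>f0\<close> that is smooth for \<open>T\<close>, and \<open>v\<close> the bias of the
      defect.\<close>
    define v1 where "v1 = op_fun (g lam) T (\<xi> + T f0)"
    define u where "u = op_fun (\<lambda>a. ?r a * ?F a) T h"
    define v where "v = op_fun ?r T d"
    have rFb: "le_on c (\<lambda>a. ?r a * ?F a) (2 powr b * ((if b = 0 then Cg else \<gamma> b) + Cg) * lam powr b)"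
      using resid_shifted[OF lam(1) _ b] by (intro le_onI) (simp add: abs_mult)
    have split: "op_fun ?r T f0 = u + v"
    proof (rule eq_by_coeffs[OF basis_of_orthonormal[OF T] basis_of_dense[OF T]])
      fix \<phi> assume \<phi>: "\<phi> \<in> basis_of T"
      show "\<phi> \<bullet> op_fun ?r T f0 = \<phi> \<bullet> (u + v)"
        unfolding u_def v_def d_def
        by (simp only: inner_add_right inner_diff_right op_fun_inner[OF T resid_le_on[OF lam(1)] \<phi>]
            op_fun_inner[OF T rFb \<phi>] op_fun_inner[OF T Fb \<phi>]) (simp add: algebra_simps)
    qed
    have w_eq: "w = - (v1 + (u + v))"
      unfolding w error_decomposition[OF T lam(1)] split v1_def ..
    have n1: "norm v1 \<le> Bg * K * lam powr b"
    proof -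
      have "norm v1 \<le> Bg / lam * norm (\<xi> + T f0)" unfolding v1_def by (rule noise_norm[OF T lam(1)])
      also have "\<dots> \<le> Bg / lam * ?S" using pos lam e by (intro mult_left_mono) auto
      finally show ?thesis using lam by (simp add: lam_powr)
    qed
    have n2: "norm u \<le> 2 powr b * ((if b = 0 then Cg else \<gamma> b) + Cg) * R * lam powr b"
    proof -
      have "norm u \<le> (2 powr b * ((if b = 0 then Cg else \<gamma> b) + Cg) * lam powr b) * norm h"
        unfolding u_def by (rule norm_op_fun_le[OF T rFb]) (use gb pos in \<open>auto intro!: mult_nonneg_nonneg\<close>)
      also have "\<dots> \<le> (2 powr b * ((if b = 0 then Cg else \<gamma> b) + Cg) * lam powr b) * R"
        using gb pos by (intro mult_left_mono h(1) mult_nonneg_nonneg) auto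
      finally show ?thesis by (simp add: mult_ac)
    qed
    have n3: "norm v \<le> Cg * l * R * lam powr b"
    proof -
      have "norm v \<le> Cg * norm d"
        unfolding v_def by (rule norm_op_fun_le[OF T resid_le_on[OF lam(1)]]) (use pos in auto)
      also have "\<dots> \<le> Cg * (l * R * lam powr b)" using d pos by (intro mult_left_mono) auto
      finally show ?thesis by (simp add: mult_ac)
    qed
    have "norm w \<le> norm v1 + (norm u + norm v)"
      unfolding w_eq norm_minus_cancel by (intro order_trans[OF norm_triangle_ineq] add_left_mono norm_triangle_ineq)
    also have "\<dots> \<le> Bg * K * lam powr b + (2 powr b * ((if b = 0 then Cg else \<gamma> b) + Cg) * R * lam powr b
        + Cg * l * R * lam powr b)"
      by (intro add_mono n1 n2 n3)
    also have "\<dots> = k1 * lam powr b" by (simp only: k1_def distrib_right)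
    finally have nw: "norm w \<le> k1 * lam powr b" .
    have "w \<bullet> C w \<le> k2 * lam powr (2 * b + 1)" if b2: "b + 1/2 \<le> \<eta>0"
    proof -
      have p: "lam powr (2 * b + 1) = (lam powr b)\<^sup>2 * lam" "(lam powr (b + 1/2))\<^sup>2 = (lam powr b)\<^sup>2 * lam"
        "(lam powr (1/2))\<^sup>2 = lam"
      proof -
        have "lam powr (2 * b) = (lam powr b)\<^sup>2" by (simp add: power2_eq_square powr_add[symmetric])
        then show "lam powr (2 * b + 1) = (lam powr b)\<^sup>2 * lam" using lam by (simp add: powr_add)
        show half: "(lam powr (1/2))\<^sup>2 = lam" using lam by (simp add: powr_half_sqrt)
        show "(lam powr (b + 1/2))\<^sup>2 = (lam powr b)\<^sup>2 * lam"
          unfolding powr_add power_mult_distrib half ..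
      qed
      have g0: "0 \<le> \<gamma> (b + 1/2)" "0 \<le> \<gamma> (1/2)" using pos(5)[of "b + 1/2"] pos(5)[of "1/2"] b b2 by auto
      have q1: "v1 \<bullet> T v1 \<le> (Ag * Bg * K\<^sup>2) * lam powr (2 * b + 1)"
      proof -
        have "v1 \<bullet> T v1 \<le> Ag * Bg / lam * (norm (\<xi> + T f0))\<^sup>2"
          unfolding v1_def by (rule noise_quadratic[OF T lam(1)])
        also have "\<dots> \<le> Ag * Bg / lam * ?S\<^sup>2" using pos lam e by (intro mult_left_mono power_mono) auto
        also have "\<dots> = (Ag * Bg * K\<^sup>2) * lam powr (2 * b + 1)"
          using lam by (simp add: p lam_powr power_mult_distrib) (simp add: power2_eq_square)
        finally show ?thesis .
      qed
      have q2: "u \<bullet> T u \<le> (k3\<^sup>2 * R\<^sup>2) * lam powr (2 * b + 1)"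
      proof -
        have "u \<bullet> T u \<le> (k3 * lam powr (b + 1/2))\<^sup>2 * (norm h)\<^sup>2"
          unfolding u_def k3_def
          by (rule quadratic_op_fun_le[OF T rFb], rule le_onI, rule resid_shifted_sqrt[OF lam(1) _ b(1) b2])
            (use g0 in \<open>auto intro!: mult_nonneg_nonneg\<close>)
        also have "\<dots> \<le> (k3 * lam powr (b + 1/2))\<^sup>2 * R\<^sup>2" using h(1) by (intro mult_left_mono power_mono) auto
        finally show ?thesis by (simp only: p power_mult_distrib) (simp only: mult_ac)
      qed
      have q3: "v \<bullet> T v \<le> ((\<gamma> (1/2))\<^sup>2 * (l * R)\<^sup>2) * lam powr (2 * b + 1)"
      proof -
        have "v \<bullet> T v \<le> (\<gamma> (1/2) * lam powr (1/2))\<^sup>2 * (norm d)\<^sup>2"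
          unfolding v_def
          by (rule quadratic_op_fun_le[OF T resid_le_on[OF lam(1)]], rule le_onI, rule resid_sqrt[OF lam(1)])
            (use g0 b b2 in auto)
        also have "\<dots> \<le> (\<gamma> (1/2) * lam powr (1/2))\<^sup>2 * (l * R * lam powr b)\<^sup>2"
          using d by (intro mult_left_mono power_mono) auto
        finally show ?thesis by (simp only: p power_mult_distrib) (simp only: mult_ac)
      qed
      have "w \<bullet> T w \<le> 2 * (v1 \<bullet> T v1) + 2 * ((u + v) \<bullet> T (u + v))"
        unfolding w_eq quadratic_minus[OF T] by (rule quadratic_add_le[OF T])
      also have "\<dots> \<le> 2 * (v1 \<bullet> T v1) + 2 * (2 * (u \<bullet> T u) + 2 * (v \<bullet> T v))"
        by (intro add_left_mono mult_left_mono quadratic_add_le[OF T]) auto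
      also have "\<dots> \<le> 2 * ((Ag * Bg * K\<^sup>2) * lam powr (2 * b + 1)) + 2 * (2 * ((k3\<^sup>2 * R\<^sup>2) * lam powr (2 * b + 1))
          + 2 * (((\<gamma> (1/2))\<^sup>2 * (l * R)\<^sup>2) * lam powr (2 * b + 1)))"
        by (intro add_mono mult_left_mono q1 q2 q3) auto
      also have "\<dots> = (2 * (Ag * Bg * K\<^sup>2) + 4 * (k3\<^sup>2 * R\<^sup>2 + (\<gamma> (1/2))\<^sup>2 * (l * R)\<^sup>2)) * lam powr (2 * b + 1)"
        by (simp add: algebra_simps)
      finally have qT: "w \<bullet> T w \<le> (2 * (Ag * Bg * K\<^sup>2) + 4 * (k3\<^sup>2 * R\<^sup>2 + (\<gamma> (1/2))\<^sup>2 * (l * R)\<^sup>2)) * lam powr (2 * b + 1)" .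
      \<comment> \<open>The exchange of \<open>T\<close> for \<open>C\<close> costs \<lambda>^(3 b +
        1), at most the target order because \<lambda> \<le> 1.\<close>
      have "?S * (norm w)\<^sup>2 \<le> ?S * (k1 * lam powr b)\<^sup>2"
        using nw S0 by (intro mult_left_mono power_mono) auto
      also have "\<dots> = K * k1\<^sup>2 * (lam powr b * lam powr (2 * b + 1))"
        by (simp only: p lam_powr power_mult_distrib) (simp only: power2_eq_square mult_ac)
      also have "\<dots> \<le> K * k1\<^sup>2 * (1 * lam powr (2 * b + 1))"
        using lam b K by (intro mult_left_mono mult_right_mono) (auto simp: powr_le1)
      finally have "?S * (norm w)\<^sup>2 \<le> K * k1\<^sup>2 * lam powr (2 * b + 1)" by simp
      then have "w \<bullet> C w \<le> (2 * (Ag * Bg * K\<^sup>2) + 4 * (k3\<^sup>2 * R\<^sup>2 + (\<gamma> (1/2))\<^sup>2 * (l * R)\<^sup>2)) * lam powr (2 * b + 1)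
          + K * k1\<^sup>2 * lam powr (2 * b + 1)"
        using quadratic_transfer[OF C T S0 S, of w] qT by simp
      then show ?thesis by (simp only: k2_def distrib_right)
    qed
    then show ?thesis using nw by blast
  qed
  have le: "k1 * lam powr x \<le> max k1 k2 * lam powr x" "k2 * lam powr x \<le> max k1 k2 * lam powr x" for lam x :: real
    by (auto intro: mult_right_mono)
  show ?thesis
    unfolding close_data_def
    by (rule exI[of _ "max k1 k2"], intro conjI allI impI, use k1 in simp, unfold Let_def)
      (use main le order_trans in meson)
qed

text \<open>A spectrum bounded away from 0 removes the division by \<lambda> in the noise and makes
  the residual O(\<lambda>) by the qualification at 1. Here the regularisation parameter equals the
  error scale S.\<close>

theorem deterministic_rates_invertible:
  fixes C :: "'h::{real_inner,banach} \<Rightarrow> 'h"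
  assumes C: "posdiag c C" and inv: "boundedly_invertible C" and \<eta>: "1 \<le> \<eta>0" and K: "0 < K"
  shows "\<exists>k\<ge>0. \<exists>s>0. \<forall>S T \<xi>. 0 < S \<longrightarrow> S \<le> s \<longrightarrow> close_data c C f0 (K * S) T \<xi> \<longrightarrow>
    norm (- op_fun (g S) T \<xi> - f0) \<le> k * S"
proof -
  obtain B where B: "bounded_linear B" "\<And>f. B (C f) = f"
    using inv by (auto simp: boundedly_invertible_def)
  obtain M where M: "0 < M" "\<And>f. norm (B f) \<le> norm f * M" using bounded_linear.pos_bounded[OF B(1)] by blast
  \<comment> \<open>On unit vectors the norm of the image under \<open>C\<close> is at least 2 q,
    and a perturbation of size at most q leaves q for the eigenvalues of \<open>T\<close>.\<close>
  define q where "q = 1 / (2 * M)"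
  have q: "0 < q" using M by (simp add: q_def)
  have "norm (- op_fun (g S) T \<xi> - f0) \<le> (Ag / q * K + \<gamma> 1 / q * norm f0) * S"
    if S: "0 < S" "S \<le> q / K" and T: "posdiag c T" and e: "norm (\<xi> + T f0) \<le> K * S"
      and HS: "\<And>F. finite F \<Longrightarrow> F \<subseteq> basis_of C \<Longrightarrow> (\<Sum>\<phi>\<in>F. (norm (T \<phi> - C \<phi>))\<^sup>2) \<le> (K * S)\<^sup>2" for S T \<xi>
  proof -
    have ev: "q \<le> \<phi> \<bullet> T \<phi>" if \<phi>: "\<phi> \<in> basis_of T" for \<phi>
    proof -
      have n1: "norm \<phi> = 1" using basis_of_orthonormal[OF T] \<phi> by (simp add: orthonormal_def)
      have "1 \<le> norm (C \<phi>) * M" using M(2)[of "C \<phi>"] B(2) n1 by simp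
      then have "2 * q \<le> norm (C \<phi>)" using M(1) by (simp add: q_def field_simps)
      also have "\<dots> \<le> norm (T \<phi>) + norm (T \<phi> - C \<phi>)"
        using norm_triangle_ineq4[of "T \<phi>" "T \<phi> - C \<phi>"] by simp
      also have "norm (T \<phi> - C \<phi>) \<le> K * S * norm \<phi>"
        by (rule norm_diff_le[OF C T _ HS]) (use K S in auto)
      also have "K * S * norm \<phi> \<le> q" using S K n1 by (simp add: field_simps)
      finally have "q \<le> norm (T \<phi>)" by simp
      also have "T \<phi> = (\<phi> \<bullet> T \<phi>) *\<^sub>R \<phi>" by (rule eigenbasis_eigenvector[OF basis_of[OF T] \<phi>])
      then have "norm (T \<phi>) = \<bar>\<phi> \<bullet> T \<phi>\<bar>" using n1 by (metis mult.right_neutral norm_scaleR)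
      finally show ?thesis using eigenvalue_range[OF T \<phi>] by simp
    qed
    have "norm (op_fun (g S) T (\<xi> + T f0)) \<le> Ag / q * norm (\<xi> + T f0)"
    proof (rule norm_le_coeffs[OF basis_of_orthonormal[OF T] basis_of_dense[OF T]])
      fix \<phi> assume \<phi>: "\<phi> \<in> basis_of T"
      let ?b = "\<phi> \<bullet> T \<phi>"
      have "q * \<bar>g S ?b\<bar> \<le> ?b * \<bar>g S ?b\<bar>" by (intro mult_right_mono ev \<phi>) simp
      also have "\<dots> \<le> Ag" using gA[OF S(1) eigenvalue_range[OF T \<phi>]] eigenvalue_range[OF T \<phi>] by (simp add: abs_mult)
      finally have "\<bar>g S ?b\<bar> \<le> Ag / q" using q by (simp add: field_simps)
      then show "\<bar>\<phi> \<bullet> op_fun (g S) T (\<xi> + T f0)\<bar> \<le> Ag / q * \<bar>\<phi> \<bullet> (\<xi> + T f0)\<bar>"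
        unfolding op_fun_inner[OF T g_le_on[OF S(1)] \<phi>] abs_mult by (rule mult_right_mono) simp
    qed (use pos q in simp)
    also have "\<dots> \<le> Ag / q * (K * S)" using pos q e by (intro mult_left_mono) auto
    finally have n1: "norm (op_fun (g S) T (\<xi> + T f0)) \<le> Ag / q * (K * S)" .
    have n2: "norm (op_fun (resid S) T f0) \<le> \<gamma> 1 / q * S * norm f0"
    proof (rule norm_le_coeffs[OF basis_of_orthonormal[OF T] basis_of_dense[OF T]])
      fix \<phi> assume \<phi>: "\<phi> \<in> basis_of T"
      let ?b = "\<phi> \<bullet> T \<phi>"
      have "q * \<bar>resid S ?b\<bar> \<le> ?b * \<bar>resid S ?b\<bar>" by (intro mult_right_mono ev \<phi>) simp
      also have "\<dots> \<le> \<gamma> 1 * S"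
        using gD[OF S(1) eigenvalue_range[OF T \<phi>], of 1] \<eta> eigenvalue_range[OF T \<phi>] S(1)
        by (simp add: resid_def mult.commute)
      finally have "\<bar>resid S ?b\<bar> \<le> \<gamma> 1 / q * S" using q by (simp add: field_simps)
      then show "\<bar>\<phi> \<bullet> op_fun (resid S) T f0\<bar> \<le> \<gamma> 1 / q * S * \<bar>\<phi> \<bullet> f0\<bar>"
        unfolding op_fun_inner[OF T resid_le_on[OF S(1)] \<phi>] abs_mult by (rule mult_right_mono) simp
    qed (use pos(5)[of 1] \<eta> q S in simp)
    have "norm (- op_fun (g S) T \<xi> - f0) \<le> norm (op_fun (g S) T (\<xi> + T f0)) + norm (op_fun (resid S) T f0)"
      unfolding error_decomposition[OF T S(1)] norm_minus_cancel by (rule norm_triangle_ineq)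
    also have "\<dots> \<le> Ag / q * (K * S) + \<gamma> 1 / q * S * norm f0" by (intro add_mono n1 n2)
    finally show ?thesis by (simp add: algebra_simps)
  qed
  note main = this
  show ?thesis
  proof (rule exI[of _ "Ag / q * K + \<gamma> 1 / q * norm f0"], rule conjI[OF _ exI[of _ "q / K"]]; (intro conjI allI impI)?)
    show "0 \<le> Ag / q * K + \<gamma> 1 / q * norm f0" using pos(1) pos(5)[of 1] \<eta> q K by simp
    show "0 < q / K" using q K by simp
    fix S T \<xi> assume S: "0 < S" "S \<le> q / K" and cd: "close_data c C f0 (K * S) T \<xi>"
    show "norm (- op_fun (g S) T \<xi> - f0) \<le> (Ag / q * K + \<gamma> 1 / q * norm f0) * S"
      by (rule main[OF S]) (use cd in \<open>simp_all add: close_data_def\<close>)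
  qed
qed

end

section \<open>Distances between members of the exponential family\<close>

text \<open>Finiteness of the norm of h is what makes the passage through \<open>enn2real\<close>
  faithful for finite exponents, since infinity is mapped to 0.\<close>

lemma Lp_norm_le:
  assumes le: "\<And>x. x \<in> space M \<Longrightarrow> \<bar>f x\<bar> \<le> a * \<bar>h x\<bar>" and a: "0 \<le> a" and r: "0 < r"
    and f: "f \<in> borel_measurable M" and h: "h \<in> borel_measurable M" and fin: "Lp_norm M r h < \<infinity>"
  shows "Lp_norm M r f \<le> ennreal a * Lp_norm M r h"
proof (cases "r = \<infinity>")
  case True
  have [measurable]: "f \<in> borel_measurable M" "h \<in> borel_measurable M" by (fact f, fact h)
  have "AE x in M. ennreal \<bar>f x\<bar> \<le> ennreal a * esssup M (\<lambda>x. ennreal \<bar>h x\<bar>)"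
  proof (rule AE_mp[OF esssup_AE[of "\<lambda>x. ennreal \<bar>h x\<bar>" M]], intro AE_I2 impI)
    fix x assume x: "x \<in> space M" and hx: "ennreal \<bar>h x\<bar> \<le> esssup M (\<lambda>x. ennreal \<bar>h x\<bar>)"
    have "ennreal \<bar>f x\<bar> \<le> ennreal (a * \<bar>h x\<bar>)" by (intro ennreal_leI le x)
    also have "\<dots> = ennreal a * ennreal \<bar>h x\<bar>" using a by (simp add: ennreal_mult)
    also have "\<dots> \<le> ennreal a * esssup M (\<lambda>x. ennreal \<bar>h x\<bar>)" by (intro mult_left_mono hx) simp
    finally show "ennreal \<bar>f x\<bar> \<le> ennreal a * esssup M (\<lambda>x. ennreal \<bar>h x\<bar>)" .
  qed
  then have "esssup M (\<lambda>x. ennreal \<bar>f x\<bar>) \<le> ennreal a * esssup M (\<lambda>x. ennreal \<bar>h x\<bar>)"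
    by (intro esssup_I) measurable
  then show ?thesis using True by (simp add: Lp_norm_def)
next
  case False
  define p where "p = enn2real r"
  have p: "0 < p" using r False by (simp add: p_def enn2real_positive_iff less_top)
  let ?I = "\<lambda>h. \<integral>\<^sup>+x. ennreal (\<bar>h x\<bar> powr p) \<partial>M"
  have hfin: "?I h \<noteq> \<infinity>" using fin False by (auto simp: Lp_norm_def Let_def p_def)
  have "?I f \<le> (\<integral>\<^sup>+x. ennreal (a powr p) * ennreal (\<bar>h x\<bar> powr p) \<partial>M)"
  proof (rule nn_integral_mono)
    fix x assume "x \<in> space M"
    then have "\<bar>f x\<bar> powr p \<le> (a * \<bar>h x\<bar>) powr p" using p by (intro powr_mono2 le) auto
    then show "ennreal (\<bar>f x\<bar> powr p) \<le> ennreal (a powr p) * ennreal (\<bar>h x\<bar> powr p)"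
      using a by (simp add: powr_mult ennreal_mult[symmetric] ennreal_leI)
  qed
  also have "\<dots> = ennreal (a powr p) * ?I h" using h by (intro nn_integral_cmult) measurable
  finally have le1: "?I f \<le> ennreal (a powr p) * ?I h" .
  then have ffin: "?I f \<noteq> \<infinity>" using hfin by (auto simp: ennreal_mult_eq_top_iff top_unique)
  have "enn2real (?I f) \<le> enn2real (ennreal (a powr p) * ?I h)"
    using le1 hfin by (intro enn2real_mono) (auto simp: ennreal_mult_less_top less_top)
  also have "\<dots> = a powr p * enn2real (?I h)" by (simp add: enn2real_mult)
  finally have "enn2real (?I f) powr (1 / p) \<le> (a powr p * enn2real (?I h)) powr (1 / p)"
    using p by (intro powr_mono2) auto
  also have "\<dots> = a * enn2real (?I h) powr (1 / p)"
    using p a by (simp add: powr_mult powr_powr)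
  finally have "ennreal (enn2real (?I f) powr (1 / p)) \<le> ennreal a * ennreal (enn2real (?I h) powr (1 / p))"
    using a by (simp add: ennreal_mult[symmetric] ennreal_leI)
  then show ?thesis using False hfin ffin by (simp add: Lp_norm_def Let_def p_def[symmetric])
qed

lemma abs_exp_minus_one_le: "\<bar>exp t - 1\<bar> \<le> \<bar>t\<bar> * exp \<bar>t\<bar>" for t :: real
proof -
  obtain u where u: "\<bar>u\<bar> \<le> \<bar>t\<bar>" "exp t = (\<Sum>m<1. t ^ m / fact m) + exp u / fact 1 * t ^ 1"
    using Maclaurin_exp_le[of t 1] by blast
  then have "\<bar>exp t - 1\<bar> = exp u * \<bar>t\<bar>" by (simp add: abs_mult)
  also have "\<dots> \<le> exp \<bar>t\<bar> * \<bar>t\<bar>" using u(1) by (intro mult_right_mono) auto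
  finally show ?thesis by (simp add: mult.commute)
qed

text \<open>The second-order remainder is what later yields the squared rate for the
  Kullback--Leibler divergence.\<close>

lemma exp_le_quadratic: "exp t \<le> 1 + t + t\<^sup>2 * exp \<bar>t\<bar>" for t :: real
proof -
  obtain u where u: "\<bar>u\<bar> \<le> \<bar>t\<bar>" "exp t = (\<Sum>m<2. t ^ m / fact m) + exp u / fact 2 * t ^ 2"
    using Maclaurin_exp_le[of t 2] by blast
  then have "exp t = 1 + t + exp u * t\<^sup>2 / 2" by (simp add: numeral_2_eq_2)
  also have "\<dots> \<le> 1 + t + exp u * t\<^sup>2" by simp
  also have "\<dots> \<le> 1 + t + exp \<bar>t\<bar> * t\<^sup>2" using u(1) by (intro add_left_mono mult_right_mono) auto
  finally show ?thesis by (simp add: mult.commute)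
qed

context score_family begin

lemma pd_ln_density:
  assumes i: "i \<in> Basis" and x: "x \<in> P"
  shows "pd i (\<lambda>y. ln (exp_family_density \<Omega> q0 evf f y)) x = f \<bullet> D i x + pd i q0 x / q0 x"
proof -
  have x\<Omega>: "x \<in> \<Omega>" using x P_subset by blast
  have "open ((\<lambda>s::real. x + s *\<^sub>R i) -` P)"
    by (intro open_vimage open_P continuous_intros)
  then have "\<forall>\<^sub>F s in nhds (0::real). x + s *\<^sub>R i \<in> P"
    unfolding eventually_nhds using x by (intro exI[of _ "(\<lambda>s::real. x + s *\<^sub>R i) -` P"]) auto
  then have ev: "\<forall>\<^sub>F s in nhds 0. ln (exp_family_density \<Omega> q0 evf f (x + s *\<^sub>R i))
      = evf f (x + s *\<^sub>R i) - log_partition \<Omega> q0 evf f + ln (q0 (x + s *\<^sub>R i))"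
    by (rule eventually_mono) (simp add: exp_family_density_def P_def ln_mult)
  have "((\<lambda>s. evf f (x + s *\<^sub>R i) - log_partition \<Omega> q0 evf f + ln (q0 (x + s *\<^sub>R i))) has_real_derivative
      f \<bullet> D i x + pd i q0 x / q0 x) (at 0)"
    using evf_DERIV[OF i, of x 0 f] x\<Omega> x by (auto intro!: derivative_eq_intros q0_DERIV simp: P_def)
  then have "((\<lambda>s. ln (exp_family_density \<Omega> q0 evf f (x + s *\<^sub>R i))) has_real_derivative
      f \<bullet> D i x + pd i q0 x / q0 x) (at 0)"
    by (subst DERIV_cong_ev[OF refl ev refl])
  then show ?thesis unfolding pd_def[of i "\<lambda>y. ln (exp_family_density \<Omega> q0 evf f y)"] by (rule DERIV_imp_deriv)
qed

text \<open>On \<open>P\<close> the normalising constants and log q0 cancel in the difference of the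
  gradients, leaving the partial derivatives of f0 - f; outside \<open>P\<close> the weight p0 is
  zero.\<close>

lemma fisher_divergence_eq:
  "fisher_divergence \<Omega> p0 (exp_family_density \<Omega> q0 evf f) = ennreal ((f - f0) \<bullet> avg \<mu> (f - f0) / 2)"
proof -
  let ?p = "exp_family_density \<Omega> q0 evf f" and ?w = "f - f0"
  let ?G = "\<lambda>x. (norm (grad (\<lambda>y. ln (p0 y)) x - grad (\<lambda>y. ln (?p y)) x))\<^sup>2"
  note \<mu> = \<mu>.prob_space_axioms sets_\<mu>
  have \<Omega>: "\<Omega> \<in> sets borel" using open_\<Omega> by simp
  have ortho: "orthonormal (Basis :: 'a set)" by (simp add: orthonormal_def inner_Basis)
  have pt: "ennreal (p0 x * ?G x) * indicator \<Omega> x = ennreal (pp x) * ennreal (\<Sum>i\<in>Basis. (?w \<bullet> Y1 i x)\<^sup>2)" for x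
  proof (cases "x \<in> P")
    case True
    then have x\<Omega>: "x \<in> \<Omega>" using P_subset by blast
    have "grad (\<lambda>y. ln (p0 y)) x - grad (\<lambda>y. ln (?p y)) x = (\<Sum>i\<in>Basis. (f0 \<bullet> D i x - f \<bullet> D i x) *\<^sub>R i)"
      unfolding grad_def p0 by (simp add: pd_ln_density[OF _ True] sum_subtractf[symmetric] scaleR_diff_left[symmetric])
    then have "?G x = (\<Sum>i\<in>Basis. (f0 \<bullet> D i x - f \<bullet> D i x)\<^sup>2)" by (simp add: norm_orthonormal_sum[OF ortho])
    also have "\<dots> = (\<Sum>i\<in>Basis. (?w \<bullet> Y1 i x)\<^sup>2)"
      using True by (simp add: Y1_def inner_diff_left power2_commute)
    finally show ?thesis using x\<Omega> by (simp add: pp_def p0_nonneg ennreal_mult sum_nonneg)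
  next
    case False
    then show ?thesis using pp_notin_P[OF False] by (cases "x \<in> \<Omega>") (simp_all add: pp_def)
  qed
  have m: "(\<lambda>x. \<Sum>i\<in>Basis. (?w \<bullet> Y1 i x)\<^sup>2) \<in> borel_measurable borel"
    by (intro borel_measurable_sum borel_measurable_power borel_measurable_inner Y1_measurable) auto
  have int: "integrable \<mu> (\<lambda>x. \<Sum>i\<in>Basis. (?w \<bullet> Y1 i x)\<^sup>2)"
    using integrable_inner_right[of ?w \<mu> "\<lambda>x. Zop x ?w"] Zop_integrable[OF \<mu>, of ?w]
    by (simp add: inner_Zop power2_eq_square)
  have "(\<integral>\<^sup>+x. ennreal (p0 x * ?G x) \<partial>restrict_space lborel \<Omega>)
      = (\<integral>\<^sup>+x. ennreal (pp x) * ennreal (\<Sum>i\<in>Basis. (?w \<bullet> Y1 i x)\<^sup>2) \<partial>lborel)"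
    using \<Omega> by (subst nn_integral_restrict_space) (simp_all add: pt)
  also have "\<dots> = (\<integral>\<^sup>+x. ennreal (\<Sum>i\<in>Basis. (?w \<bullet> Y1 i x)\<^sup>2) \<partial>\<mu>)"
    unfolding \<mu>_def using m by (subst nn_integral_density) auto
  also have "\<dots> = ennreal (?w \<bullet> avg \<mu> ?w)"
    unfolding avg_quadratic[OF \<mu>] by (rule nn_integral_eq_integral[OF int]) (simp add: sum_nonneg)
  finally show ?thesis
    unfolding fisher_divergence_def using avg_nonneg[OF \<mu>, of ?w]
    by (simp add: divide_ennreal[symmetric])
qed

lemma evf_diff: "x \<in> \<Omega> \<Longrightarrow> evf f x - evf h x = (f - h) \<bullet> kf x"
  by (simp add: evf_inner inner_diff_left)

lemma evf_bound:
  assumes \<kappa>: "\<And>x. x \<in> \<Omega> \<Longrightarrow> k (x, x) \<le> \<kappa>\<^sup>2" "0 \<le> \<kappa>" and x: "x \<in> \<Omega>"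
  shows "\<bar>f \<bullet> kf x\<bar> \<le> \<kappa> * norm f"
proof -
  have "norm (kf x) \<le> \<kappa>"
    using \<kappa>(1)[OF x] x by (intro power2_le_imp_le[OF _ \<kappa>(2)]) (simp add: k_inner power2_norm_eq_inner)
  then have "norm f * norm (kf x) \<le> norm f * \<kappa>" by (intro mult_left_mono) auto
  then show ?thesis using Cauchy_Schwarz_ineq2[of f "kf x"] by (simp add: mult.commute)
qed

section \<open>Members of the family as exponential tilts of \<open>p0\<close>\<close>

context
  fixes f :: 'h and s :: real
  assumes s: "0 \<le> s"
    and small: "\<And>x. x \<in> \<Omega> \<Longrightarrow> \<bar>(f - f0) \<bullet> kf x\<bar> \<le> s"
begin

text \<open>The function f - f0, extended by 0: up to normalisation the log density ratio of the two
  members.\<close>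

definition tilt :: "'a \<Rightarrow> real" where "tilt x = indicator \<Omega> x *\<^sub>R ((f - f0) \<bullet> kf x)"

lemma tilt_bound: "\<bar>tilt x\<bar> \<le> s"
  using small[of x] s by (simp add: tilt_def indicator_def)

lemma tilt_measurable[measurable]: "tilt \<in> borel_measurable borel"
  unfolding tilt_def[abs_def]
  by (intro borel_measurable_continuous_on_indicator continuous_intros kf_continuous) (simp add: open_\<Omega>)

lemma tilt_integrable: "integrable \<mu> tilt" "integrable \<mu> (\<lambda>x. exp (tilt x))"
  by (rule \<mu>.integrable_const_bound[of _ s], use tilt_bound in \<open>simp_all add: measurable_\<mu>\<close>)
    (rule \<mu>.integrable_const_bound[of _ "exp s"], use tilt_bound in \<open>simp_all add: measurable_\<mu> abs_le_iff\<close>)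

text \<open>The ratio of the partition functions of f and f0, so \<open>tilt_log\<close> is the
  difference of the log-partition values.\<close>

definition tilt_mean :: real where "tilt_mean = (LINT x|\<mu>. exp (tilt x))"
definition tilt_log :: real where "tilt_log = ln tilt_mean"

lemma tilt_mean_bounds: "exp (- s) \<le> tilt_mean" "tilt_mean \<le> exp s"
proof -
  have "(LINT x|\<mu>. exp (- s)) \<le> tilt_mean" unfolding tilt_mean_def
    using tilt_bound by (intro integral_mono tilt_integrable) (auto simp: abs_le_iff minus_le_iff)
  then show "exp (- s) \<le> tilt_mean" using \<mu>.prob_space by simp
  have "tilt_mean \<le> (LINT x|\<mu>. exp s)" unfolding tilt_mean_def
    using tilt_bound by (intro integral_mono tilt_integrable) (auto simp: abs_le_iff)
  then show "tilt_mean \<le> exp s" using \<mu>.prob_space by simp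
qed

lemma tilt_mean_pos: "0 < tilt_mean" using tilt_mean_bounds(1) exp_gt_zero[of "- s"] by linarith

lemma tilt_log_bound: "\<bar>tilt_log\<bar> \<le> s"
proof -
  have "ln (exp (- s)) \<le> ln tilt_mean" "ln tilt_mean \<le> ln (exp s)" using tilt_mean_bounds tilt_mean_pos by (simp_all only: ln_le_cancel_iff exp_gt_zero)
  then show ?thesis by (simp add: tilt_log_def abs_le_iff)
qed

lemma log_partition_tilt: "log_partition \<Omega> q0 evf f = log_partition \<Omega> q0 evf f0 + tilt_log"
proof -
  let ?A = "log_partition \<Omega> q0 evf f0"
  have "(LINT x:\<Omega>|lborel. exp (evf f x) * q0 x) = (LINT x|lborel. exp ?A * (pp x *\<^sub>R exp (tilt x)))"
    unfolding set_lebesgue_integral_def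
  proof (rule Bochner_Integration.integral_cong[OF refl])
    fix x
    show "indicator \<Omega> x *\<^sub>R (exp (evf f x) * q0 x) = exp ?A * (pp x *\<^sub>R exp (tilt x))"
    proof (cases "x \<in> \<Omega>")
      case True
      have "exp (evf f x) = exp ?A * (exp (evf f0 x - ?A) * exp (tilt x))"
        using evf_diff[OF True, of f f0] True by (simp add: tilt_def exp_add[symmetric])
      then show ?thesis using True by (simp add: pp_def p0_eq)
    qed (simp add: pp_def)
  qed
  also have "\<dots> = exp ?A * (LINT x|lborel. pp x *\<^sub>R exp (tilt x))" by simp
  also have "(LINT x|lborel. pp x *\<^sub>R exp (tilt x)) = tilt_mean"
    unfolding tilt_mean_def \<mu>_def by (subst integral_density) (auto simp: pp_nonneg)
  finally show ?thesis
    unfolding log_partition_def[of _ _ _ f] tilt_log_def using tilt_mean_pos by (simp add: ln_mult)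
qed

lemma density_tilt: "x \<in> \<Omega> \<Longrightarrow> exp_family_density \<Omega> q0 evf f x = p0 x * exp (tilt x - tilt_log)"
  using evf_diff[of x f f0]
  by (simp add: exp_family_density_def p0_eq log_partition_tilt tilt_def exp_add[symmetric] algebra_simps)

lemma density_measurable:
  "exp_family_density \<Omega> q0 evf f \<in> borel_measurable (restrict_space lborel \<Omega>)"
  "p0 \<in> borel_measurable (restrict_space lborel \<Omega>)"
proof -
  have "continuous_on \<Omega> (exp_family_density \<Omega> q0 evf f)"
    unfolding exp_family_density_def[abs_def] by (intro continuous_intros evf_continuous q0_continuous)
  from borel_measurable_continuous_on_restrict[OF this] borel_measurable_continuous_on_restrict[OF p0_continuous]
  show "exp_family_density \<Omega> q0 evf f \<in> borel_measurable (restrict_space lborel \<Omega>)"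
    "p0 \<in> borel_measurable (restrict_space lborel \<Omega>)"
    by (simp_all add: measurable_def sets_restrict_space space_restrict_space)
qed

lemma tilt_diff_bound: "\<bar>tilt x - tilt_log\<bar> \<le> 2 * s"
  using tilt_bound[of x] tilt_log_bound by linarith

text \<open>The relative error of the densities is of order s uniformly, and q0 serves as the
  dominating function.\<close>

lemma Lp_norm_tilt:
  assumes B: "\<And>x. x \<in> \<Omega> \<Longrightarrow> p0 x \<le> B * q0 x" "0 \<le> B" and r: "0 < r" and q0: "in_Lp (restrict_space lborel \<Omega>) r q0"
  shows "Lp_norm (restrict_space lborel \<Omega>) r (\<lambda>x. exp_family_density \<Omega> q0 evf f x - p0 x)
    \<le> ennreal (2 * s * exp (2 * s) * B) * Lp_norm (restrict_space lborel \<Omega>) r q0"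
proof (rule Lp_norm_le[OF _ _ r])
  fix x assume "x \<in> space (restrict_space lborel \<Omega>)"
  then have x: "x \<in> \<Omega>" by (simp add: space_restrict_space)
  have "\<bar>exp (tilt x - tilt_log) - 1\<bar> \<le> \<bar>tilt x - tilt_log\<bar> * exp \<bar>tilt x - tilt_log\<bar>" by (rule abs_exp_minus_one_le)
  also have "\<dots> \<le> (2 * s) * exp (2 * s)" using tilt_diff_bound[of x] s by (intro mult_mono) auto
  finally have le: "\<bar>exp (tilt x - tilt_log) - 1\<bar> \<le> (2 * s) * exp (2 * s)" .
  have "\<bar>exp_family_density \<Omega> q0 evf f x - p0 x\<bar> = p0 x * \<bar>exp (tilt x - tilt_log) - 1\<bar>"
  proof -
    have "exp_family_density \<Omega> q0 evf f x - p0 x = p0 x * (exp (tilt x - tilt_log) - 1)"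
      by (simp add: density_tilt[OF x] right_diff_distrib)
    then show ?thesis using p0_nonneg[OF x] by (simp add: abs_mult)
  qed
  also have "\<dots> \<le> (B * q0 x) * ((2 * s) * exp (2 * s))"
    using le B x q0_nonneg[OF x] p0_nonneg[OF x] by (intro mult_mono) auto
  also have "\<dots> = 2 * s * exp (2 * s) * B * \<bar>q0 x\<bar>" using q0_nonneg[OF x] by simp
  finally show "\<bar>exp_family_density \<Omega> q0 evf f x - p0 x\<bar> \<le> 2 * s * exp (2 * s) * B * \<bar>q0 x\<bar>" .
qed (use s B q0 density_measurable in \<open>auto simp: in_Lp_def\<close>)

text \<open>The square root halves the exponent, turning 2 s into s, and the root of p0 has norm
  1.\<close>

lemma hellinger_tilt: "hellinger \<Omega> p0 (exp_family_density \<Omega> q0 evf f) \<le> ennreal (s * exp s)"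
proof -
  let ?M = "restrict_space lborel \<Omega>"
  have \<Omega>: "\<Omega> \<in> sets borel" using open_\<Omega> by simp
  have "(\<integral>\<^sup>+x. ennreal (\<bar>sqrt (p0 x)\<bar> powr 2) \<partial>?M) = (\<integral>\<^sup>+x. ennreal (\<bar>sqrt (p0 x)\<bar> powr 2) * indicator \<Omega> x \<partial>lborel)"
    using \<Omega> by (simp add: nn_integral_restrict_space)
  also have "\<dots> = (\<integral>\<^sup>+x. ennreal (pp x) \<partial>lborel)"
    by (rule nn_integral_cong) (simp add: pp_def indicator_def powr_numeral p0_nonneg)
  also have "\<dots> = emeasure \<mu> (space \<mu>)" unfolding \<mu>_def by (simp add: emeasure_density)
  also have "\<dots> = 1" by (rule \<mu>.emeasure_space_1)
  finally have one: "Lp_norm ?M 2 (\<lambda>x. sqrt (p0 x)) = 1"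
    by (simp add: Lp_norm_def)
  have "hellinger \<Omega> p0 (exp_family_density \<Omega> q0 evf f) \<le> ennreal (s * exp s) * Lp_norm ?M 2 (\<lambda>x. sqrt (p0 x))"
    unfolding hellinger_def
  proof (rule Lp_norm_le)
    fix x assume "x \<in> space ?M"
    then have x: "x \<in> \<Omega>" by (simp add: space_restrict_space)
    have h: "\<bar>(tilt x - tilt_log) / 2\<bar> \<le> s" using tilt_diff_bound[of x] by simp
    have "sqrt (exp (tilt x - tilt_log)) = exp ((tilt x - tilt_log) / 2)"
      by (rule real_sqrt_unique) (simp_all add: power2_eq_square exp_add[symmetric])
    then have "\<bar>sqrt (p0 x) - sqrt (exp_family_density \<Omega> q0 evf f x)\<bar> = \<bar>sqrt (p0 x) * (1 - exp ((tilt x - tilt_log) / 2))\<bar>"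
      by (simp add: density_tilt[OF x] real_sqrt_mult right_diff_distrib)
    also have "\<dots> = \<bar>exp ((tilt x - tilt_log) / 2) - 1\<bar> * \<bar>sqrt (p0 x)\<bar>"
      by (simp add: abs_mult abs_minus_commute)
    also have "\<dots> \<le> (s * exp s) * \<bar>sqrt (p0 x)\<bar>"
    proof (rule mult_right_mono)
      have "\<bar>exp ((tilt x - tilt_log) / 2) - 1\<bar> \<le> \<bar>(tilt x - tilt_log) / 2\<bar> * exp \<bar>(tilt x - tilt_log) / 2\<bar>" by (rule abs_exp_minus_one_le)
      also have "\<dots> \<le> s * exp s" using h s by (intro mult_mono) auto
      finally show "\<bar>exp ((tilt x - tilt_log) / 2) - 1\<bar> \<le> s * exp s" .
    qed simp
    finally show "\<bar>sqrt (p0 x) - sqrt (exp_family_density \<Omega> q0 evf f x)\<bar> \<le> s * exp s * \<bar>sqrt (p0 x)\<bar>" .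
  qed (use s density_measurable one in auto)
  then show ?thesis by (simp add: one)
qed

text \<open>The divergence is the Jensen gap between the log of the mean of exp and the mean of the
  tilt. First-order terms cancel, hence the square of s.\<close>

lemma KL_tilt: "\<bar>KL_div \<Omega> p0 (exp_family_density \<Omega> q0 evf f)\<bar> \<le> ereal (s\<^sup>2 * exp s)"
proof -
  let ?q = "exp_family_density \<Omega> q0 evf f" and ?m = "LINT x|\<mu>. tilt x"
  have eq: "indicator \<Omega> x *\<^sub>R (p0 x * ln (p0 x / ?q x)) = pp x *\<^sub>R (tilt_log - tilt x)" for x
    by (cases "x \<in> \<Omega>"; cases "p0 x = 0") (simp_all add: pp_def density_tilt exp_minus[symmetric] divide_inverse
        mult.assoc[symmetric])
  have AE: "AE x in restrict_space lborel \<Omega>. ?q x = 0 \<longrightarrow> p0 x = 0"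
    by (rule AE_I2) (simp add: space_restrict_space density_tilt)
  have int: "integrable \<mu> (\<lambda>x. tilt_log - tilt x)" using tilt_integrable by simp
  then have "integrable lborel (\<lambda>x. pp x *\<^sub>R (tilt_log - tilt x))"
    unfolding \<mu>_def by (subst (asm) integrable_density) (auto simp: pp_nonneg)
  then have sint: "set_integrable lborel \<Omega> (\<lambda>x. p0 x * ln (p0 x / ?q x))"
    unfolding set_integrable_def eq .
  have "(LINT x:\<Omega>|lborel. p0 x * ln (p0 x / ?q x)) = (LINT x|\<mu>. tilt_log - tilt x)"
    unfolding set_lebesgue_integral_def eq \<mu>_def by (subst integral_density) (auto simp: pp_nonneg)
  also have "\<dots> = tilt_log - ?m" using tilt_integrable \<mu>.prob_space by simp
  finally have KL: "KL_div \<Omega> p0 ?q = ereal (tilt_log - ?m)" using AE sint by (simp add: KL_div_def)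
  \<comment> \<open>Combines log x \<le> x - 1 with the quadratic upper bound for exp.\<close>
  have "tilt_log - ?m \<le> s\<^sup>2 * exp s"
  proof -
    have "tilt_mean \<le> (LINT x|\<mu>. 1 + tilt x + s\<^sup>2 * exp s)"
      unfolding tilt_mean_def
    proof (rule integral_mono)
      fix x
      have "(tilt x)\<^sup>2 \<le> s\<^sup>2" using power_mono[OF tilt_bound[of x], of 2] by simp
      then have "(tilt x)\<^sup>2 * exp \<bar>tilt x\<bar> \<le> s\<^sup>2 * exp s"
        using tilt_bound[of x] by (intro mult_mono) auto
      then show "exp (tilt x) \<le> 1 + tilt x + s\<^sup>2 * exp s" using exp_le_quadratic[of "tilt x"] by linarith
    qed (use tilt_integrable in auto)
    also have "\<dots> = 1 + ?m + s\<^sup>2 * exp s" using tilt_integrable \<mu>.prob_space by simp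
    finally show ?thesis using ln_le_minus_one[OF tilt_mean_pos] by (simp add: tilt_log_def)
  qed
  \<comment> \<open>Jensen through the tangent line of exp at the mean.\<close>
  moreover have "0 \<le> tilt_log - ?m"
  proof -
    have "(LINT x|\<mu>. exp ?m * (1 + tilt x - ?m)) \<le> tilt_mean"
      unfolding tilt_mean_def
    proof (rule integral_mono)
      fix x
      have "exp ?m * (1 + (tilt x - ?m)) \<le> exp ?m * exp (tilt x - ?m)"
        by (intro mult_left_mono exp_ge_add_one_self) simp
      then show "exp ?m * (1 + tilt x - ?m) \<le> exp (tilt x)" by (simp add: exp_add[symmetric] add_diff_eq)
    qed (use tilt_integrable in auto)
    moreover have "(LINT x|\<mu>. exp ?m * (1 + tilt x - ?m)) = exp ?m"
      using tilt_integrable \<mu>.prob_space by simp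
    ultimately have "ln (exp ?m) \<le> ln tilt_mean" using tilt_mean_pos by (simp only: ln_le_cancel_iff exp_gt_zero)
    then show ?thesis by (simp add: tilt_log_def)
  qed
  ultimately show ?thesis unfolding KL by simp
qed

end

lemma avg_posdiag:
  assumes "prob_space \<nu>" "sets \<nu> = sets borel"
  shows "posdiag chi_k (avg \<nu>)"
  unfolding posdiag_def
  using avg_bounded_linear[OF assms] avg_symmetric[OF assms] avg_nonneg[OF assms] avg_le[OF assms] avg_eigenbasis[OF assms]
  by blast

end

section \<open>Convergence rates\<close>

lemma stoch_O_I:
  assumes "\<And>\<delta>. 0 < \<delta> \<Longrightarrow> \<exists>c::real. \<exists>N. \<forall>n\<ge>N. \<exists>E\<in>sets M. measure M E < \<delta> \<and>
    (\<forall>\<omega>\<in>space M - E. \<bar>Z n \<omega>\<bar> \<le> ereal (c * \<theta> n))"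
  shows "stoch_O M Z \<theta>"
  unfolding stoch_O_def
proof (intro allI impI)
  fix \<delta> :: real assume "0 < \<delta>"
  then obtain c :: real and N where cN: "\<And>n. n \<ge> N \<Longrightarrow> \<exists>E\<in>sets M. measure M E < \<delta> \<and>
    (\<forall>\<omega>\<in>space M - E. \<bar>Z n \<omega>\<bar> \<le> ereal (c * \<theta> n))" using assms by metis
  have "\<exists>E\<in>sets M. measure M E < \<delta> \<and> {\<omega>\<in>space M. ereal (c * \<theta> n) < \<bar>Z n \<omega>\<bar>} \<subseteq> E" if n: "n \<ge> N" for n
  proof -
    obtain E where E: "E \<in> sets M" "measure M E < \<delta>" "\<And>\<omega>. \<omega> \<in> space M - E \<Longrightarrow> \<bar>Z n \<omega>\<bar> \<le> ereal (c * \<theta> n)"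
      using cN[OF n] by blast
    have "{\<omega>\<in>space M. ereal (c * \<theta> n) < \<bar>Z n \<omega>\<bar>} \<subseteq> E"
    proof
      fix \<omega> assume \<omega>: "\<omega> \<in> {\<omega>\<in>space M. ereal (c * \<theta> n) < \<bar>Z n \<omega>\<bar>}"
      show "\<omega> \<in> E" by (rule ccontr) (use E(3)[of \<omega>] \<omega> in auto)
    qed
    then show ?thesis using E by blast
  qed
  then show "\<exists>c. \<forall>\<^sub>F n in sequentially. \<exists>E\<in>sets M. measure M E < \<delta> \<and> {\<omega>\<in>space M. ereal (c * \<theta> n) < \<bar>Z n \<omega>\<bar>} \<subseteq> E"
    unfolding eventually_sequentially by blast
qed

text \<open>1/(2(u + 1)) decreases and u/(2(u + 1)) increases in u, so the maximum and the minimum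
  are both attained at the smaller argument.\<close>

lemma rate_exponents:
  fixes x y :: real
  assumes "0 < x" "0 < y"
  shows "max (1 / (2 * (x + 1))) (1 / (2 * (y + 1))) = 1 / (2 * (min x y + 1))"
    and "min (x / (2 * (x + 1))) (y / (2 * (y + 1))) = min x y / (2 * (min x y + 1))"
proof -
  have mono: "1 / (2 * (v + 1)) \<le> 1 / (2 * (u + 1)) \<and> u / (2 * (u + 1)) \<le> v / (2 * (v + 1))"
    if "0 < u" "u \<le> v" for u v :: real
  proof
    show "1 / (2 * (v + 1)) \<le> 1 / (2 * (u + 1))" using that by (intro divide_left_mono) auto
    have "(u * (2 * (v + 1)) - v * (2 * (u + 1))) / (2 * (u + 1) * (2 * (v + 1))) \<le> 0"
    proof (rule divide_nonpos_pos)
      show "u * (2 * (v + 1)) - v * (2 * (u + 1)) \<le> 0" using that by (simp add: algebra_simps)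
      show "0 < 2 * (u + 1) * (2 * (v + 1))" using that by (intro mult_pos_pos) auto
    qed
    then show "u / (2 * (u + 1)) \<le> v / (2 * (v + 1))" using that by (subst frac_le_eq) auto
  qed
  have "max (1 / (2 * (x + 1))) (1 / (2 * (y + 1))) = 1 / (2 * (min x y + 1)) \<and>
    min (x / (2 * (x + 1))) (y / (2 * (y + 1))) = min x y / (2 * (min x y + 1))"
  proof (cases "x \<le> y")
    case True
    show ?thesis using mono[OF assms(1) True] by (simp only: max.absorb1 min.absorb1 True simp_thms)
  next
    case False
    then have "y \<le> x" by simp
    then show ?thesis using mono[OF assms(2), of x] by (simp only: max.absorb2 min.absorb2 simp_thms)
  qed
  then show "max (1 / (2 * (x + 1))) (1 / (2 * (y + 1))) = 1 / (2 * (min x y + 1))"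
    "min (x / (2 * (x + 1))) (y / (2 * (y + 1))) = min x y / (2 * (min x y + 1))" by blast+
qed

lemma enn2ereal_abs_le: "0 \<le> c \<Longrightarrow> x \<le> ennreal c \<Longrightarrow> \<bar>enn2ereal x\<bar> \<le> ereal c"
  by (metis abs_ereal_ge0 enn2ereal_ennreal enn2ereal_nonneg less_eq_ennreal.rep_eq)

locale regularized_family = sampled_family \<Omega> k evf q0 p0 f0 M X + spectral_regularizer "chi \<Omega> k" g Ag Bg Cg \<eta>0 \<gamma>
  for \<Omega> :: "'a::euclidean_space set" and k :: "'a \<times> 'a \<Rightarrow> real"
    and evf :: "'h::{real_inner,banach,second_countable_topology} \<Rightarrow> 'a \<Rightarrow> real"
    and q0 p0 :: "'a \<Rightarrow> real" and f0 :: 'h and M :: "'w measure" and X :: "nat \<Rightarrow> 'w \<Rightarrow> 'a"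
    and g Ag Bg Cg \<eta>0 \<gamma>
begin

abbreviation err :: "real \<Rightarrow> nat \<Rightarrow> 'w \<Rightarrow> 'h" where
  "err l n \<omega> \<equiv> estimator \<Omega> k evf q0 (g l) n (\<lambda>a. X a \<omega>) - f0"

lemma pop_posdiag: "posdiag chi_k (avg \<mu>)"
  by (rule avg_posdiag[OF \<mu>.prob_space_axioms sets_\<mu>])

text \<open>The event and the data \<open>T\<close>, \<open>\<xi>\<close> are fixed before the
  parameter l; the deterministic bounds can then be applied with l = \<open>lam n\<close>.\<close>

lemma sample_control:
  assumes "0 < \<delta>"
  shows "\<exists>K>0. \<forall>n\<ge>1. \<exists>E\<in>sets M. measure M E < \<delta> \<and> (\<forall>\<omega>\<in>space M - E. \<exists>T \<xi>.
    close_data chi_k (avg \<mu>) f0 (K * real n powr (- (1/2))) T \<xi> \<and> (\<forall>l. err l n \<omega> = - op_fun (g l) T \<xi> - f0))"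
proof -
  from stochastic_control[OF basis_of_orthonormal[OF pop_posdiag] assms] obtain K where K: "0 < K" and
    ctrl: "\<forall>n\<ge>1. \<exists>E\<in>sets M. measure M E < \<delta> \<and> (\<forall>\<omega>\<in>space M - E. (\<forall>a. X a \<omega> \<in> P) \<and>
    norm ((1 / real n) *\<^sub>R (\<Sum>a<n. score (X a \<omega>))) \<le> K / sqrt n \<and>
    (\<forall>F. finite F \<longrightarrow> F \<subseteq> basis_of (avg \<mu>) \<longrightarrow> (\<Sum>\<phi>\<in>F. (norm (emp n \<omega> \<phi> - avg \<mu> \<phi>))\<^sup>2) \<le> (K / sqrt n)\<^sup>2))"
    by (elim exE conjE)
  have main: "\<exists>T \<xi>. close_data chi_k (avg \<mu>) f0 (K * real n powr (- (1/2))) T \<xi> \<and>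
      (\<forall>l. err l n \<omega> = - op_fun (g l) T \<xi> - f0)"
    if n: "1 \<le> n" and xs: "\<forall>a. X a \<omega> \<in> P" and sc: "norm ((1 / real n) *\<^sub>R (\<Sum>a<n. score (X a \<omega>))) \<le> K / sqrt n"
      and HS: "\<forall>F. finite F \<longrightarrow> F \<subseteq> basis_of (avg \<mu>) \<longrightarrow> (\<Sum>\<phi>\<in>F. (norm (emp n \<omega> \<phi> - avg \<mu> \<phi>))\<^sup>2) \<le> (K / sqrt n)\<^sup>2"
    for n \<omega>
  proof (intro exI conjI allI)
    let ?xs = "\<lambda>a. X a \<omega>"
    have n0: "0 < n" and xs': "\<And>a. ?xs a \<in> P" using n xs by auto
    have K_eq: "K / sqrt n = K * real n powr (- (1/2))"
      by (simp only: powr_minus powr_half_sqrt[OF of_nat_0_le_iff]) (rule divide_inverse)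
    have emp_eq: "emp_op \<Omega> k evf n ?xs = emp n \<omega>" unfolding emp_def by (rule emp_op_avg[OF n0 xs'])
    show "close_data chi_k (avg \<mu>) f0 (K * real n powr (- (1/2))) (emp n \<omega>) (emp_xi \<Omega> k evf q0 n ?xs)"
      unfolding close_data_def
    proof (intro conjI)
      show "posdiag chi_k (emp n \<omega>)" unfolding emp_def by (rule avg_posdiag[OF emp_measure])
      show "norm (emp_xi \<Omega> k evf q0 n ?xs + emp n \<omega> f0) \<le> K * real n powr (- (1/2))"
        using sc emp_xi_score[of n ?xs, OF n0 xs'] unfolding emp_eq K_eq by simp
    qed (use HS in \<open>simp only: K_eq\<close>)
    show "err l n \<omega> = - op_fun (g l) (emp n \<omega>) (emp_xi \<Omega> k evf q0 n ?xs) - f0" for l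
      by (simp add: estimator_def emp_eq)
  qed
  show ?thesis
  proof (intro exI[of _ K] conjI K allI impI)
    fix n :: nat assume n: "1 \<le> n"
    from ctrl[rule_format, OF n] obtain E where E: "E \<in> sets M" "measure M E < \<delta>" and
      ctrl': "\<forall>\<omega>\<in>space M - E. (\<forall>a. X a \<omega> \<in> P) \<and>
        norm ((1 / real n) *\<^sub>R (\<Sum>a<n. score (X a \<omega>))) \<le> K / sqrt n \<and>
        (\<forall>F. finite F \<longrightarrow> F \<subseteq> basis_of (avg \<mu>) \<longrightarrow> (\<Sum>\<phi>\<in>F. (norm (emp n \<omega> \<phi> - avg \<mu> \<phi>))\<^sup>2) \<le> (K / sqrt n)\<^sup>2)"
      by (elim bexE conjE)
    show "\<exists>E\<in>sets M. measure M E < \<delta> \<and> (\<forall>\<omega>\<in>space M - E. \<exists>T \<xi>.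
      close_data chi_k (avg \<mu>) f0 (K * real n powr (- (1/2))) T \<xi> \<and> (\<forall>l. err l n \<omega> = - op_fun (g l) T \<xi> - f0))"
    proof (intro bexI[of _ E] conjI ballI E)
      fix \<omega> assume "\<omega> \<in> space M - E"
      from ctrl'[rule_format, OF this]
      show "\<exists>T \<xi>. close_data chi_k (avg \<mu>) f0 (K * real n powr (- (1/2))) T \<xi> \<and>
        (\<forall>l. err l n \<omega> = - op_fun (g l) T \<xi> - f0)"
        by (elim conjE) (rule main[OF n])
    qed
  qed
qed

lemma error_bounds:
  assumes b: "0 \<le> b" "b \<le> \<eta>0" "b \<le> \<beta>" and f0: "f0 \<in> range (op_powr (avg \<mu>) \<beta>)"
    and lam_eq: "\<forall>n\<ge>1. lam n = real n powr (- (1 / (2 * (b + 1))))" and \<delta>: "0 < \<delta>"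
  shows "\<exists>K\<ge>0. \<forall>n\<ge>1. \<exists>E\<in>sets M. measure M E < \<delta> \<and> (\<forall>\<omega>\<in>space M - E.
    norm (err (lam n) n \<omega>) \<le> K * lam n powr b \<and>
    (b + 1/2 \<le> \<eta>0 \<longrightarrow> err (lam n) n \<omega> \<bullet> avg \<mu> (err (lam n) n \<omega>) \<le> K * lam n powr (2 * b + 1)))"
proof -
  note lam = lam_eq[rule_format]
  from op_powr_range_shifted[OF pop_posdiag b(1,3) f0] obtain R where R: "0 \<le> R" and
    source: "\<forall>lam. 0 < lam \<longrightarrow> lam \<le> 1 \<longrightarrow> (\<exists>h. norm h \<le> R \<and> f0 = op_fun (\<lambda>a. (a + lam) powr b) (avg \<mu>) h)"
    by (elim exE conjE)
  from sample_control[OF \<delta>] obtain K where K: "0 < K" and ctrl: "\<forall>n\<ge>1. \<exists>E\<in>sets M. measure M E < \<delta> \<and>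
    (\<forall>\<omega>\<in>space M - E. \<exists>T \<xi>. close_data chi_k (avg \<mu>) f0 (K * real n powr (- (1/2))) T \<xi> \<and>
      (\<forall>l. err l n \<omega> = - op_fun (g l) T \<xi> - f0))"
    by (elim exE conjE)
  from deterministic_rates[OF pop_posdiag chi_nonneg b(1,2) K R source] obtain k' where k': "0 \<le> k'" and
    rates: "\<forall>lam T \<xi>. 0 < lam \<longrightarrow> lam \<le> 1 \<longrightarrow> close_data chi_k (avg \<mu>) f0 (K * lam powr (b + 1)) T \<xi> \<longrightarrow>
    (let w = - op_fun (g lam) T \<xi> - f0 in
      norm w \<le> k' * lam powr b \<and> (b + 1/2 \<le> \<eta>0 \<longrightarrow> w \<bullet> avg \<mu> w \<le> k' * lam powr (2 * b + 1)))"
    by (elim exE conjE)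
  show ?thesis
  proof (intro exI[of _ k'] conjI k' allI impI)
    fix n :: nat assume n: "1 \<le> n"
    have l: "0 < lam n" "lam n \<le> 1"
      using n b by (auto simp: lam powr_minus_divide ge_one_powr_ge_zero)
    \<comment> \<open>The balancing identity: the sampling error n^(-1/2) is \<lambda>^(b +
      1).\<close>
    have "lam n powr (b + 1) = real n powr (- (1 / (2 * (b + 1))) * (b + 1))"
      using n by (simp only: lam powr_powr)
    also have "- (1 / (2 * (b + 1))) * (b + 1) = - (1/2)" using b by (simp add: field_simps)
    finally have e: "real n powr (- (1/2)) = lam n powr (b + 1)" ..
    from ctrl[rule_format, OF n] obtain E where E: "E \<in> sets M" "measure M E < \<delta>" and ctrl':
      "\<forall>\<omega>\<in>space M - E. \<exists>T \<xi>. close_data chi_k (avg \<mu>) f0 (K * real n powr (- (1/2))) T \<xi> \<and>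
        (\<forall>l. err l n \<omega> = - op_fun (g l) T \<xi> - f0)"
      by (elim bexE conjE)
    show "\<exists>E\<in>sets M. measure M E < \<delta> \<and> (\<forall>\<omega>\<in>space M - E. norm (err (lam n) n \<omega>) \<le> k' * lam n powr b \<and>
      (b + 1/2 \<le> \<eta>0 \<longrightarrow> err (lam n) n \<omega> \<bullet> avg \<mu> (err (lam n) n \<omega>) \<le> k' * lam n powr (2 * b + 1)))"
    proof (rule bexI[of _ E], rule conjI, rule E(2), rule ballI)
      fix \<omega> assume "\<omega> \<in> space M - E"
      from ctrl'[rule_format, OF this] obtain T \<xi> where
        T: "close_data chi_k (avg \<mu>) f0 (K * real n powr (- (1/2))) T \<xi>" and
        err: "\<forall>l. err l n \<omega> = - op_fun (g l) T \<xi> - f0" by (elim exE conjE)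
      show "norm (err (lam n) n \<omega>) \<le> k' * lam n powr b \<and>
        (b + 1/2 \<le> \<eta>0 \<longrightarrow> err (lam n) n \<omega> \<bullet> avg \<mu> (err (lam n) n \<omega>) \<le> k' * lam n powr (2 * b + 1))"
        using rates[rule_format, OF l T[unfolded e]] unfolding Let_def err[rule_format] .
    qed (rule E(1))
  qed
qed

text \<open>The lower bound on the empirical spectrum requires a small perturbation, so the estimate
  starts at an N where n^(-1/2) has dropped below the threshold s.\<close>

lemma error_bounds_invertible:
  assumes inv: "boundedly_invertible (avg \<mu>)" and \<eta>: "1 \<le> \<eta>0"
    and lam_eq: "\<forall>n\<ge>1. lam n = real n powr (- (1/2))" and \<delta>: "0 < \<delta>"
  shows "\<exists>K\<ge>0. \<exists>N. \<forall>n\<ge>N. \<exists>E\<in>sets M. measure M E < \<delta> \<and> (\<forall>\<omega>\<in>space M - E.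
    norm (err (lam n) n \<omega>) \<le> K * real n powr (- (1/2)))"
proof -
  note lam = lam_eq[rule_format]
  let ?s = "\<lambda>n. real n powr (- (1/2))"
  from sample_control[OF \<delta>] obtain K where K: "0 < K" and ctrl: "\<forall>n\<ge>1. \<exists>E\<in>sets M. measure M E < \<delta> \<and>
    (\<forall>\<omega>\<in>space M - E. \<exists>T \<xi>. close_data chi_k (avg \<mu>) f0 (K * ?s n) T \<xi> \<and>
      (\<forall>l. err l n \<omega> = - op_fun (g l) T \<xi> - f0))"
    by (elim exE conjE)
  from deterministic_rates_invertible[OF pop_posdiag inv \<eta> K, of f0] obtain k' s where
    k': "0 \<le> k'" and s: "0 < s" and rates: "\<forall>S T \<xi>. 0 < S \<longrightarrow> S \<le> s \<longrightarrow>
      close_data chi_k (avg \<mu>) f0 (K * S) T \<xi> \<longrightarrow> norm (- op_fun (g S) T \<xi> - f0) \<le> k' * S"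
    by (elim exE conjE)
  have "?s \<longlonglongrightarrow> 0" by (rule tendsto_neg_powr) (auto intro: filterlim_real_sequentially)
  then have "\<forall>\<^sub>F n in sequentially. ?s n < s" using s by (rule order_tendstoD)
  then obtain N where N: "\<And>n. n \<ge> N \<Longrightarrow> ?s n < s" unfolding eventually_sequentially by auto
  show ?thesis
  proof (rule exI[of _ k'], rule conjI[OF k' exI[of _ "max 1 N"]], intro allI impI)
    fix n :: nat assume n: "max 1 N \<le> n"
    have n1: "1 \<le> n" and S: "0 < ?s n" "?s n \<le> s" using n N[of n] by auto
    from ctrl[rule_format, OF n1] obtain E where E: "E \<in> sets M" "measure M E < \<delta>" and ctrl':
      "\<forall>\<omega>\<in>space M - E. \<exists>T \<xi>. close_data chi_k (avg \<mu>) f0 (K * ?s n) T \<xi> \<and>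
        (\<forall>l. err l n \<omega> = - op_fun (g l) T \<xi> - f0)"
      by (elim bexE conjE)
    show "\<exists>E\<in>sets M. measure M E < \<delta> \<and> (\<forall>\<omega>\<in>space M - E. norm (err (lam n) n \<omega>) \<le> k' * ?s n)"
    proof (rule bexI[of _ E], rule conjI, rule E(2), rule ballI)
      fix \<omega> assume "\<omega> \<in> space M - E"
      from ctrl'[rule_format, OF this] obtain T \<xi> where
        T: "close_data chi_k (avg \<mu>) f0 (K * ?s n) T \<xi>" and
        err: "\<forall>l. err l n \<omega> = - op_fun (g l) T \<xi> - f0" by (elim exE conjE)
      show "norm (err (lam n) n \<omega>) \<le> k' * ?s n"
        using rates[rule_format, OF S T] unfolding err[rule_format] lam[OF n1] .
    qed (rule E(1))
  qed
qed

lemma kernel_bound: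
  assumes "bdd_above ((\<lambda>x. k (x, x)) ` \<Omega>)"
  obtains \<kappa> where "0 \<le> \<kappa>" "\<And>x f. x \<in> \<Omega> \<Longrightarrow> \<bar>f \<bullet> kf x\<bar> \<le> \<kappa> * norm f"
proof -
  obtain b where b: "\<And>x. x \<in> \<Omega> \<Longrightarrow> k (x, x) \<le> b" using assms by (auto simp: bdd_above_def)
  have "k (x, x) \<le> (sqrt \<bar>b\<bar>)\<^sup>2" if "x \<in> \<Omega>" for x using b[OF that] by simp
  then show ?thesis using that[of "sqrt \<bar>b\<bar>"] evf_bound[of "sqrt \<bar>b\<bar>"] by simp
qed

text \<open>The constants are uniform in f and t, so they can be used at every sample point and
  every n. The restriction t \<le> 1 keeps the exponential factors bounded.\<close>

lemma distance_bounds: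
  assumes k_bdd: "bdd_above ((\<lambda>x. k (x, x)) ` \<Omega>)" and K: "0 \<le> K"
  shows "\<exists>c\<ge>0. \<forall>f t. 0 \<le> t \<longrightarrow> t \<le> 1 \<longrightarrow> norm (f - f0) \<le> K * t \<longrightarrow>
      hellinger \<Omega> p0 (exp_family_density \<Omega> q0 evf f) \<le> ennreal (c * t) \<and>
      \<bar>KL_div \<Omega> p0 (exp_family_density \<Omega> q0 evf f)\<bar> \<le> ereal (c * t\<^sup>2)"
    and "0 < r \<Longrightarrow> in_Lp (restrict_space lborel \<Omega>) r q0 \<Longrightarrow>
      \<exists>c\<ge>0. \<forall>f t. 0 \<le> t \<longrightarrow> t \<le> 1 \<longrightarrow> norm (f - f0) \<le> K * t \<longrightarrow>
      Lp_norm (restrict_space lborel \<Omega>) r (\<lambda>x. exp_family_density \<Omega> q0 evf f x - p0 x) \<le> ennreal (c * t)"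
proof -
  obtain \<kappa> where \<kappa>: "0 \<le> \<kappa>" "\<And>x f. x \<in> \<Omega> \<Longrightarrow> \<bar>f \<bullet> kf x\<bar> \<le> \<kappa> * norm f" by (rule kernel_bound[OF k_bdd]) (rule that)
  define u where "u = \<kappa> * K"
  have u: "0 \<le> u" using \<kappa> K by (simp add: u_def)
  have s: "0 \<le> u * t" "u * t \<le> u" "\<And>x. x \<in> \<Omega> \<Longrightarrow> \<bar>(f - f0) \<bullet> kf x\<bar> \<le> u * t"
    if "0 \<le> t" "t \<le> 1" "norm (f - f0) \<le> K * t" for f t
  proof -
    show "0 \<le> u * t" "u * t \<le> u" using u that by (auto intro: mult_left_le)
    show "\<bar>(f - f0) \<bullet> kf x\<bar> \<le> u * t" if x: "x \<in> \<Omega>" for x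
    proof -
      have "\<kappa> * norm (f - f0) \<le> \<kappa> * (K * t)" using \<kappa>(1) \<open>norm (f - f0) \<le> K * t\<close> by (intro mult_left_mono)
      then show ?thesis using \<kappa>(2)[OF x, of "f - f0"] by (simp add: u_def mult.assoc)
    qed
  qed
  show "\<exists>c\<ge>0. \<forall>f t. 0 \<le> t \<longrightarrow> t \<le> 1 \<longrightarrow> norm (f - f0) \<le> K * t \<longrightarrow>
      hellinger \<Omega> p0 (exp_family_density \<Omega> q0 evf f) \<le> ennreal (c * t) \<and>
      \<bar>KL_div \<Omega> p0 (exp_family_density \<Omega> q0 evf f)\<bar> \<le> ereal (c * t\<^sup>2)"
  \<comment> \<open>The sum of the two constants serves the Hellinger and the Kullback--Leibler
    bound at once.\<close>
  proof (intro exI[of _ "u * exp u + u\<^sup>2 * exp u"] conjI allI impI)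
    fix f t assume t: "0 \<le> t" "t \<le> 1" "norm (f - f0) \<le> K * t"
    note S = s[OF t]
    have "u * t * exp (u * t) \<le> u * t * exp u" using S by (intro mult_left_mono) auto
    also have "\<dots> = (u * exp u) * t" by simp
    also have "\<dots> \<le> (u * exp u + u\<^sup>2 * exp u) * t" using t by (intro mult_right_mono) auto
    finally have "ennreal (u * t * exp (u * t)) \<le> ennreal ((u * exp u + u\<^sup>2 * exp u) * t)" by (rule ennreal_leI)
    then show "hellinger \<Omega> p0 (exp_family_density \<Omega> q0 evf f) \<le> ennreal ((u * exp u + u\<^sup>2 * exp u) * t)"
      using hellinger_tilt[OF S(1,3)] by (rule order_trans[rotated])
    have "(u * t)\<^sup>2 * exp (u * t) \<le> (u * t)\<^sup>2 * exp u" using S by (intro mult_left_mono) auto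
    also have "\<dots> = (u\<^sup>2 * exp u) * t\<^sup>2" by (simp add: power_mult_distrib)
    also have "\<dots> \<le> (u * exp u + u\<^sup>2 * exp u) * t\<^sup>2" using u by (intro mult_right_mono) auto
    finally have "ereal ((u * t)\<^sup>2 * exp (u * t)) \<le> ereal ((u * exp u + u\<^sup>2 * exp u) * t\<^sup>2)" by simp
    then show "\<bar>KL_div \<Omega> p0 (exp_family_density \<Omega> q0 evf f)\<bar> \<le> ereal ((u * exp u + u\<^sup>2 * exp u) * t\<^sup>2)"
      using KL_tilt[OF S(1,3)] by (rule order_trans[rotated])
  qed (use u in auto)
  assume r: "0 < r" and q0: "in_Lp (restrict_space lborel \<Omega>) r q0"
  \<comment> \<open>A bounded kernel bounds f0 on the domain, so p0 is at most a constant times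
    q0.\<close>
  define B where "B = exp (\<kappa> * norm f0 - log_partition \<Omega> q0 evf f0)"
  have B: "p0 x \<le> B * q0 x" if x: "x \<in> \<Omega>" for x
    unfolding p0_eq B_def using \<kappa>(2)[OF x, of f0] q0_nonneg[OF x] x
    by (intro mult_right_mono) (auto simp: evf_inner abs_le_iff)
  define N where "N = enn2real (Lp_norm (restrict_space lborel \<Omega>) r q0)"
  have N: "Lp_norm (restrict_space lborel \<Omega>) r q0 = ennreal N" "0 \<le> N"
    using q0 by (auto simp: N_def in_Lp_def less_top)
  show "\<exists>c\<ge>0. \<forall>f t. 0 \<le> t \<longrightarrow> t \<le> 1 \<longrightarrow> norm (f - f0) \<le> K * t \<longrightarrow>
      Lp_norm (restrict_space lborel \<Omega>) r (\<lambda>x. exp_family_density \<Omega> q0 evf f x - p0 x) \<le> ennreal (c * t)"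
  proof (intro exI[of _ "2 * u * exp (2 * u) * B * N"] conjI allI impI)
    fix f t assume t: "0 \<le> t" "t \<le> 1" "norm (f - f0) \<le> K * t"
    note S = s[OF t]
    have B0: "0 \<le> B" by (simp add: B_def)
    have "Lp_norm (restrict_space lborel \<Omega>) r (\<lambda>x. exp_family_density \<Omega> q0 evf f x - p0 x)
        \<le> ennreal (2 * (u * t) * exp (2 * (u * t)) * B) * ennreal N"
      using Lp_norm_tilt[OF S(1,3) B B0 r q0] by (simp add: N)
    also have "\<dots> = ennreal (2 * (u * t) * exp (2 * (u * t)) * B * N)"
      using S B0 N by (simp add: ennreal_mult)
    also have "\<dots> \<le> ennreal (2 * (u * t) * exp (2 * u) * B * N)"
      using S B0 N by (intro ennreal_leI mult_right_mono mult_left_mono) auto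
    also have "2 * (u * t) * exp (2 * u) * B * N = 2 * u * exp (2 * u) * B * N * t" by simp
    finally show "Lp_norm (restrict_space lborel \<Omega>) r (\<lambda>x. exp_family_density \<Omega> q0 evf f x - p0 x)
        \<le> ennreal (2 * u * exp (2 * u) * B * N * t)" .
  qed (use u N in \<open>auto simp: B_def\<close>)
qed

end

theorem theorem8:
  fixes \<Omega> :: "'a::euclidean_space set"
    and k :: "'a \<times> 'a \<Rightarrow> real"
    and evf :: "'h::{real_inner,banach,second_countable_topology} \<Rightarrow> 'a \<Rightarrow> real"
    and q0 p0 :: "'a \<Rightarrow> real"
    and f0 :: 'h
    and g :: "real \<Rightarrow> real \<Rightarrow> real"
    and Ag Bg Cg \<eta>0 :: real
    and \<gamma> :: "real \<Rightarrow> real"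
    and M :: "'w measure"
    and X :: "nat \<Rightarrow> 'w \<Rightarrow> 'a"
    and lam :: "nat \<Rightarrow> real"
    and C :: "'h \<Rightarrow> 'h"
    and fhat :: "nat \<Rightarrow> 'w \<Rightarrow> 'h"
    and phat :: "nat \<Rightarrow> 'w \<Rightarrow> 'a \<Rightarrow> real"
  assumes q0_density: "prob_density_on \<Omega> q0"
    and rkhs: "rkhs \<Omega> k evf"
    and f0: "f0 \<in> exp_family_domain \<Omega> q0 evf"
    and p0: "p0 = exp_family_density \<Omega> q0 evf f0"
    and assm_A: "domain_assm \<Omega>"
    and assm_B: "smoothness_assm \<Omega> k p0"
    and assm_C: "boundary_assm \<Omega> k p0"
    and assm_D: "integrability_assm 2 \<Omega> k q0 p0"
    and assm_E: "regularizer_assm \<Omega> k g Ag Bg Cg \<eta>0 \<gamma>"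
    and M: "prob_space M"
    and indep: "prob_space.indep_vars M (\<lambda>_. borel) X UNIV"
    and distr: "\<And>a. distributed M lborel (X a) (\<lambda>x. ennreal (p0 x) * indicator \<Omega> x)"
    and lam: "\<And>n. n \<ge> 1 \<Longrightarrow> lam n \<ge> real n powr (- (1/2))"
    and C: "C = pop_op \<Omega> k evf p0"
    and fhat: "\<And>n \<omega>. fhat n \<omega> = estimator \<Omega> k evf q0 (g (lam n)) n (\<lambda>a. X a \<omega>)"
    and phat: "\<And>n \<omega>. phat n \<omega> = exp_family_density \<Omega> q0 evf (fhat n \<omega>)"
  shows
    "(\<forall>\<beta>>0. \<forall>\<theta>.
        f0 \<in> range (op_powr C \<beta>) \<and>
        (\<forall>n\<ge>1. lam n = real n powr (- max (1 / (2 * (\<beta> + 1))) (1 / (2 * (\<eta>0 + 1))))) \<and>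
        (\<forall>n. \<theta> n = real n powr (- min (\<beta> / (2 * (\<beta> + 1))) (\<eta>0 / (2 * (\<eta>0 + 1)))))
        \<longrightarrow>
        stoch_O M (\<lambda>n \<omega>. ereal (norm (fhat n \<omega> - f0))) \<theta> \<and>
        (bdd_above ((\<lambda>x. k (x, x)) ` \<Omega>) \<longrightarrow>
          (\<forall>r::ennreal. 1 < r \<and>
             in_Lp (restrict_space lborel \<Omega>) 1 q0 \<and> in_Lp (restrict_space lborel \<Omega>) r q0 \<longrightarrow>
             stoch_O M (\<lambda>n \<omega>. enn2ereal
               (Lp_norm (restrict_space lborel \<Omega>) r (\<lambda>x. phat n \<omega> x - p0 x))) \<theta>) \<and>
          stoch_O M (\<lambda>n \<omega>. enn2ereal (hellinger \<Omega> p0 (phat n \<omega>))) \<theta> \<and>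
          stoch_O M (\<lambda>n \<omega>. KL_div \<Omega> p0 (phat n \<omega>)) (\<lambda>n. (\<theta> n)\<^sup>2)))
     \<and>
     (\<forall>\<beta>\<ge>0.
        f0 \<in> range (op_powr C \<beta>) \<and>
        (\<forall>n\<ge>1. lam n = real n powr (- (1 / min (2 * \<beta> + 2) (2 * \<eta>0 + 1))))
        \<longrightarrow>
        stoch_O M (\<lambda>n \<omega>. enn2ereal (fisher_divergence \<Omega> p0 (phat n \<omega>)))
          (\<lambda>n. real n powr (- (min (2 * \<beta> + 1) (2 * \<eta>0) / min (2 * \<beta> + 2) (2 * \<eta>0 + 1)))))
     \<and>
     (\<forall>\<theta>.
        boundedly_invertible C \<and>
        (\<forall>n\<ge>1. lam n = real n powr (- (1 / min 2 (2 * \<eta>0)))) \<and>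
        (\<forall>n. \<theta> n = real n powr (- (1/2)))
        \<longrightarrow>
        stoch_O M (\<lambda>n \<omega>. ereal (norm (fhat n \<omega> - f0))) \<theta> \<and>
        stoch_O M (\<lambda>n \<omega>. enn2ereal (fisher_divergence \<Omega> p0 (phat n \<omega>))) (\<lambda>n. (\<theta> n)\<^sup>2))"
proof -
  interpret M: prob_space M by (rule M)
  have diag: "bdd_above (diag_values \<Omega> k)" using assm_E by (simp add: regularizer_assm_def)
  have "distr M lborel (X 0) = density lborel (\<lambda>x. ennreal (p0 x) * indicator \<Omega> x)"
    by (rule distributed_distr_eq_density[OF distr])
  moreover have "X 0 \<in> M \<rightarrow>\<^sub>M lborel" by (rule distributed_measurable[OF distr])
  ultimately have p0_prob: "prob_space (density lborel (\<lambda>x. ennreal (p0 x) * indicator \<Omega> x))"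
    using M.prob_space_distr by metis
  interpret score_family \<Omega> k evf q0 p0 f0
  proof (intro score_family.intro smooth_rkhs.intro score_family_axioms.intro)
    show "open \<Omega>" using assm_A by (simp add: domain_assm_def)
    show "0 \<le> q0 x" if "x \<in> \<Omega>" for x using q0_density that by (simp add: prob_density_on_def)
    show "iter_pd_exists (\<Omega> \<times> \<Omega>) (diag_dirs bs) k" "continuous_on (\<Omega> \<times> \<Omega>) (iter_pd (diag_dirs bs) k)"
      if "set bs \<subseteq> Basis" "length bs \<le> 2" for bs
      using assm_B that unfolding smoothness_assm_def by blast+
  qed (fact rkhs p0 p0_prob assm_B assm_C assm_D diag)+
  interpret regularized_family \<Omega> k evf q0 p0 f0 M X g Ag Bg Cg \<eta>0 \<gamma>
  proof (unfold_locales)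
    show "distr M borel (X a) = \<mu>" for a
      using distributed_distr_eq_density[OF distr, of a] unfolding \<mu>_eq[symmetric]
      by (metis distr_cong sets_lborel)
  qed (use indep assm_E in \<open>auto simp: regularizer_assm_def\<close>)
  have C: "C = avg \<mu>" unfolding C by (rule pop_op_avg)
  have err: "fhat n \<omega> - f0 = err (lam n) n \<omega>" for n \<omega> by (simp add: fhat)
  have fisher: "\<bar>enn2ereal (fisher_divergence \<Omega> p0 (phat n \<omega>))\<bar> \<le> ereal c"
    if "(fhat n \<omega> - f0) \<bullet> avg \<mu> (fhat n \<omega> - f0) \<le> c" for n \<omega> c
  proof -
    have nn: "0 \<le> (fhat n \<omega> - f0) \<bullet> avg \<mu> (fhat n \<omega> - f0)"
      by (rule avg_nonneg[OF \<mu>.prob_space_axioms sets_\<mu>])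
    then show ?thesis
      unfolding phat fisher_divergence_eq using that by (intro enn2ereal_abs_le ennreal_leI) auto
  qed
  show ?thesis
  proof (intro conjI allI impI; (elim conjE)?)

    \<comment> \<open>Rates in the norm and, for bounded kernels, in the distances between
      densities\<close>
    fix \<beta> :: real and \<theta>
    assume \<beta>: "0 < \<beta>" and src: "f0 \<in> range (op_powr C \<beta>)"
      and lam_eq: "\<forall>n\<ge>1. lam n = real n powr (- max (1 / (2 * (\<beta> + 1))) (1 / (2 * (\<eta>0 + 1))))"
      and \<theta>: "\<forall>n. \<theta> n = real n powr (- min (\<beta> / (2 * (\<beta> + 1))) (\<eta>0 / (2 * (\<eta>0 + 1))))"
    define b where "b = min \<beta> \<eta>0"
    have b: "0 \<le> b" "b \<le> \<eta>0" "b \<le> \<beta>" using \<beta> pos(4) by (auto simp: b_def)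
    have exps: "max (1 / (2 * (\<beta> + 1))) (1 / (2 * (\<eta>0 + 1))) = 1 / (2 * (b + 1))"
      "min (\<beta> / (2 * (\<beta> + 1))) (\<eta>0 / (2 * (\<eta>0 + 1))) = b / (2 * (b + 1))"
      unfolding b_def by (rule rate_exponents[OF \<beta> pos(4)])+
    have lam': "\<forall>n\<ge>1. lam n = real n powr (- (1 / (2 * (b + 1))))"
      using lam_eq unfolding exps .
    have rate: "lam n powr b = \<theta> n" if "n \<ge> 1" for n
      unfolding lam'[rule_format, OF that] \<theta>[rule_format] exps powr_powr by simp
    have \<theta>01: "0 \<le> \<theta> n" "\<theta> n \<le> 1" if "n \<ge> 1" for n
      using that b by (auto simp: \<theta>[rule_format] exps powr_minus_divide ge_one_powr_ge_zero)
    have bound: "\<exists>K\<ge>0. \<forall>n\<ge>1. \<exists>E\<in>sets M. measure M E < \<delta> \<and> (\<forall>\<omega>\<in>space M - E. norm (fhat n \<omega> - f0) \<le> K * \<theta> n)"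
      if "0 < \<delta>" for \<delta>
    proof -
      from error_bounds[OF b src[unfolded C] lam' that] obtain K where K: "0 \<le> K" and
        bd: "\<forall>n\<ge>1. \<exists>E\<in>sets M. measure M E < \<delta> \<and> (\<forall>\<omega>\<in>space M - E. norm (err (lam n) n \<omega>) \<le> K * lam n powr b \<and>
          (b + 1/2 \<le> \<eta>0 \<longrightarrow> err (lam n) n \<omega> \<bullet> avg \<mu> (err (lam n) n \<omega>) \<le> K * lam n powr (2 * b + 1)))"
        by (elim exE conjE)
      show ?thesis
      proof (intro exI[of _ K] conjI K allI impI)
        fix n :: nat assume n: "1 \<le> n"
        show "\<exists>E\<in>sets M. measure M E < \<delta> \<and> (\<forall>\<omega>\<in>space M - E. norm (fhat n \<omega> - f0) \<le> K * \<theta> n)"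
          using bd[rule_format, OF n] unfolding err rate[OF n] by (elim bexE conjE, intro bexI conjI ballI) auto
      qed
    qed
    show "stoch_O M (\<lambda>n \<omega>. ereal (norm (fhat n \<omega> - f0))) \<theta>"
    proof (rule stoch_O_I)
      fix \<delta> :: real assume "0 < \<delta>"
      from bound[OF this] show "\<exists>c N. \<forall>n\<ge>N. \<exists>E\<in>sets M. measure M E < \<delta> \<and>
        (\<forall>\<omega>\<in>space M - E. \<bar>ereal (norm (fhat n \<omega> - f0))\<bar> \<le> ereal (c * \<theta> n))" by auto
    qed
    assume k_bdd: "bdd_above ((\<lambda>x. k (x, x)) ` \<Omega>)"
    \<comment> \<open>Each distance is bounded deterministically by the norm error, so the
      exceptional events found for the norm serve again.\<close>
    have transfer: "stoch_O M Z \<theta>'"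
      if Z: "\<And>K. 0 \<le> K \<Longrightarrow> \<exists>c. \<forall>n\<ge>1. \<forall>\<omega>. norm (fhat n \<omega> - f0) \<le> K * \<theta> n \<longrightarrow> \<bar>Z n \<omega>\<bar> \<le> ereal (c * \<theta>' n)"
      for Z \<theta>'
    proof (rule stoch_O_I)
      fix \<delta> :: real assume "0 < \<delta>"
      from bound[OF this] obtain K where K: "0 \<le> K" "\<And>n. n \<ge> 1 \<Longrightarrow> \<exists>E\<in>sets M. measure M E < \<delta> \<and>
        (\<forall>\<omega>\<in>space M - E. norm (fhat n \<omega> - f0) \<le> K * \<theta> n)" by blast
      obtain c where c: "\<And>n \<omega>. n \<ge> 1 \<Longrightarrow> norm (fhat n \<omega> - f0) \<le> K * \<theta> n \<Longrightarrow> \<bar>Z n \<omega>\<bar> \<le> ereal (c * \<theta>' n)"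
        using Z[OF K(1)] by blast
      show "\<exists>c N. \<forall>n\<ge>N. \<exists>E\<in>sets M. measure M E < \<delta> \<and> (\<forall>\<omega>\<in>space M - E. \<bar>Z n \<omega>\<bar> \<le> ereal (c * \<theta>' n))"
        by (intro exI[of _ c] exI[of _ 1]) (use K(2) c in meson)
    qed
    show "stoch_O M (\<lambda>n \<omega>. enn2ereal (hellinger \<Omega> p0 (phat n \<omega>))) \<theta>"
    proof (rule transfer)
      fix K :: real assume "0 \<le> K"
      from distance_bounds(1)[OF k_bdd this] obtain c where c: "0 \<le> c" "\<And>f t. 0 \<le> t \<Longrightarrow> t \<le> 1 \<Longrightarrow>
        norm (f - f0) \<le> K * t \<Longrightarrow> hellinger \<Omega> p0 (exp_family_density \<Omega> q0 evf f) \<le> ennreal (c * t)" by blast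
      show "\<exists>c. \<forall>n\<ge>1. \<forall>\<omega>. norm (fhat n \<omega> - f0) \<le> K * \<theta> n \<longrightarrow>
          \<bar>enn2ereal (hellinger \<Omega> p0 (phat n \<omega>))\<bar> \<le> ereal (c * \<theta> n)"
        unfolding phat using c \<theta>01 by (intro exI[of _ c] allI impI enn2ereal_abs_le) auto
    qed
    show "stoch_O M (\<lambda>n \<omega>. KL_div \<Omega> p0 (phat n \<omega>)) (\<lambda>n. (\<theta> n)\<^sup>2)"
    proof (rule transfer)
      fix K :: real assume "0 \<le> K"
      from distance_bounds(1)[OF k_bdd this] obtain c where c: "\<And>f t. 0 \<le> t \<Longrightarrow> t \<le> 1 \<Longrightarrow>
        norm (f - f0) \<le> K * t \<Longrightarrow> \<bar>KL_div \<Omega> p0 (exp_family_density \<Omega> q0 evf f)\<bar> \<le> ereal (c * t\<^sup>2)" by blast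
      show "\<exists>c. \<forall>n\<ge>1. \<forall>\<omega>. norm (fhat n \<omega> - f0) \<le> K * \<theta> n \<longrightarrow>
          \<bar>KL_div \<Omega> p0 (phat n \<omega>)\<bar> \<le> ereal (c * (\<theta> n)\<^sup>2)"
        unfolding phat using c \<theta>01 by (intro exI[of _ c] allI impI) auto
    qed
    fix r :: ennreal
    assume r: "1 < r" and q0_r: "in_Lp (restrict_space lborel \<Omega>) r q0"
    have r0: "0 < r" using r by (rule less_trans[rotated]) simp
    show "stoch_O M (\<lambda>n \<omega>. enn2ereal (Lp_norm (restrict_space lborel \<Omega>) r (\<lambda>x. phat n \<omega> x - p0 x))) \<theta>"
    proof (rule transfer)
      fix K :: real assume "0 \<le> K"
      from distance_bounds(2)[OF k_bdd this r0 q0_r] obtain c where c: "0 \<le> c" "\<And>f t. 0 \<le> t \<Longrightarrow> t \<le> 1 \<Longrightarrow>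
        norm (f - f0) \<le> K * t \<Longrightarrow>
        Lp_norm (restrict_space lborel \<Omega>) r (\<lambda>x. exp_family_density \<Omega> q0 evf f x - p0 x) \<le> ennreal (c * t)" by blast
      show "\<exists>c. \<forall>n\<ge>1. \<forall>\<omega>. norm (fhat n \<omega> - f0) \<le> K * \<theta> n \<longrightarrow>
          \<bar>enn2ereal (Lp_norm (restrict_space lborel \<Omega>) r (\<lambda>x. phat n \<omega> x - p0 x))\<bar> \<le> ereal (c * \<theta> n)"
        unfolding phat using c \<theta>01 by (intro exI[of _ c] allI impI enn2ereal_abs_le) auto
    qed
  next

    \<comment> \<open>Rate in the Fisher distance\<close>
    fix \<beta> :: real
    assume \<beta>: "0 \<le> \<beta>" and src: "f0 \<in> range (op_powr C \<beta>)"
      and lam_eq: "\<forall>n\<ge>1. lam n = real n powr (- (1 / min (2 * \<beta> + 2) (2 * \<eta>0 + 1)))"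
    have "2 powr (- (1/2)) \<le> (2::real) powr (- (1 / min (2 * \<beta> + 2) (2 * \<eta>0 + 1)))"
      using lam[of 2] lam_eq by simp
    then have "1 / min (2 * \<beta> + 2) (2 * \<eta>0 + 1) \<le> 1/2" by (simp only: powr_le_cancel_iff neg_le_iff_le one_less_numeral_iff semiring_norm)
    moreover have "0 < min (2 * \<beta> + 2) (2 * \<eta>0 + 1)" using \<beta> pos(4) by simp
    ultimately have "2 \<le> min (2 * \<beta> + 2) (2 * \<eta>0 + 1)" by (simp add: field_simps)
    then have \<eta>: "1/2 \<le> \<eta>0" by simp
    \<comment> \<open>The largest admissible exponent with b + 1/2 \<le> \<eta>0; both minima in the
      stated rate are then affine in b.\<close>
    define b where "b = min \<beta> (\<eta>0 - 1/2)"
    have b: "0 \<le> b" "b \<le> \<eta>0" "b \<le> \<beta>" "b + 1/2 \<le> \<eta>0" using \<beta> \<eta> by (auto simp: b_def)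
    have exps: "min (2 * \<beta> + 2) (2 * \<eta>0 + 1) = 2 * (b + 1)" "min (2 * \<beta> + 1) (2 * \<eta>0) = 2 * b + 1"
      by (auto simp: b_def min_def)
    have lam': "\<forall>n\<ge>1. lam n = real n powr (- (1 / (2 * (b + 1))))"
      using lam_eq unfolding exps .
    have rate: "lam n powr (2 * b + 1) = real n powr (- ((2 * b + 1) / (2 * (b + 1))))" if "n \<ge> 1" for n
      unfolding lam'[rule_format, OF that] powr_powr by simp
    show "stoch_O M (\<lambda>n \<omega>. enn2ereal (fisher_divergence \<Omega> p0 (phat n \<omega>)))
          (\<lambda>n. real n powr (- (min (2 * \<beta> + 1) (2 * \<eta>0) / min (2 * \<beta> + 2) (2 * \<eta>0 + 1))))"
      unfolding exps
    proof (rule stoch_O_I)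
      fix \<delta> :: real assume "0 < \<delta>"
      from error_bounds[OF b(1-3) src[unfolded C] lam' this] obtain K where
        K: "\<And>n. n \<ge> 1 \<Longrightarrow> \<exists>E\<in>sets M. measure M E < \<delta> \<and> (\<forall>\<omega>\<in>space M - E.
          (fhat n \<omega> - f0) \<bullet> avg \<mu> (fhat n \<omega> - f0) \<le> K * lam n powr (2 * b + 1))"
        using b(4) unfolding err by blast
      show "\<exists>c N. \<forall>n\<ge>N. \<exists>E\<in>sets M. measure M E < \<delta> \<and> (\<forall>\<omega>\<in>space M - E.
          \<bar>enn2ereal (fisher_divergence \<Omega> p0 (phat n \<omega>))\<bar>
            \<le> ereal (c * real n powr (- ((2 * b + 1) / (2 * (b + 1))))))"
        by (intro exI[of _ K] exI[of _ 1]) (use K fisher rate in metis)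
    qed
  next

    \<comment> \<open>Rates for a boundedly invertible population operator\<close>
    fix \<theta>
    assume inv: "boundedly_invertible C" and lam_eq: "\<forall>n\<ge>1. lam n = real n powr (- (1 / min 2 (2 * \<eta>0)))"
      and \<theta>: "\<forall>n. \<theta> n = real n powr (- (1/2))"
    have "2 powr (- (1/2)) \<le> (2::real) powr (- (1 / min 2 (2 * \<eta>0)))"
      using lam[of 2] lam_eq by simp
    then have "1 / min 2 (2 * \<eta>0) \<le> 1/2" by (simp only: powr_le_cancel_iff neg_le_iff_le one_less_numeral_iff semiring_norm)
    moreover have "0 < min 2 (2 * \<eta>0)" using pos(4) by simp
    ultimately have "2 \<le> min 2 (2 * \<eta>0)" by (simp add: field_simps)
    then have \<eta>: "1 \<le> \<eta>0" by simp
    have lam': "\<forall>n\<ge>1. lam n = real n powr (- (1/2))" using lam_eq \<eta> by simp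
    have bound: "\<exists>K\<ge>0. \<exists>N. \<forall>n\<ge>N. \<exists>E\<in>sets M. measure M E < \<delta> \<and>
        (\<forall>\<omega>\<in>space M - E. norm (fhat n \<omega> - f0) \<le> K * \<theta> n)" if "0 < \<delta>" for \<delta>
      using error_bounds_invertible[OF inv[unfolded C] \<eta> lam' that] unfolding err \<theta>[rule_format] .
    show "stoch_O M (\<lambda>n \<omega>. ereal (norm (fhat n \<omega> - f0))) \<theta>"
    proof (rule stoch_O_I)
      fix \<delta> :: real assume "0 < \<delta>"
      from bound[OF this] show "\<exists>c N. \<forall>n\<ge>N. \<exists>E\<in>sets M. measure M E < \<delta> \<and>
        (\<forall>\<omega>\<in>space M - E. \<bar>ereal (norm (fhat n \<omega> - f0))\<bar> \<le> ereal (c * \<theta> n))" by auto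
    qed
    show "stoch_O M (\<lambda>n \<omega>. enn2ereal (fisher_divergence \<Omega> p0 (phat n \<omega>))) (\<lambda>n. (\<theta> n)\<^sup>2)"
    proof (rule stoch_O_I)
      fix \<delta> :: real assume "0 < \<delta>"
      from bound[OF this] obtain K N where K: "0 \<le> K" "\<And>n. n \<ge> N \<Longrightarrow> \<exists>E\<in>sets M. measure M E < \<delta> \<and>
        (\<forall>\<omega>\<in>space M - E. norm (fhat n \<omega> - f0) \<le> K * \<theta> n)" by blast
      \<comment> \<open>The operator is bounded by \<open>chi_k\<close>, so the squared norm rate
        passes directly to the Fisher distance.\<close>
      have "\<bar>enn2ereal (fisher_divergence \<Omega> p0 (phat n \<omega>))\<bar> \<le> ereal (chi_k * K\<^sup>2 * (\<theta> n)\<^sup>2)"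
        if "norm (fhat n \<omega> - f0) \<le> K * \<theta> n" for n \<omega>
      proof (rule fisher)
        have "(fhat n \<omega> - f0) \<bullet> avg \<mu> (fhat n \<omega> - f0) \<le> chi_k * (norm (fhat n \<omega> - f0))\<^sup>2"
          by (rule avg_le[OF \<mu>.prob_space_axioms sets_\<mu>])
        also have "\<dots> \<le> chi_k * (K * \<theta> n)\<^sup>2"
          using that chi_nonneg by (intro mult_left_mono power_mono) auto
        finally show "(fhat n \<omega> - f0) \<bullet> avg \<mu> (fhat n \<omega> - f0) \<le> chi_k * K\<^sup>2 * (\<theta> n)\<^sup>2"
          by (simp add: power_mult_distrib mult.assoc)
      qed
      then show "\<exists>c N. \<forall>n\<ge>N. \<exists>E\<in>sets M. measure M E < \<delta> \<and> (\<forall>\<omega>\<in>space M - E.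
          \<bar>enn2ereal (fisher_divergence \<Omega> p0 (phat n \<omega>))\<bar> \<le> ereal (c * (\<theta> n)\<^sup>2))"
        by (intro exI[of _ "chi_k * K\<^sup>2"] exI[of _ N]) (use K(2) in meson)
    qed
  qed
qed

end
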